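(* Let $\{X_m\}$ be the $a$th Hopf-power Markov chain ($a\ge2$) on a free-commutative state space basis $\mathcal{B}_n$ (the degree $n$ part of a free-commutative state space basis $\mathcal{B}$ of a graded connected commutative Hopf algebra over $\mathbb{R}$ with finite-dimensional graded pieces). Fix a state $y\in\mathcal{B}_n$ with factorisation into generators $y=c_1\cdots c_l$, $l=l(y)$, and let $\mathbf{f}_y:\mathcal{B}_n\to\mathbb{R}$ be $$\mathbf{f}_y(x):=\frac{1}{l!\,Z(y)\,\eta(x)}\sum_{\sigma\in\mathfrak{S}_l}\eta_x^{c_{\sigma(1)},\dots,c_{\sigma(l)}}.$$ Then the probability that the chain can still reach $y$ after $m$ steps satisfies: (i) $\displaystyle P\{X_m\to y\mid X_0=x_0\}\le\frac{a^{(l(y)-n)m}\mathbf{f}_y(x_0)}{\min_{x\in\mathcal{B}_n,\,x\to y}\mathbf{f}_y(x)}=\frac{a^{(l(y)-n)m}\frac{1}{\eta(x_0)}\sum_{\sigma\in\mathfrak{S}_l}\eta_{x_0}^{c_{\sigma(1)},\dots,c_{\sigma(l)}}}{\min_{x\in\mathcal{B}_n,\,x\to y}\frac{1}{\eta(x)}\sum_{\sigma\in\mathfrak{S}_l}\eta_x^{c_{\sigma(1)},\dots,c_{\sigma(l)}}}$ for every $x_0\in\mathcal{B}_n$ and $m\ge0$; (ii) $\displaystyle P\{X_m\to y\mid X_0=x_0\}=\eta(y)\,a^{(l(y)-n)m}\,\mathbf{f}_y(x_0)\,(1+o(1))$ as $m\to\infty$; (iii) for any starting distribution, $\displaystyle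 P\{X_m\to y\}\le\frac{a^{(l(y)-n)m}}{\min_{x\in\mathcal{B}_n,\,x\to y}\mathbf{f}_y(x)\,Z(y)}\cdot\frac{1}{\eta(y)}\binom{n}{\deg c_1\ \dots\ \deg c_l}$.
   Context: A graded connected Hopf algebra over $\mathbb{R}$ is $\mathcal{H}=\bigoplus_{n\ge0}\mathcal{H}_n$ with $\mathcal{H}_0=\mathbb{R}\cdot1$, an associative unital product $\mathcal{H}_i\otimes\mathcal{H}_j\to\mathcal{H}_{i+j}$ and a coassociative coproduct $\Delta:\mathcal{H}_n\to\bigoplus_{j=0}^n\mathcal{H}_j\otimes\mathcal{H}_{n-j}$ with $\Delta(x)-1\otimes x-x\otimes1\in\bigoplus_{j=1}^{n-1}\mathcal{H}_j\otimes\mathcal{H}_{n-j}$ for $x\in\mathcal{H}_n$ ($n\ge1$), $\Delta(1)=1\otimes1$, and $\Delta(wz)=\Delta(w)\Delta(z)$. $\Psi^a:=m^{[a]}\Delta^{[a]}$ is the $a$-fold coproduct followed by the $a$-fold product. For a basis $\mathcal{B}=\amalg_n\mathcal{B}_n$ ($\mathcal{B}_n$ a basis of $\mathcal{H}_n$, $\mathcal{B}_0=\{1\}$), structure constants are defined by $z_1\cdots z_a=\sum_{y}\xi^y_{z_1,\dots,z_a}y$ and $\Delta^{[a]}(x)=\sum_{z_1,\dots,z_a\in\mathcal{B}}\eta_x^{z_1,\dots,z_a}z_1\otimes\cdots\otimes z_a$. $\mathcal{B}$ is a state space basis if all $\xi^y_{w,z}\ge0$, all $\eta_x^{w,z}\ge0$,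 and no $x\in\mathcal{B}$ with $\deg x>1$ satisfies $\Delta(x)=1\otimes x+x\otimes1$. $\mathcal{B}$ is free-commutative if $\mathcal{H}$ is commutative and there is a set $\mathcal{C}$ of homogeneous elements of positive degree (the free generators) such that $\mathcal{H}$ is the polynomial algebra on $\mathcal{C}$ and $\mathcal{B}$ consists of all products $c_1\cdots c_l$, $l\ge0$, $\{c_1,\dots,c_l\}$ a multiset in $\mathcal{C}$. The length $l(x)$ of $x\in\mathcal{B}$ is the number of factors in its factorisation into generators. The rescaling function is $\eta(x):=\sum_{c_1,\dots,c_n\in\mathcal{B}_1}\eta_x^{c_1,\dots,c_n}$ for $x\in\mathcal{B}_n$ (strictly positive). The $a$th Hopf-power Markov chain on $\mathcal{B}_n$ has transition matrix $\check K_{a,n}$ defined by $a^{-n}\Psi^a(x)=\sum_{y\in\mathcal{B}_n}\frac{\eta(x)}{\eta(y)}\check K_{a,n}(x,y)\,y$ for $x\in\mathcal{B}_n$. For $x,x'\in\mathcal{B}$, write $x\to x'$ if $x'$ appears with non-zero coefficient in $\Psi^{b}(x)$ (expanded in $\mathcal{B}$) for some integer $b\ge1$. $Z(y)$ is the number of permutations in $\mathfrak{S}_l$ fixing the tuple $(c_1,\dots,c_l)$. *)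

theory Defs
  imports "HOL-Probability.Probability" "HOL-Analysis.Finite_Function_Topology"
begin

section \<open>Tensor powers of a real vector space\<close>

text \<open>
  All tensor powers of a vector space live in one type, the quotient of the free real vector space
  on lists of vectors by the relations of multilinearity. The class of a list of length \<open>a\<close> is an
  elementary tensor of the \<open>a\<close>-th tensor power, and the \<open>a\<close>-th tensor power is the span of these.
\<close>

definition multilinear_relations :: "('a::real_vector list \<Rightarrow>\<^sub>0 real) set" where
  "multilinear_relations =
     {Poly_Mapping.single (us @ (x + y) # vs) 1 - Poly_Mapping.single (us @ x # vs) 1
        - Poly_Mapping.single (us @ y # vs) 1 | us x y vs. True} \<union>
     {Poly_Mapping.single (us @ (r *\<^sub>R x) # vs) 1 - r *\<^sub>R Poly_Mapping.single (us @ x # vs) 1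
        | us r x vs. True}"

quotient_type (overloaded) 'a tensor = "'a::real_vector list \<Rightarrow>\<^sub>0 real" /
  "\<lambda>p q. p - q \<in> span multilinear_relations"
proof (rule equivpI)
  let ?N = "span multilinear_relations :: ('a list \<Rightarrow>\<^sub>0 real) set"
  show "reflp (\<lambda>p q. p - q \<in> ?N)"
    by (simp add: reflp_def span_zero)
  show "symp (\<lambda>p q. p - q \<in> ?N)"
  proof (rule sympI)
    fix p q assume "p - q \<in> ?N"
    then have "- (p - q) \<in> ?N" by (rule span_neg)
    then show "q - p \<in> ?N" by simp
  qed
  show "transp (\<lambda>p q. p - q \<in> ?N)"
  proof (rule transpI)
    fix p q r assume "p - q \<in> ?N" "q - r \<in> ?N"
    then have "(p - q) + (q - r) \<in> ?N" by (rule span_add)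
    then show "p - r \<in> ?N" by simp
  qed
qed

instantiation tensor :: (real_vector) real_vector
begin

lift_definition zero_tensor :: "'a tensor" is 0 .

lift_definition plus_tensor :: "'a tensor \<Rightarrow> 'a tensor \<Rightarrow> 'a tensor" is "(+)"
proof -
  fix p q r s :: "'a list \<Rightarrow>\<^sub>0 real"
  assume "p - q \<in> span multilinear_relations" "r - s \<in> span multilinear_relations"
  then have "(p - q) + (r - s) \<in> span multilinear_relations" by (rule span_add)
  then show "p + r - (q + s) \<in> span multilinear_relations" by (simp add: algebra_simps)
qed

lift_definition uminus_tensor :: "'a tensor \<Rightarrow> 'a tensor" is uminus
proof -
  fix p q :: "'a list \<Rightarrow>\<^sub>0 real"
  assume "p - q \<in> span multilinear_relations"
  then have "- (p - q) \<in> span multilinear_relations" by (rule span_neg)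
  then show "- p - - q \<in> span multilinear_relations" by simp
qed

lift_definition minus_tensor :: "'a tensor \<Rightarrow> 'a tensor \<Rightarrow> 'a tensor" is "(-)"
proof -
  fix p q r s :: "'a list \<Rightarrow>\<^sub>0 real"
  assume "p - q \<in> span multilinear_relations" "r - s \<in> span multilinear_relations"
  then have "(p - q) - (r - s) \<in> span multilinear_relations" by (rule span_diff)
  then show "p - r - (q - s) \<in> span multilinear_relations" by (simp add: algebra_simps)
qed

lift_definition scaleR_tensor :: "real \<Rightarrow> 'a tensor \<Rightarrow> 'a tensor" is "(*\<^sub>R)"
  by (simp flip: scaleR_diff_right add: span_scale)

instance
  by standard (transfer; simp add: span_zero algebra_simps)+

end

lift_definition tens :: "'a::real_vector list \<Rightarrow> 'a tensor" is "\<lambda>us. Poly_Mapping.single us 1" .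

definition multilinear :: "('a::real_vector list \<Rightarrow> 'b::real_vector) \<Rightarrow> bool" where
  "multilinear f \<longleftrightarrow>
     (\<forall>us x y vs. f (us @ (x + y) # vs) = f (us @ x # vs) + f (us @ y # vs)) \<and>
     (\<forall>us r x vs. f (us @ (r *\<^sub>R x) # vs) = r *\<^sub>R f (us @ x # vs))"

text \<open>
  The linear extension of a multilinear map; the lemmas below show that it exists and is unique.
\<close>

definition tensor_lift :: "('a::real_vector list \<Rightarrow> 'b::real_vector) \<Rightarrow> 'a tensor \<Rightarrow> 'b" where
  "tensor_lift f = (THE g. linear g \<and> (\<forall>us. g (tens us) = f us))"

lemma multilinear_tens: "multilinear tens"
  unfolding multilinear_def
proof (intro conjI allI)
  fix us :: "'a list" and x y vs
  show "tens (us @ (x + y) # vs) = tens (us @ x # vs) + tens (us @ y # vs)"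
    by transfer (rule span_base, auto simp: multilinear_relations_def diff_diff_eq)
next
  fix us :: "'a list" and r x vs
  show "tens (us @ (r *\<^sub>R x) # vs) = r *\<^sub>R tens (us @ x # vs)"
    by transfer (rule span_base, unfold multilinear_relations_def, rule UnI2, blast)
qed

lemma lookup_scaleR: "Poly_Mapping.lookup (r *\<^sub>R p) k = r *\<^sub>R Poly_Mapping.lookup p k"
proof -
  have "{i. r *\<^sub>R Poly_Mapping.lookup p i \<noteq> 0} \<subseteq> Poly_Mapping.keys p"
    by (auto simp: in_keys_iff)
  then have "finite {i. r *\<^sub>R Poly_Mapping.lookup p i \<noteq> 0}"
    by (rule finite_subset) simp
  then show ?thesis by (simp add: scaleR_poly_mapping_def)
qed

lemma abs_tensor_eq_sum:
  "abs_tensor p = (\<Sum>us\<in>Poly_Mapping.keys p. Poly_Mapping.lookup p us *\<^sub>R tens us)"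
proof -
  have abs_sum: "abs_tensor (\<Sum>i\<in>A. f i) = (\<Sum>i\<in>A. abs_tensor (f i))" if "finite A"
    for A :: "'a list set" and f :: "'a list \<Rightarrow> 'a list \<Rightarrow>\<^sub>0 real"
    using that by (induction A rule: finite_induct)
      (simp_all add: zero_tensor.abs_eq flip: plus_tensor.abs_eq)
  have "p = (\<Sum>us\<in>Poly_Mapping.keys p. Poly_Mapping.lookup p us *\<^sub>R Poly_Mapping.single us 1)"
  proof (rule poly_mapping_eqI)
    fix k
    have "Poly_Mapping.lookup (\<Sum>us\<in>Poly_Mapping.keys p. Poly_Mapping.lookup p us *\<^sub>R Poly_Mapping.single us 1) k =
      (\<Sum>us\<in>Poly_Mapping.keys p. if us = k then Poly_Mapping.lookup p us else 0)"
      unfolding lookup_sum by (rule sum.cong) (auto simp: lookup_scaleR lookup_single)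
    then show "Poly_Mapping.lookup p k =
      Poly_Mapping.lookup (\<Sum>us\<in>Poly_Mapping.keys p. Poly_Mapping.lookup p us *\<^sub>R Poly_Mapping.single us 1) k"
      by (simp add: in_keys_iff)
  qed
  then have "abs_tensor p =
      abs_tensor (\<Sum>us\<in>Poly_Mapping.keys p. Poly_Mapping.lookup p us *\<^sub>R Poly_Mapping.single us 1)"
    by simp
  also have "\<dots> = (\<Sum>us\<in>Poly_Mapping.keys p. Poly_Mapping.lookup p us *\<^sub>R tens us)"
    by (subst abs_sum) (simp_all add: tens.abs_eq scaleR_tensor.abs_eq)
  finally show ?thesis .
qed

lemma abs_tensor_surj: "\<exists>p. t = abs_tensor p"
  by (induction t rule: tensor.abs_induct) blast

lemma tensor_linear_unique:
  fixes g h :: "'a::real_vector tensor \<Rightarrow> 'b::real_vector"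
  assumes "linear g" "linear h" "\<And>us. g (tens us) = h (tens us)"
  shows "g = h"
proof
  fix t :: "'a tensor"
  obtain p where "t = abs_tensor p" using abs_tensor_surj by blast
  then show "g t = h t"
    by (simp add: abs_tensor_eq_sum linear_sum[OF assms(1)] linear_sum[OF assms(2)]
        linear_scale[OF assms(1)] linear_scale[OF assms(2)] assms(3))
qed

lemma tensor_linear_exists:
  assumes "multilinear (f :: 'a::real_vector list \<Rightarrow> 'b::real_vector)"
  shows "\<exists>g. linear g \<and> (\<forall>us. g (tens us) = f us)"
proof -
  define G where "G p = (\<Sum>us\<in>Poly_Mapping.keys p. Poly_Mapping.lookup p us *\<^sub>R f us)"
    for p :: "'a list \<Rightarrow>\<^sub>0 real"
  have G_super: "G p = (\<Sum>us\<in>A. Poly_Mapping.lookup p us *\<^sub>R f us)"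
    if "finite A" "Poly_Mapping.keys p \<subseteq> A" for A p
    unfolding G_def using that by (intro sum.mono_neutral_left) (auto simp: in_keys_iff)
  have G: "linear G"
  proof
    fix p q :: "'a list \<Rightarrow>\<^sub>0 real" and r :: real
    let ?A = "Poly_Mapping.keys p \<union> Poly_Mapping.keys q"
    have "Poly_Mapping.keys (p + q) \<subseteq> ?A" by (rule Poly_Mapping.keys_add)
    then show "G (p + q) = G p + G q"
      by (simp add: G_super[of ?A] lookup_add scaleR_left_distrib sum.distrib)
    have "Poly_Mapping.keys (r *\<^sub>R p) \<subseteq> Poly_Mapping.keys p" by (auto simp: in_keys_iff lookup_scaleR)
    then show "G (r *\<^sub>R p) = r *\<^sub>R G p"
      by (simp add: G_super[of "Poly_Mapping.keys p"] scaleR_sum_right lookup_scaleR)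
  qed
  have G_single: "G (Poly_Mapping.single us 1) = f us" for us
    by (simp add: G_def)
  have "G p = 0" if "p \<in> multilinear_relations" for p
    using that assms
    by (auto simp: multilinear_relations_def multilinear_def linear_diff[OF G] linear_scale[OF G] G_single)
  then have G0: "G p = 0" if "p \<in> span multilinear_relations" for p
    using linear_eq_0_on_span[OF G] that by blast
  define g where "g t = G (rep_tensor t)" for t
  have g: "g (abs_tensor p) = G p" for p
  proof -
    have "rep_tensor (abs_tensor p) - p \<in> span multilinear_relations"
      using Quotient_rep_abs[OF Quotient_tensor, of p] by (simp add: span_zero)
    then have "G (rep_tensor (abs_tensor p) - p) = 0" by (rule G0)
    then show ?thesis by (simp add: g_def linear_diff[OF G])
  qed
  have "linear g"
  proof
    fix s t :: "'a tensor" and r :: real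
    obtain p q where "s = abs_tensor p" "t = abs_tensor q" using abs_tensor_surj by metis
    then show "g (s + t) = g s + g t" "g (r *\<^sub>R s) = r *\<^sub>R g s"
      by (simp_all add: plus_tensor.abs_eq scaleR_tensor.abs_eq g linear_add[OF G] linear_scale[OF G])
  qed
  moreover have "g (tens us) = f us" for us
    by (simp add: tens.abs_eq g G_single)
  ultimately show ?thesis by blast
qed

lemma
  assumes "multilinear f"
  shows linear_tensor_lift: "linear (tensor_lift f)"
    and tensor_lift_tens: "tensor_lift f (tens us) = f us"
proof -
  have "\<exists>!g. linear g \<and> (\<forall>us. g (tens us) = f us)"
  proof (rule ex_ex1I)
    show "\<exists>g. linear g \<and> (\<forall>us. g (tens us) = f us)" by (rule tensor_linear_exists[OF assms])
    show "g = h" if "linear g \<and> (\<forall>us. g (tens us) = f us)" "linear h \<and> (\<forall>us. h (tens us) = f us)"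
      for g h using that by (intro tensor_linear_unique) auto
  qed
  from theI'[OF this] show "linear (tensor_lift f)" "tensor_lift f (tens us) = f us"
    by (simp_all add: tensor_lift_def)
qed

definition tensor_append :: "'a::real_vector tensor \<Rightarrow> 'a tensor \<Rightarrow> 'a tensor" (infixr "\<otimes>\<^sub>t" 70) where
  "s \<otimes>\<^sub>t t = tensor_lift (\<lambda>us. tensor_lift (\<lambda>vs. tens (us @ vs)) t) s"

text \<open>The product of the algebra structure on each tensor power; tensors of different orders have product zero.\<close>

definition tensor_mult :: "'a::real_algebra_1 tensor \<Rightarrow> 'a tensor \<Rightarrow> 'a tensor" where
  "tensor_mult s t = tensor_lift (\<lambda>us. tensor_lift
     (\<lambda>vs. if length us = length vs then tens (map2 (*) us vs) else 0) t) s"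

section \<open>Graded connected Hopf algebras\<close>

text \<open>
  The algebra is the whole type and \<open>H n\<close> is its homogeneous part of degree \<open>n\<close>. Counit and antipode
  are not part of the data: grading and connectedness determine them.
\<close>

definition graded_vector_space :: "(nat \<Rightarrow> 'h::real_vector set) \<Rightarrow> bool" where
  "graded_vector_space H \<longleftrightarrow> (\<forall>n. subspace (H n)) \<and>
     (\<forall>x. \<exists>!f. (\<forall>n. f n \<in> H n) \<and> finite {n. f n \<noteq> 0} \<and> x = (\<Sum>n | f n \<noteq> 0. f n))"

definition graded_connected_Hopf_algebra ::
  "(nat \<Rightarrow> 'h::real_algebra_1 set) \<Rightarrow> ('h \<Rightarrow> 'h tensor) \<Rightarrow> bool" where
  "graded_connected_Hopf_algebra H \<Delta> \<longleftrightarrow>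
     graded_vector_space H \<and>
     H 0 = span {1} \<and>
     (\<forall>i j. \<forall>w\<in>H i. \<forall>z\<in>H j. w * z \<in> H (i + j)) \<and>
     linear \<Delta> \<and>
     (\<forall>n. \<forall>x\<in>H n. \<Delta> x \<in> span {tens [u, v] | u v j. j \<le> n \<and> u \<in> H j \<and> v \<in> H (n - j)}) \<and>
     (\<forall>n\<ge>1. \<forall>x\<in>H n. \<Delta> x - tens [1, x] - tens [x, 1] \<in>
        span {tens [u, v] | u v j. 1 \<le> j \<and> j < n \<and> u \<in> H j \<and> v \<in> H (n - j)}) \<and>
     \<Delta> 1 = tens [1, 1] \<and>
     (\<forall>w z. \<Delta> (w * z) = tensor_mult (\<Delta> w) (\<Delta> z)) \<and>
     (\<forall>x. tensor_lift (\<lambda>us. case us of [u, v] \<Rightarrow> \<Delta> u \<otimes>\<^sub>t tens [v] | _ \<Rightarrow> 0) (\<Delta> x) =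
          tensor_lift (\<lambda>us. case us of [u, v] \<Rightarrow> tens [u] \<otimes>\<^sub>t \<Delta> v | _ \<Rightarrow> 0) (\<Delta> x))"

definition counit :: "('h::real_vector \<Rightarrow> 'h tensor) \<Rightarrow> 'h \<Rightarrow> real" where
  "counit \<Delta> = (THE e. linear e \<and> (\<forall>x.
     tensor_lift (\<lambda>us. case us of [u, v] \<Rightarrow> e u *\<^sub>R v | _ \<Rightarrow> 0) (\<Delta> x) = x \<and>
     tensor_lift (\<lambda>us. case us of [u, v] \<Rightarrow> e v *\<^sub>R u | _ \<Rightarrow> 0) (\<Delta> x) = x))"

text \<open>
  The \<open>a\<close>-fold coproduct takes values in the \<open>a\<close>-th tensor power, so it is the identity for
  \<open>a = 1\<close>, the coproduct for \<open>a = 2\<close>, and the counit for \<open>a = 0\<close>. Only degree zero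
  uses the last case.
\<close>

fun iter_coproduct :: "('h::real_vector \<Rightarrow> 'h tensor) \<Rightarrow> nat \<Rightarrow> 'h \<Rightarrow> 'h tensor" where
  "iter_coproduct \<Delta> 0 x = counit \<Delta> x *\<^sub>R tens []"
| "iter_coproduct \<Delta> (Suc 0) x = tens [x]"
| "iter_coproduct \<Delta> (Suc (Suc k)) x =
     tensor_lift (\<lambda>us. if us = [] then 0 else tens (butlast us) \<otimes>\<^sub>t \<Delta> (last us))
       (iter_coproduct \<Delta> (Suc k) x)"

definition iter_product :: "'h::real_algebra_1 tensor \<Rightarrow> 'h" where
  "iter_product = tensor_lift prod_list"

definition hopf_power :: "('h::real_algebra_1 \<Rightarrow> 'h tensor) \<Rightarrow> nat \<Rightarrow> 'h \<Rightarrow> 'h" where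
  "hopf_power \<Delta> a x = iter_product (iter_coproduct \<Delta> a x)"

section \<open>State space bases\<close>

definition graded_basis :: "(nat \<Rightarrow> 'h::real_algebra_1 set) \<Rightarrow> (nat \<Rightarrow> 'h set) \<Rightarrow> bool" where
  "graded_basis H B \<longleftrightarrow> B 0 = {1} \<and> (\<forall>n. independent (B n) \<and> span (B n) = H n)"

definition product_coeff :: "(nat \<Rightarrow> 'h::real_algebra_1 set) \<Rightarrow> 'h list \<Rightarrow> 'h \<Rightarrow> real" where
  "product_coeff B zs y = representation (\<Union>n. B n) (prod_list zs) y"

definition coproduct_coeff ::
  "('h::real_algebra_1 \<Rightarrow> 'h tensor) \<Rightarrow> (nat \<Rightarrow> 'h set) \<Rightarrow> 'h \<Rightarrow> 'h list \<Rightarrow> real" where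
  "coproduct_coeff \<Delta> B x zs =
     representation (tens ` {us. length us = length zs \<and> set us \<subseteq> (\<Union>n. B n)})
       (iter_coproduct \<Delta> (length zs) x) (tens zs)"

definition state_space_basis ::
  "(nat \<Rightarrow> 'h::real_algebra_1 set) \<Rightarrow> ('h \<Rightarrow> 'h tensor) \<Rightarrow> (nat \<Rightarrow> 'h set) \<Rightarrow> bool" where
  "state_space_basis H \<Delta> B \<longleftrightarrow> graded_basis H B \<and>
     (\<forall>w\<in>(\<Union>n. B n). \<forall>z\<in>(\<Union>n. B n). \<forall>y\<in>(\<Union>n. B n). product_coeff B [w, z] y \<ge> 0) \<and>
     (\<forall>x\<in>(\<Union>n. B n). \<forall>w\<in>(\<Union>n. B n). \<forall>z\<in>(\<Union>n. B n). coproduct_coeff \<Delta> B x [w, z] \<ge> 0) \<and>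
     (\<forall>n>1. \<forall>x\<in>B n. \<Delta> x \<noteq> tens [1, x] + tens [x, 1])"

text \<open>
  Commutativity of the algebra is expressed by the sort. That it is the polynomial algebra on \<open>C\<close>
  means that the monomials, one for each finite multiset in \<open>C\<close>, form a basis of it.
\<close>

definition free_polynomial_generators :: "'h::{real_algebra_1, comm_ring_1} set \<Rightarrow> bool" where
  "free_polynomial_generators C \<longleftrightarrow>
     inj_on prod_mset {S. set_mset S \<subseteq> C} \<and>
     independent (prod_mset ` {S. set_mset S \<subseteq> C}) \<and>
     span (prod_mset ` {S. set_mset S \<subseteq> C}) = UNIV"

definition free_commutative_basis ::
  "(nat \<Rightarrow> 'h::{real_algebra_1, comm_ring_1} set) \<Rightarrow> (nat \<Rightarrow> 'h set) \<Rightarrow> 'h set \<Rightarrow> bool" where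
  "free_commutative_basis H B C \<longleftrightarrow>
     (\<forall>c\<in>C. \<exists>d>0. c \<in> H d) \<and>
     free_polynomial_generators C \<and>
     (\<Union>n. B n) = prod_mset ` {S. set_mset S \<subseteq> C}"

definition basis_degree :: "(nat \<Rightarrow> 'h set) \<Rightarrow> 'h \<Rightarrow> nat" where
  "basis_degree B x = (THE n. x \<in> B n)"

definition rescaling ::
  "('h::real_algebra_1 \<Rightarrow> 'h tensor) \<Rightarrow> (nat \<Rightarrow> 'h set) \<Rightarrow> 'h \<Rightarrow> real" where
  "rescaling \<Delta> B x =
     (\<Sum>cs | length cs = basis_degree B x \<and> set cs \<subseteq> B 1. coproduct_coeff \<Delta> B x cs)"

section \<open>Hopf-power Markov chains\<close>

text \<open>
  The defining equation determines \<open>K\<close> on \<open>B n\<close>, because \<open>B n\<close> is a basis and the rescaling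
  function is positive.
\<close>

definition Hopf_power_transition_matrix ::
  "('h::real_algebra_1 \<Rightarrow> 'h tensor) \<Rightarrow> (nat \<Rightarrow> 'h set) \<Rightarrow> nat \<Rightarrow> nat \<Rightarrow> ('h \<Rightarrow> 'h \<Rightarrow> real) \<Rightarrow> bool"
  where
  "Hopf_power_transition_matrix \<Delta> B a n K \<longleftrightarrow> (\<forall>x\<in>B n.
     (1 / real a ^ n) *\<^sub>R hopf_power \<Delta> a x =
       (\<Sum>y\<in>B n. (rescaling \<Delta> B x / rescaling \<Delta> B y * K x y) *\<^sub>R y))"

definition Markov_chain ::
  "'w measure \<Rightarrow> 's set \<Rightarrow> ('s \<Rightarrow> 's \<Rightarrow> real) \<Rightarrow> (nat \<Rightarrow> 'w \<Rightarrow> 's) \<Rightarrow> bool" where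
  "Markov_chain M S K X \<longleftrightarrow> prob_space M \<and>
     (\<forall>m. X m \<in> measurable M (count_space S)) \<and>
     (\<forall>m s t. t \<in> S \<longrightarrow> \<P>(\<omega> in M. \<forall>i\<le>m. X i \<omega> = s i) > 0 \<longrightarrow>
        \<P>(\<omega> in M. X (Suc m) \<omega> = t \<bar> \<forall>i\<le>m. X i \<omega> = s i) = K (s m) t)"

definition reaches ::
  "('h::real_algebra_1 \<Rightarrow> 'h tensor) \<Rightarrow> (nat \<Rightarrow> 'h set) \<Rightarrow> 'h \<Rightarrow> 'h \<Rightarrow> bool" where
  "reaches \<Delta> B x x' \<longleftrightarrow> (\<exists>b\<ge>1. representation (\<Union>n. B n) (hopf_power \<Delta> b x) x' \<noteq> 0)"

text \<open>
  In the next three definitions the list \<open>cs\<close> is the factorisation of a basis element into free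
  generators.
\<close>

definition symmetrised_coeff ::
  "('h::real_algebra_1 \<Rightarrow> 'h tensor) \<Rightarrow> (nat \<Rightarrow> 'h set) \<Rightarrow> 'h list \<Rightarrow> 'h \<Rightarrow> real" where
  "symmetrised_coeff \<Delta> B cs x =
     (\<Sum>\<sigma> | \<sigma> permutes {..<length cs}. coproduct_coeff \<Delta> B x (permute_list \<sigma> cs))"

definition stabiliser_size :: "'h list \<Rightarrow> nat" where
  "stabiliser_size cs = card {\<sigma>. \<sigma> permutes {..<length cs} \<and> permute_list \<sigma> cs = cs}"

definition absorption_fn ::
  "('h::real_algebra_1 \<Rightarrow> 'h tensor) \<Rightarrow> (nat \<Rightarrow> 'h set) \<Rightarrow> 'h list \<Rightarrow> 'h \<Rightarrow> real" where
  "absorption_fn \<Delta> B cs x =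
     1 / (fact (length cs) * real (stabiliser_size cs) * rescaling \<Delta> B x) * symmetrised_coeff \<Delta> B cs x"

end

theory Submission
  imports Defs "HOL-Combinatorics.Multiset_Permutations"
begin

text \<open>
  Linear functionals on the Hopf algebra form a monoid under convolution, and the coefficient
  \<open>\<eta>\<^sub>x\<^bsup>z\<^sub>1,\<dots>,z\<^sub>a\<^esup>\<close> is the value at \<open>x\<close> of the convolution of the dual basis functionals of
  \<open>z\<^sub>1, \<dots>, z\<^sub>a\<close>. The functional dual to a free generator is an infinitesimal character, so the
  symmetrised convolution of \<open>l\<close> of them is an eigenvector of \<open>\<Psi>\<^sup>a\<close> with eigenvalue \<open>a\<^sup>l\<close>. Hence
  \<open>\<^bold>f\<^sub>y\<close> is a non-negative right eigenfunction of the chain with eigenvalue \<open>a\<^bsup>l(y)-n\<^esup>\<close>. It is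
  positive on the states that can reach \<open>y\<close>, which gives the bound (i) by Markov's inequality. On a product of
  generators it vanishes unless the product is \<open>y\<close> or has fewer than \<open>l(y)\<close> factors. A state \<open>z\<close> with
  fewer factors is visited at time \<open>m\<close> with probability \<open>O(a\<^bsup>(l(z)-n)m\<^esup>)\<close>, as one sees from the
  eigenfunction of \<open>z\<close> itself, so only \<open>y\<close> contributes to the leading term in (ii). For (iii), the
  rescaling function is the convolution power of the sum of the functionals dual to \<open>\<B>\<^sub>1\<close>; comparing convolutions of
  non-negative functionals bounds \<open>\<^bold>f\<^sub>y\<close>.
\<close>

section \<open>Linear maps on tensors\<close>

text \<open>The symmetrisation is forced: for infinitesimal characters \<open>d1\<close>,
  \<open>d2\<close>, composing \<open>d1 \<star> d2\<close> with the second Hopf power gives 3 times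
  \<open>d1 \<star> d2\<close> plus \<open>d2 \<star> d1\<close>, which need not be a multiple of
  \<open>d1 \<star> d2\<close>. After summing over all orders the factor 4 comes out, without
  cocommutativity. Convolution is set up for maps into an arbitrary algebra. Real values give the
  coproduct coefficients, and the identity map of the algebra has the Hopf powers as its convolution
  powers, so one calculus serves both. Coassociativity enters once, as associativity of convolution.
  Reachability of \<open>y\<close> may be witnessed by a Hopf power \<open>b\<close> unrelated to
  the chain parameter \<open>a\<close>. This causes no trouble because the functional behind the
  eigenfunction is an eigenvector of every positive Hopf power. The sum of the functionals dual to
  degree one is itself infinitesimal. Hence the rescaling function satisfies
  \<open>\<eta>(w z) = binom(i + j, i) \<eta>(w) \<eta>(z)\<close> in degrees \<open>i\<close>,
  \<open>j\<close>, which is the source of the multinomial coefficient in (iii).\<close>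

lemma tensor_lift_eqI:
  assumes "multilinear f" "linear g" "\<And>us. g (tens us) = f us"
  shows "tensor_lift f = g"
  by (rule tensor_linear_unique) (simp_all add: assms linear_tensor_lift tensor_lift_tens)

lemma tensor_lift_add:
  assumes "multilinear f" "multilinear g"
  shows "tensor_lift (\<lambda>us. f us + g us) t = tensor_lift f t + tensor_lift g t"
proof -
  have "multilinear (\<lambda>us. f us + g us)"
    using assms by (simp add: multilinear_def algebra_simps)
  moreover have "linear (\<lambda>t. tensor_lift f t + tensor_lift g t)"
    by (intro linear_compose_add linear_tensor_lift assms)
  ultimately have "tensor_lift (\<lambda>us. f us + g us) = (\<lambda>t. tensor_lift f t + tensor_lift g t)"
    by (rule tensor_lift_eqI) (simp add: tensor_lift_tens assms)
  then show ?thesis by simp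
qed

lemma tensor_lift_scaleR:
  assumes "multilinear f"
  shows "tensor_lift (\<lambda>us. r *\<^sub>R f us) t = r *\<^sub>R tensor_lift f t"
proof -
  have "multilinear (\<lambda>us. r *\<^sub>R f us)"
    using assms by (simp add: multilinear_def algebra_simps)
  moreover have "linear (\<lambda>t. r *\<^sub>R tensor_lift f t)"
    by (intro linear_compose_scale_right linear_tensor_lift assms)
  ultimately have "tensor_lift (\<lambda>us. r *\<^sub>R f us) = (\<lambda>t. r *\<^sub>R tensor_lift f t)"
    by (rule tensor_lift_eqI) (simp add: tensor_lift_tens assms)
  then show ?thesis by simp
qed

text \<open>Both \<open>tensor_append\<close> and \<open>tensor_mult\<close> are lifts of lifts.
  With the second tensor fixed, \<open>left\<close> makes the inner lift multilinear in the first
  list, because lifting is additive and homogeneous in the lifted map.\<close>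

lemma
  assumes right: "\<And>us. multilinear (F us)" and left: "\<And>vs. multilinear (\<lambda>us. F us vs)"
  shows tensor_lift2_tens: "tensor_lift (\<lambda>us. tensor_lift (F us) t) (tens us) = tensor_lift (F us) t"
    and linear_tensor_lift2_left: "linear (tensor_lift (\<lambda>us. tensor_lift (F us) t))"
    and linear_tensor_lift2_right: "linear (\<lambda>t. tensor_lift (\<lambda>us. tensor_lift (F us) t) s)"
proof -
  have ml: "multilinear (\<lambda>us. tensor_lift (F us) t)" for t
    unfolding multilinear_def
  proof (intro conjI allI)
    fix us x y vs
    have "F (us @ (x + y) # vs) = (\<lambda>ws. F (us @ x # vs) ws + F (us @ y # vs) ws)"
      using left by (auto simp: multilinear_def)
    then show "tensor_lift (F (us @ (x + y) # vs)) t =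
        tensor_lift (F (us @ x # vs)) t + tensor_lift (F (us @ y # vs)) t"
      by (simp add: tensor_lift_add right)
    fix r
    have "F (us @ (r *\<^sub>R x) # vs) = (\<lambda>ws. r *\<^sub>R F (us @ x # vs) ws)"
      using left by (auto simp: multilinear_def)
    then show "tensor_lift (F (us @ (r *\<^sub>R x) # vs)) t = r *\<^sub>R tensor_lift (F (us @ x # vs)) t"
      by (simp add: tensor_lift_scaleR right)
  qed
  show "tensor_lift (\<lambda>us. tensor_lift (F us) t) (tens us) = tensor_lift (F us) t"
    by (rule tensor_lift_tens[OF ml])
  show "linear (tensor_lift (\<lambda>us. tensor_lift (F us) t))"
    by (rule linear_tensor_lift[OF ml])
  show "linear (\<lambda>t. tensor_lift (\<lambda>us. tensor_lift (F us) t) s)"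
  proof
    fix t t' r
    have eq: "tensor_lift (F us) (t + t') = tensor_lift (F us) t + tensor_lift (F us) t'"
      "tensor_lift (F us) (r *\<^sub>R t) = r *\<^sub>R tensor_lift (F us) t" for us
      by (simp_all add: linear_add linear_scale linear_tensor_lift right)
    show "tensor_lift (\<lambda>us. tensor_lift (F us) (t + t')) s =
        tensor_lift (\<lambda>us. tensor_lift (F us) t) s + tensor_lift (\<lambda>us. tensor_lift (F us) t') s"
      by (simp add: eq tensor_lift_add ml)
    show "tensor_lift (\<lambda>us. tensor_lift (F us) (r *\<^sub>R t)) s =
        r *\<^sub>R tensor_lift (\<lambda>us. tensor_lift (F us) t) s"
      by (simp add: eq tensor_lift_scaleR ml)
  qed
qed

lemma multilinear_append: "multilinear (\<lambda>vs. tens (us @ vs))" "multilinear (\<lambda>us. tens (us @ vs))"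
  using multilinear_tens unfolding multilinear_def by (metis append.assoc append_Cons)+

lemma tens_append [simp]: "tens us \<otimes>\<^sub>t tens vs = tens (us @ vs)"
  unfolding tensor_append_def
  by (simp add: tensor_lift2_tens multilinear_append tensor_lift_tens)

lemma linear_tensor_append_left: "linear (\<lambda>s. s \<otimes>\<^sub>t t)"
  unfolding tensor_append_def by (rule linear_tensor_lift2_left; rule multilinear_append)

lemma linear_tensor_append_right: "linear (\<lambda>t. s \<otimes>\<^sub>t t)"
  unfolding tensor_append_def by (rule linear_tensor_lift2_right; rule multilinear_append)

lemma tensor_append_empty [simp]: "tens [] \<otimes>\<^sub>t t = t"
proof -
  have "(\<lambda>t. tens [] \<otimes>\<^sub>t t) = (\<lambda>t. t)"
    by (rule tensor_linear_unique) (simp_all add: linear_tensor_append_right linear_ident)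
  then show ?thesis by metis
qed

text \<open>Changing one entry of a list changes the componentwise product at the same position
  only, which reduces multilinearity of that product to \<open>multilinear_tens\<close>.\<close>

lemma map2_mult_split:
  assumes "length us = length us1 + Suc (length us2)"
  shows "map2 (*) us (us1 @ x # us2) =
    map2 (*) (take (length us1) us) us1 @ us ! length us1 * x #
      map2 (*) (drop (Suc (length us1)) us) us2"
    and "map2 (*) (us1 @ x # us2) us =
    map2 (*) us1 (take (length us1) us) @ x * us ! length us1 #
      map2 (*) us2 (drop (Suc (length us1)) us)"
proof -
  obtain ws z ws' where us: "us = ws @ z # ws'" "length ws = length us1"
    by (rule that[OF id_take_nth_drop[of "length us1"]]) (simp_all add: assms)
  then show "map2 (*) us (us1 @ x # us2) =
    map2 (*) (take (length us1) us) us1 @ us ! length us1 * x #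
      map2 (*) (drop (Suc (length us1)) us) us2"
    and "map2 (*) (us1 @ x # us2) us =
    map2 (*) us1 (take (length us1) us) @ x * us ! length us1 #
      map2 (*) us2 (drop (Suc (length us1)) us)"
    by (simp_all add: nth_append)
qed

lemma multilinear_map2_mult:
  fixes us :: "'a::real_algebra_1 list"
  shows "multilinear (\<lambda>vs. if length us = length vs then tens (map2 (*) us vs) else 0)"
    and "multilinear (\<lambda>us'. if length us' = length us then tens (map2 (*) us' us) else 0)"
  using multilinear_tens
  by (auto simp: multilinear_def map2_mult_split distrib_left distrib_right
      simp del: length_map length_zip)

lemma linear_tensor_mult:
  shows "linear (\<lambda>s. tensor_mult s t)" "linear (\<lambda>t. tensor_mult s t)"
  unfolding tensor_mult_def
  by (rule linear_tensor_lift2_left linear_tensor_lift2_right; rule multilinear_map2_mult)+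

lemma tensor_mult_tens:
  "tensor_mult (tens us) (tens vs) = (if length us = length vs then tens (map2 (*) us vs) else 0)"
proof -
  let ?F = "\<lambda>us vs. if length us = length vs then tens (map2 (*) us vs) else (0 :: 'a tensor)"
  have "tensor_mult (tens us) (tens vs) = tensor_lift (?F us) (tens vs)"
    unfolding tensor_mult_def
    by (rule tensor_lift2_tens[of ?F]; rule multilinear_map2_mult)
  also have "\<dots> = ?F us vs"
    by (rule tensor_lift_tens) (rule multilinear_map2_mult)
  finally show ?thesis .
qed

text \<open>One name for the lifts in the coassociativity and counit laws and for the lift that
  defines convolution. Tensors of order other than two are sent to 0.\<close>

definition tensor_pairing :: "('a::real_vector \<Rightarrow> 'a \<Rightarrow> 'b::real_vector) \<Rightarrow> 'a tensor \<Rightarrow> 'b" where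
  "tensor_pairing \<beta> = tensor_lift (\<lambda>us. case us of [u, v] \<Rightarrow> \<beta> u v | _ \<Rightarrow> 0)"

lemma multilinear_pairing:
  assumes "bilinear \<beta>"
  shows "multilinear (\<lambda>us. case us of [u, v] \<Rightarrow> \<beta> u v | _ \<Rightarrow> 0)"
  unfolding multilinear_def
  by (auto split: list.splits simp: append_eq_Cons_conv Cons_eq_append_conv
      bilinear_ladd[OF assms] bilinear_radd[OF assms] bilinear_lmul[OF assms] bilinear_rmul[OF assms])

lemma
  assumes "bilinear \<beta>"
  shows linear_tensor_pairing: "linear (tensor_pairing \<beta>)"
    and tensor_pairing_tens: "tensor_pairing \<beta> (tens us) = (case us of [u, v] \<Rightarrow> \<beta> u v | _ \<Rightarrow> 0)"
    and tensor_pairing_tens2 [simp]: "tensor_pairing \<beta> (tens [u, v]) = \<beta> u v"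
  using multilinear_pairing[OF assms]
  by (simp_all add: tensor_pairing_def linear_tensor_lift tensor_lift_tens)

lemma bilinear_compose: "linear L \<Longrightarrow> bilinear \<beta> \<Longrightarrow> bilinear (\<lambda>u v. L (\<beta> u v))"
  by (simp add: bilinear_def linear_iff)

lemma bilinear_mult_functions:
  fixes f g :: "'a::real_vector \<Rightarrow> 'b::real_algebra"
  shows "linear f \<Longrightarrow> linear g \<Longrightarrow> bilinear (\<lambda>u v. f u * g v)"
  by (simp add: bilinear_def linear_iff distrib_left distrib_right)

lemma linear_tensor_pairing_comp:
  assumes "linear L" "bilinear \<beta>"
  shows "L (tensor_pairing \<beta> t) = tensor_pairing (\<lambda>u v. L (\<beta> u v)) t"
proof -
  note b = bilinear_compose[OF assms]
  have "L \<circ> tensor_pairing \<beta> = tensor_pairing (\<lambda>u v. L (\<beta> u v))"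
    using assms
    by (intro tensor_linear_unique linear_compose linear_tensor_pairing b)
      (auto simp: tensor_pairing_tens b linear_0 split: list.splits)
  then show ?thesis by (metis comp_apply)
qed

lemma tensor_pairing_sum:
  assumes "\<And>i. i \<in> I \<Longrightarrow> bilinear (\<beta> i)"
  shows "tensor_pairing (\<lambda>u v. \<Sum>i\<in>I. \<beta> i u v) t = (\<Sum>i\<in>I. tensor_pairing (\<beta> i) t)"
proof -
  have b: "bilinear (\<lambda>u v. \<Sum>i\<in>I. \<beta> i u v)"
    using assms by (simp add: bilinear_def linear_compose_sum)
  have "tensor_pairing (\<lambda>u v. \<Sum>i\<in>I. \<beta> i u v) = (\<lambda>t. \<Sum>i\<in>I. tensor_pairing (\<beta> i) t)"
    using assms by (intro tensor_linear_unique linear_compose_sum)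
      (auto simp: tensor_pairing_tens linear_tensor_pairing b split: list.splits)
  then show ?thesis by metis
qed

lemma tensor_pairing_scaleR:
  assumes "bilinear \<beta>"
  shows "tensor_pairing (\<lambda>u v. r *\<^sub>R \<beta> u v) t = r *\<^sub>R tensor_pairing \<beta> t"
proof -
  have "linear (\<lambda>x :: 'b. r *\<^sub>R x)" by (simp add: linear_iff algebra_simps)
  from linear_tensor_pairing_comp[OF this assms] show ?thesis by simp
qed

text \<open>The tensor product of the maps followed by multiplication in \<open>'b\<close>. The
  codomain stays general: the reals for coefficients, the algebra itself for Hopf powers.\<close>

definition tensor_eval :: "('a::real_vector \<Rightarrow> 'b::real_algebra_1) list \<Rightarrow> 'a tensor \<Rightarrow> 'b" where
  "tensor_eval fs = tensor_lift
     (\<lambda>us. if length us = length fs then prod_list (map2 (\<lambda>f u. f u) fs us) else 0)"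

lemma prod_list_map2_split:
  assumes "length fs = length us + Suc (length vs)"
  shows "prod_list (map2 (\<lambda>f u. f u) fs (us @ x # vs)) =
    prod_list (map2 (\<lambda>f u. f u) (take (length us) fs) us) * (fs ! length us) x *
      prod_list (map2 (\<lambda>f u. f u) (drop (Suc (length us)) fs) vs)"
proof -
  obtain gs g gs' where "fs = gs @ g # gs'" "length gs = length us"
    by (rule that[OF id_take_nth_drop[of "length us"]]) (simp_all add: assms)
  then show ?thesis by (simp add: nth_append mult.assoc)
qed

lemma
  assumes "\<And>f. f \<in> set fs \<Longrightarrow> linear f"
  shows linear_tensor_eval: "linear (tensor_eval fs)"
    and tensor_eval_tens: "tensor_eval fs (tens us) =
      (if length us = length fs then prod_list (map2 (\<lambda>f u. f u) fs us) else 0)"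
proof -
  have lin: "linear (fs ! i)" if "i < length fs" for i
    using that assms by simp
  have "multilinear (\<lambda>us. if length us = length fs then prod_list (map2 (\<lambda>f u. f u) fs us) else 0)"
    unfolding multilinear_def
    by (auto simp: prod_list_map2_split linear_add[OF lin] linear_scale[OF lin] distrib_left distrib_right)
  then show "linear (tensor_eval fs)" "tensor_eval fs (tens us) =
      (if length us = length fs then prod_list (map2 (\<lambda>f u. f u) fs us) else 0)"
    by (simp_all add: tensor_eval_def linear_tensor_lift tensor_lift_tens)
qed

text \<open>All orders share one type, so having order \<open>k\<close> must be expressed by
  membership in a subspace.\<close>

definition tensor_power :: "nat \<Rightarrow> 'a::real_vector tensor set" where
  "tensor_power k = span (tens ` {us. length us = k})"

lemma tens_in_tensor_power [simp]: "length us = k \<Longrightarrow> tens us \<in> tensor_power k"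
  unfolding tensor_power_def by (rule span_base) auto

lemma subspace_tensor_power: "subspace (tensor_power k)"
  unfolding tensor_power_def by (rule subspace_span)

lemma linear_image_span_subset:
  assumes "linear L" "t \<in> span A" "subspace V" "\<And>x. x \<in> A \<Longrightarrow> L x \<in> V"
  shows "L t \<in> V"
  using assms(2)
proof (induction t rule: span_induct_alt)
  case base
  show ?case using assms(1,3) by (simp add: linear_0 subspace_0)
next
  case (step c x y)
  then show ?case
    using assms by (simp add: linear_add linear_scale subspace_add subspace_mul)
qed

lemma tensor_append_in_tensor_power:
  assumes "s \<in> tensor_power j" "t \<in> tensor_power k"
  shows "s \<otimes>\<^sub>t t \<in> tensor_power (j + k)"
proof (rule linear_image_span_subset[OF linear_tensor_append_left assms(1)[unfolded tensor_power_def] subspace_tensor_power])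
  fix s' :: "'a tensor" assume "s' \<in> tens ` {us. length us = j}"
  then obtain us where us: "s' = tens us" "length us = j" by auto
  show "s' \<otimes>\<^sub>t t \<in> tensor_power (j + k)"
    by (rule linear_image_span_subset[OF linear_tensor_append_right assms(2)[unfolded tensor_power_def] subspace_tensor_power])
      (auto simp: us)
qed

lemma tensor_power_eq_span:
  assumes "span U = UNIV"
  shows "tensor_power k = span (tens ` {us. length us = k \<and> set us \<subseteq> U})"
proof
  show "span (tens ` {us. length us = k \<and> set us \<subseteq> U}) \<subseteq> tensor_power k"
    unfolding tensor_power_def by (rule span_mono) auto
  \<comment> \<open>Entries are expanded from the left; \<open>ws\<close> collects those already
    replaced by elements of \<open>U\<close>.\<close>
  have "tens (ws @ us) \<in> span (tens ` {vs. length vs = length (ws @ us) \<and> set vs \<subseteq> U})"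
    if "set ws \<subseteq> U" for ws us
    using that
  proof (induction us arbitrary: ws)
    case Nil
    then show ?case by (auto intro: span_base)
  next
    case (Cons u us)
    have lin: "linear (\<lambda>x. tens (ws @ x # us))"
      using multilinear_tens by (auto simp: multilinear_def linear_iff)
    have "u \<in> span U" using assms by simp
    then show ?case
    proof (rule linear_image_span_subset[OF lin _ subspace_span])
      fix x assume "x \<in> U"
      then show "tens (ws @ x # us) \<in> span (tens ` {vs. length vs = length (ws @ u # us) \<and> set vs \<subseteq> U})"
        using Cons.IH[of "ws @ [x]"] Cons.prems by simp
    qed
  qed
  from this[of "[]"] show "tensor_power k \<subseteq> span (tens ` {us. length us = k \<and> set us \<subseteq> U})"
    unfolding tensor_power_def by (intro span_minimal subspace_span) auto
qed

lemma tensor_power_eqI: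
  assumes "linear L" "linear L'" "\<And>us. length us = k \<Longrightarrow> L (tens us) = L' (tens us)"
    and "t \<in> tensor_power k"
  shows "L t = L' t"
  by (rule linear_eq_on_span[OF assms(1,2) _ assms(4)[unfolded tensor_power_def]]) (use assms(3) in auto)

lemma linear_tens_single: "linear (\<lambda>x. tens [x])"
proof
  have add: "tens (us @ (x + y) # vs) = tens (us @ x # vs) + tens (us @ y # vs)"
    and scale: "tens (us @ (r *\<^sub>R x) # vs) = r *\<^sub>R tens (us @ x # vs)" for us vs and x y :: 'a and r
    using multilinear_tens unfolding multilinear_def by blast+
  show "tens [x + y] = tens [x] + tens [y]" "tens [r *\<^sub>R x] = r *\<^sub>R tens [x]" for x y :: 'a and r
    using add[of "[]" x y "[]"] scale[of "[]" r x "[]"] by simp_all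
qed

section \<open>Convolution\<close>

text \<open>The counit is a parameter because \<open>counit\<close> is a definite description,
  awkward to compute with; \<open>counit_eq\<close> identifies the two.\<close>

locale coalgebra =
  fixes \<Delta> :: "'h::real_vector \<Rightarrow> 'h tensor" and \<epsilon> :: "'h \<Rightarrow> real"
  assumes linear_coproduct: "linear \<Delta>"
    and coproduct_in_tensor_power: "\<Delta> x \<in> tensor_power 2"
    and coassociative: "tensor_pairing (\<lambda>u v. \<Delta> u \<otimes>\<^sub>t tens [v]) (\<Delta> x) =
      tensor_pairing (\<lambda>u v. tens [u] \<otimes>\<^sub>t \<Delta> v) (\<Delta> x)"
    and linear_counit: "linear \<epsilon>"
    and counit_left: "tensor_pairing (\<lambda>u v. \<epsilon> u *\<^sub>R v) (\<Delta> x) = x"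
    and counit_right: "tensor_pairing (\<lambda>u v. \<epsilon> v *\<^sub>R u) (\<Delta> x) = x"
begin

definition convolution :: "('h \<Rightarrow> 'b::real_algebra_1) \<Rightarrow> ('h \<Rightarrow> 'b) \<Rightarrow> 'h \<Rightarrow> 'b" (infixr "\<star>" 75)
  where "(f \<star> g) x = tensor_pairing (\<lambda>u v. f u * g v) (\<Delta> x)"

lemma linear_pairing_coproduct:
  assumes "bilinear \<beta>"
  shows "linear (\<lambda>x. tensor_pairing \<beta> (\<Delta> x))"
  using linear_compose[OF linear_coproduct linear_tensor_pairing[OF assms]] by (simp add: o_def)

lemma linear_convolution [simp]: "linear f \<Longrightarrow> linear g \<Longrightarrow> linear (f \<star> g)"
  unfolding convolution_def by (intro linear_pairing_coproduct bilinear_mult_functions)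

lemma convolution_sum_left:
  "(\<And>i. i \<in> I \<Longrightarrow> linear (f i)) \<Longrightarrow> linear g \<Longrightarrow> ((\<lambda>x. \<Sum>i\<in>I. f i x) \<star> g) x = (\<Sum>i\<in>I. (f i \<star> g) x)"
  by (simp add: convolution_def sum_distrib_right tensor_pairing_sum bilinear_mult_functions)

lemma convolution_sum_right:
  "(\<And>i. i \<in> I \<Longrightarrow> linear (g i)) \<Longrightarrow> linear f \<Longrightarrow> (f \<star> (\<lambda>x. \<Sum>i\<in>I. g i x)) x = (\<Sum>i\<in>I. (f \<star> g i) x)"
  by (simp add: convolution_def sum_distrib_left tensor_pairing_sum bilinear_mult_functions)

lemma convolution_scaleR:
  "linear f \<Longrightarrow> linear g \<Longrightarrow> ((\<lambda>x. r *\<^sub>R f x) \<star> (\<lambda>x. s *\<^sub>R g x)) x = (r * s) *\<^sub>R (f \<star> g) x"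
  by (simp add: convolution_def tensor_pairing_scaleR bilinear_mult_functions mult.commute)

lemma linear_of_real_counit [simp]: "linear (\<lambda>x. of_real (\<epsilon> x) :: 'b::real_algebra_1)"
  using linear_counit by (simp add: linear_iff of_real_def algebra_simps)

lemma linear_real_counit [simp]: "linear \<epsilon>"
  by (rule linear_counit)

lemma convolution_counit_left:
  assumes "linear f"
  shows "(\<lambda>x. of_real (\<epsilon> x)) \<star> f = f"
proof
  fix x
  have "bilinear (\<lambda>u v. \<epsilon> u *\<^sub>R v)"
    using linear_counit by (simp add: bilinear_def linear_iff algebra_simps)
  from linear_tensor_pairing_comp[OF assms this] have "f x = tensor_pairing (\<lambda>u v. f (\<epsilon> u *\<^sub>R v)) (\<Delta> x)"
    by (metis counit_left)
  then show "((\<lambda>x. of_real (\<epsilon> x)) \<star> f) x = f x"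
    by (simp add: convolution_def linear_scale[OF assms] of_real_def)
qed

lemma convolution_counit_right:
  assumes "linear f"
  shows "f \<star> (\<lambda>x. of_real (\<epsilon> x)) = f"
proof
  fix x
  have "bilinear (\<lambda>u v. \<epsilon> v *\<^sub>R u)"
    using linear_counit by (simp add: bilinear_def linear_iff algebra_simps)
  from linear_tensor_pairing_comp[OF assms this] have "f x = tensor_pairing (\<lambda>u v. f (\<epsilon> v *\<^sub>R u)) (\<Delta> x)"
    by (metis counit_right)
  then show "(f \<star> (\<lambda>x. of_real (\<epsilon> x))) x = f x"
    by (simp add: convolution_def linear_scale[OF assms] of_real_def)
qed

lemma convolution_real_counit [simp]:
  "linear f \<Longrightarrow> \<epsilon> \<star> f = f" "linear f \<Longrightarrow> f \<star> \<epsilon> = f"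
  using convolution_counit_left[of f] convolution_counit_right[of f] by simp_all

text \<open>Handles tensors with explicit first entries and a coproduct in the last two slots, the
  shape produced by \<open>coproduct_last\<close>.\<close>

lemma tensor_eval_tens_append:
  fixes g h :: "'h \<Rightarrow> 'b::real_algebra_1"
  assumes "\<And>f. f \<in> set fs \<Longrightarrow> linear f" "linear g" "linear h" "length us = length fs"
  shows "tensor_eval (fs @ [g, h]) (tens us \<otimes>\<^sub>t t) =
    prod_list (map2 (\<lambda>f u. f u) fs us) * tensor_pairing (\<lambda>u v. g u * h v) t"
proof -
  have lin: "linear f" if "f \<in> set (fs @ [g, h])" for f using that assms by auto
  have eval: "tensor_eval (fs @ [g, h]) (tens us) = (if length us = length (fs @ [g, h]) then
      prod_list (map2 (\<lambda>f u. f u) (fs @ [g, h]) us) else 0)" for us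
    by (rule tensor_eval_tens) (use lin in blast)
  have mult: "linear (\<lambda>y. c * y)" for c :: 'b by (simp add: linear_iff distrib_left)
  have b: "bilinear (\<lambda>u v. g u * h v)" by (intro bilinear_mult_functions assms)
  have "tensor_eval (fs @ [g, h]) \<circ> (\<lambda>t. tens us \<otimes>\<^sub>t t) =
    (\<lambda>y. prod_list (map2 (\<lambda>f u. f u) fs us) * y) \<circ> tensor_pairing (\<lambda>u v. g u * h v)"
    by (intro tensor_linear_unique linear_compose linear_tensor_pairing linear_tensor_eval
        linear_tensor_append_right b mult lin)
      (auto simp: eval tensor_pairing_tens b assms(4) split: list.split)
  then show ?thesis by (metis comp_apply)
qed

text \<open>The two bracketings are \<open>tensor_eval [f, g, h]\<close> applied to the two sides of
  coassociativity.\<close>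

lemma convolution_assoc:
  fixes f g h :: "'h \<Rightarrow> 'b::real_algebra_1"
  assumes "linear f" "linear g" "linear h"
  shows "(f \<star> g) \<star> h = f \<star> (g \<star> h)"
proof
  fix x
  let ?L = "tensor_eval [f, g, h]"
  have lin: "linear ?L" using assms by (intro linear_tensor_eval) auto
  have eval: "?L (tens us) = (if length us = length [f, g, h] then
      prod_list (map2 (\<lambda>f u. f u) [f, g, h] us) else 0)" for us
    by (rule tensor_eval_tens) (use assms in auto)
  have b: "bilinear (\<lambda>u v. f u * g v)" by (intro bilinear_mult_functions assms)
  have b1: "bilinear (\<lambda>u v. \<Delta> u \<otimes>\<^sub>t tens [v])"
    by (auto simp: bilinear_def linear_iff linear_add[OF linear_tens_single] linear_scale[OF linear_tens_single]
      linear_add[OF linear_coproduct] linear_scale[OF linear_coproduct]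
      linear_add[OF linear_tensor_append_left] linear_scale[OF linear_tensor_append_left]
      linear_add[OF linear_tensor_append_right] linear_scale[OF linear_tensor_append_right])
  have b2: "bilinear (\<lambda>u v. tens [u] \<otimes>\<^sub>t \<Delta> v)"
    by (auto simp: bilinear_def linear_iff linear_add[OF linear_tens_single] linear_scale[OF linear_tens_single]
      linear_add[OF linear_coproduct] linear_scale[OF linear_coproduct]
      linear_add[OF linear_tensor_append_left] linear_scale[OF linear_tensor_append_left]
      linear_add[OF linear_tensor_append_right] linear_scale[OF linear_tensor_append_right])
  have left: "?L (s \<otimes>\<^sub>t tens [v]) = tensor_pairing (\<lambda>u v. f u * g v) s * h v" for s v
  proof -
    have mult: "linear (\<lambda>y. y * c)" for c :: 'b by (simp add: linear_iff distrib_right)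
    have "?L \<circ> (\<lambda>s. s \<otimes>\<^sub>t tens [v]) = (\<lambda>y. y * h v) \<circ> tensor_pairing (\<lambda>u v. f u * g v)"
      using assms
      by (intro tensor_linear_unique linear_compose linear_tensor_pairing lin linear_tensor_append_left b mult)
        (auto simp: eval tensor_pairing_tens b mult.assoc split: list.split)
    then show ?thesis by (metis comp_apply)
  qed
  have right: "?L (tens [u] \<otimes>\<^sub>t s) = f u * tensor_pairing (\<lambda>u v. g u * h v) s" for s u
    using tensor_eval_tens_append[of "[f]" g h "[u]" s] assms by simp
  have "((f \<star> g) \<star> h) x = ?L (tensor_pairing (\<lambda>u v. \<Delta> u \<otimes>\<^sub>t tens [v]) (\<Delta> x))"
    by (simp add: linear_tensor_pairing_comp[OF lin b1] left convolution_def)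
  also have "\<dots> = (f \<star> (g \<star> h)) x"
    unfolding coassociative by (simp add: linear_tensor_pairing_comp[OF lin b2] right convolution_def)
  finally show "((f \<star> g) \<star> h) x = (f \<star> (g \<star> h)) x" .
qed

definition conv_list :: "('h \<Rightarrow> 'b::real_algebra_1) list \<Rightarrow> 'h \<Rightarrow> 'b" where
  "conv_list fs = foldr (\<star>) fs (\<lambda>x. of_real (\<epsilon> x))"

lemma conv_list_Nil: "conv_list [] = (\<lambda>x. of_real (\<epsilon> x))"
  by (simp add: conv_list_def)

lemma conv_list_Nil_real [simp]: "conv_list [] = \<epsilon>"
  by (simp add: conv_list_Nil)

lemma conv_list_Cons [simp]: "conv_list (f # fs) = f \<star> conv_list fs"
  by (simp add: conv_list_def)

lemma linear_conv_list [simp]: "(\<And>f. f \<in> set fs \<Longrightarrow> linear f) \<Longrightarrow> linear (conv_list fs)"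
  by (induction fs) (simp_all add: conv_list_Nil)

lemma conv_list_append:
  assumes "\<And>f. f \<in> set fs \<union> set gs \<Longrightarrow> linear f"
  shows "conv_list (fs @ gs) = conv_list fs \<star> conv_list gs"
  using assms by (induction fs) (simp_all add: convolution_counit_left convolution_assoc conv_list_Nil)

text \<open>Uniqueness is the usual argument for units: \<open>e \<star> \<epsilon>\<close> equals
  \<open>\<epsilon>\<close> because \<open>e\<close> is a left counit, and equals \<open>e\<close>
  because \<open>\<epsilon>\<close> is a right counit.\<close>

lemma counit_eq: "counit \<Delta> = \<epsilon>"
  unfolding counit_def
proof (rule the_equality)
  show "linear \<epsilon> \<and> (\<forall>x. tensor_lift (\<lambda>us. case us of [u, v] \<Rightarrow> \<epsilon> u *\<^sub>R v | _ \<Rightarrow> 0) (\<Delta> x) = x \<and>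
     tensor_lift (\<lambda>us. case us of [u, v] \<Rightarrow> \<epsilon> v *\<^sub>R u | _ \<Rightarrow> 0) (\<Delta> x) = x)"
    using linear_counit counit_left counit_right by (simp add: tensor_pairing_def)
next
  fix e :: "'h \<Rightarrow> real"
  assume "linear e \<and> (\<forall>x. tensor_lift (\<lambda>us. case us of [u, v] \<Rightarrow> e u *\<^sub>R v | _ \<Rightarrow> 0) (\<Delta> x) = x \<and>
     tensor_lift (\<lambda>us. case us of [u, v] \<Rightarrow> e v *\<^sub>R u | _ \<Rightarrow> 0) (\<Delta> x) = x)"
  then have e: "linear e" "tensor_pairing (\<lambda>u v. e u *\<^sub>R v) (\<Delta> x) = x" for x
    by (simp_all add: tensor_pairing_def)
  have b: "bilinear (\<lambda>u v. e u *\<^sub>R v)"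
    using e(1) by (simp add: bilinear_def linear_iff algebra_simps)
  show "e = \<epsilon>"
  proof
    fix x
    have "\<epsilon> x = tensor_pairing (\<lambda>u v. \<epsilon> (e u *\<^sub>R v)) (\<Delta> x)"
      using linear_tensor_pairing_comp[OF linear_counit b, of "\<Delta> x"] by (simp add: e(2))
    also have "\<dots> = (e \<star> \<epsilon>) x"
      by (simp add: convolution_def linear_scale[OF linear_counit])
    also have "\<dots> = e x"
      using e(1) by simp
    finally show "e x = \<epsilon> x" ..
  qed
qed

abbreviation coproduct_last :: "'h list \<Rightarrow> 'h tensor" where
  "coproduct_last us \<equiv> if us = [] then 0 else tens (butlast us) \<otimes>\<^sub>t \<Delta> (last us)"

lemma multilinear_coproduct_last: "multilinear coproduct_last"
proof -
  have add: "tens (us @ (x + y) # vs) = tens (us @ x # vs) + tens (us @ y # vs)"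
    and scale: "tens (us @ (r *\<^sub>R x) # vs) = r *\<^sub>R tens (us @ x # vs)" for us vs and x y :: 'h and r
    using multilinear_tens unfolding multilinear_def by blast+
  show ?thesis
    unfolding multilinear_def
    by (auto simp: butlast_append add scale linear_add[OF linear_coproduct] linear_scale[OF linear_coproduct]
        linear_add[OF linear_tensor_append_left] linear_scale[OF linear_tensor_append_left]
        linear_add[OF linear_tensor_append_right] linear_scale[OF linear_tensor_append_right])
qed

lemma iter_coproduct_in_tensor_power: "iter_coproduct \<Delta> k x \<in> tensor_power k"
proof (induction k rule: nat_induct)
  case 0
  show ?case by (simp add: subspace_mul[OF subspace_tensor_power])
next
  case (Suc k)
  show ?case
  proof (cases k)
    case 0
    then show ?thesis by simp
  next
    case (Suc j)
    have "tensor_lift coproduct_last t \<in> tensor_power (Suc k)" if "t \<in> tensor_power k" for t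
    proof (rule linear_image_span_subset[OF linear_tensor_lift[OF multilinear_coproduct_last]
          that[unfolded tensor_power_def] subspace_tensor_power])
      fix t assume "t \<in> tens ` {us :: 'h list. length us = k}"
      then obtain us where us: "t = tens us" "length us = k" by auto
      then have "tensor_lift coproduct_last t = tens (butlast us) \<otimes>\<^sub>t \<Delta> (last us)"
        using Suc by (auto simp: tensor_lift_tens[OF multilinear_coproduct_last])
      also have "\<dots> \<in> tensor_power (j + 2)"
        by (intro tensor_append_in_tensor_power coproduct_in_tensor_power)
          (simp add: us Suc)
      finally show "tensor_lift coproduct_last t \<in> tensor_power (Suc k)" by (simp add: Suc)
    qed
    then show ?thesis using Suc.IH by (simp add: Suc)
  qed
qed

lemma tensor_eval_coproduct_last:
  assumes "\<And>f. f \<in> set fs \<Longrightarrow> linear f" "linear g" "linear h" "t \<in> tensor_power (Suc (length fs))"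
  shows "tensor_eval (fs @ [g, h]) (tensor_lift coproduct_last t) = tensor_eval (fs @ [g \<star> h]) t"
proof -
  have lin: "linear f" if "f \<in> set (fs @ [g, h]) \<or> f \<in> set (fs @ [g \<star> h])" for f
    using that assms by auto
  have eval: "tensor_eval (fs @ [g \<star> h]) (tens us) = (if length us = length (fs @ [g \<star> h]) then
      prod_list (map2 (\<lambda>f u. f u) (fs @ [g \<star> h]) us) else 0)" for us
    by (rule tensor_eval_tens) (use lin in blast)
  have "(tensor_eval (fs @ [g, h]) \<circ> tensor_lift coproduct_last) t = tensor_eval (fs @ [g \<star> h]) t"
  proof (rule tensor_power_eqI[OF _ _ _ assms(4)])
    show "linear (tensor_eval (fs @ [g, h]) \<circ> tensor_lift coproduct_last)"
      by (intro linear_compose linear_tensor_lift multilinear_coproduct_last linear_tensor_eval lin) simp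
    show "linear (tensor_eval (fs @ [g \<star> h]))"
      by (intro linear_tensor_eval lin) simp
    fix us :: "'h list" assume "length us = Suc (length fs)"
    then obtain ws z where us: "us = ws @ [z]" "length ws = length fs"
      by (metis length_Suc_conv_rev)
    show "(tensor_eval (fs @ [g, h]) \<circ> tensor_lift coproduct_last) (tens us) = tensor_eval (fs @ [g \<star> h]) (tens us)"
      using assms us
      by (simp add: tensor_lift_tens[OF multilinear_coproduct_last] tensor_eval_tens_append
          eval convolution_def)
  qed
  then show ?thesis by simp
qed

text \<open>The last step of \<open>iter_coproduct\<close> splits the last slot, which by
  \<open>tensor_eval_coproduct_last\<close> fuses the last two maps into \<open>g \<star> h\<close>;
  associativity takes them apart again. Without maps the value is the counit.\<close>

lemma tensor_eval_iter_coproduct: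
  fixes fs :: "('h \<Rightarrow> 'b::real_algebra_1) list"
  assumes "\<And>f. f \<in> set fs \<Longrightarrow> linear f"
  shows "tensor_eval fs (iter_coproduct \<Delta> (length fs) x) = conv_list fs x"
  using assms
proof (induction "length fs" arbitrary: fs)
  case 0
  then show ?case
    using linear_scale[OF linear_tensor_eval[of "[] :: ('h \<Rightarrow> 'b) list"]]
      tensor_eval_tens[of "[] :: ('h \<Rightarrow> 'b) list" "[]"]
    by (simp add: counit_eq conv_list_Nil of_real_def)
next
  case (Suc k)
  show ?case
  proof (cases k)
    case 0
    then obtain f where "fs = [f]" using Suc.hyps(2) by (metis length_0_conv length_Suc_conv)
    then show ?thesis using Suc.prems tensor_eval_tens[of "[f]" "[x]"]
      by (simp add: conv_list_Nil convolution_counit_right)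
  next
    case (Suc j)
    then obtain gs g h where fs: "fs = gs @ [g, h]" "length gs = j"
      using Suc.hyps(2) by (metis append.assoc append_Cons append_Nil length_Suc_conv_rev)
    have lin: "\<And>f. f \<in> set gs \<Longrightarrow> linear f" "linear g" "linear h"
      using Suc.prems fs by auto
    have "tensor_eval fs (iter_coproduct \<Delta> (length fs) x) =
        tensor_eval (gs @ [g, h]) (tensor_lift coproduct_last (iter_coproduct \<Delta> (Suc j) x))"
      by (simp add: fs)
    also have "\<dots> = tensor_eval (gs @ [g \<star> h]) (iter_coproduct \<Delta> (Suc j) x)"
      using fs(2) lin iter_coproduct_in_tensor_power by (intro tensor_eval_coproduct_last) auto
    also have "\<dots> = conv_list (gs @ [g \<star> h]) x"
    proof -
      have "linear f" if "f \<in> set (gs @ [g \<star> h])" for f using that lin by auto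
      then show ?thesis
        using Suc.hyps(1)[of "gs @ [g \<star> h]"] fs(2) Suc by simp
    qed
    also have "\<dots> = conv_list (gs @ [g, h]) x"
    proof -
      have "conv_list (gs @ [g \<star> h]) = conv_list gs \<star> conv_list [g \<star> h]"
        using lin by (intro conv_list_append) auto
      moreover have "conv_list (gs @ [g, h]) = conv_list gs \<star> conv_list [g, h]"
        using lin by (intro conv_list_append) auto
      ultimately show ?thesis using lin by (simp add: conv_list_Nil convolution_counit_right)
    qed
    finally show ?thesis using fs by simp
  qed
qed

end

section \<open>Symmetrised convolutions of infinitesimal characters\<close>

lemma sum_Pow_remove:
  assumes "finite S"
  shows "(\<Sum>i\<in>S. \<Sum>T\<in>Pow (S - {i}). h i T) = (\<Sum>T\<in>Pow S. \<Sum>i\<in>S - T. h i T)"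
proof -
  have "(\<Sum>i\<in>S. \<Sum>T\<in>Pow (S - {i}). h i T) = (\<Sum>(i, T)\<in>(SIGMA i:S. Pow (S - {i})). h i T)"
    using assms by (intro sum.Sigma) auto
  also have "\<dots> = (\<Sum>(T, i)\<in>(SIGMA T:Pow S. S - T). h i T)"
    by (rule sum.reindex_bij_witness[where i = "\<lambda>(T, i). (i, T)" and j = "\<lambda>(i, T). (T, i)"]) auto
  also have "\<dots> = (\<Sum>T\<in>Pow S. \<Sum>i\<in>S - T. h i T)"
    using assms by (intro sum.Sigma[symmetric]) auto
  finally show ?thesis .
qed

text \<open>Together with \<open>sum_Pow_remove\<close> this sorts the terms in
  \<open>sym_conv_mult\<close> by the final left index set: here \<open>i\<close> has joined the
  left set, there it belongs to the complement.\<close>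

lemma sum_Pow_insert:
  assumes "finite S"
  shows "(\<Sum>i\<in>S. \<Sum>T\<in>Pow (S - {i}). h i T) = (\<Sum>T\<in>Pow S. \<Sum>i\<in>T. h i (T - {i}))"
proof -
  have fin: "finite T" if "T \<subseteq> S" for T using that assms by (rule finite_subset)
  have "(\<Sum>i\<in>S. \<Sum>T\<in>Pow (S - {i}). h i T) = (\<Sum>(i, T)\<in>(SIGMA i:S. Pow (S - {i})). h i T)"
    using assms by (intro sum.Sigma) auto
  also have "\<dots> = (\<Sum>(T, i)\<in>(SIGMA T:Pow S. T). h i (T - {i}))"
    by (rule sum.reindex_bij_witness[where i = "\<lambda>(T, i). (i, T - {i})" and j = "\<lambda>(i, T). (insert i T, i)"])
      (auto intro!: arg_cong[of _ _ "h _"])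
  also have "\<dots> = (\<Sum>T\<in>Pow S. \<Sum>i\<in>T. h i (T - {i}))"
    using assms fin by (intro sum.Sigma[symmetric]) auto
  finally show ?thesis .
qed

lemma sum_permutations_of_set:
  assumes "finite S" "S \<noteq> {}"
  shows "(\<Sum>is\<in>permutations_of_set S. h is) = (\<Sum>i\<in>S. \<Sum>is\<in>permutations_of_set (S - {i}). h (i # is))"
proof -
  have "(\<Sum>is\<in>permutations_of_set S. h is) =
      (\<Sum>i\<in>S. \<Sum>is\<in>(#) i ` permutations_of_set (S - {i}). h is)"
    unfolding permutations_of_set_nonempty[OF assms(2)]
    using assms(1) by (intro sum.UNION_disjoint) auto
  also have "\<dots> = (\<Sum>i\<in>S. \<Sum>is\<in>permutations_of_set (S - {i}). h (i # is))"
    by (simp add: sum.reindex)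
  finally show ?thesis .
qed

context coalgebra
begin

lemma bilinear_linear_mult:
  fixes f :: "'h \<Rightarrow> real"
  shows "linear f \<Longrightarrow> linear g \<Longrightarrow> bilinear (\<lambda>u v. c * (f u * g v))"
  by (simp add: bilinear_def linear_iff distrib_left distrib_right mult.left_commute)

text \<open>Orderings are taken of an index set and not of a set of functionals, so that repeated
  functionals stay apart; a state may contain a generator several times.\<close>

definition sym_conv :: "('i \<Rightarrow> 'h \<Rightarrow> real) \<Rightarrow> 'i set \<Rightarrow> 'h \<Rightarrow> real" where
  "sym_conv d S = (\<lambda>x. \<Sum>is\<in>permutations_of_set S. conv_list (map d is) x)"

lemma sym_conv_empty [simp]: "sym_conv d {} = \<epsilon>"
  by (simp add: sym_conv_def)

lemma linear_sym_conv [simp]: "(\<And>i. i \<in> S \<Longrightarrow> linear (d i)) \<Longrightarrow> linear (sym_conv d S)"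
  unfolding sym_conv_def
  by (intro linear_compose_sum ballI linear_conv_list) (auto dest: permutations_of_setD)

lemma sym_conv_remove:
  assumes "finite S" "S \<noteq> {}" "\<And>i. i \<in> S \<Longrightarrow> linear (d i)"
  shows "sym_conv d S x = (\<Sum>i\<in>S. (d i \<star> sym_conv d (S - {i})) x)"
proof -
  have "sym_conv d S x = (\<Sum>i\<in>S. \<Sum>is\<in>permutations_of_set (S - {i}). (d i \<star> conv_list (map d is)) x)"
    unfolding sym_conv_def by (subst sum_permutations_of_set) (simp_all add: assms)
  also have "\<dots> = (\<Sum>i\<in>S. (d i \<star> sym_conv d (S - {i})) x)"
    unfolding sym_conv_def
    by (intro sum.cong refl convolution_sum_right[symmetric] linear_conv_list)
      (auto dest: permutations_of_setD intro: assms(3))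
  finally show ?thesis .
qed

lemma sym_conv_singleton:
  assumes "linear (d i)"
  shows "sym_conv d {i} = d i"
  using assms by (simp add: sym_conv_def)

text \<open>Cutting an ordering of \<open>S\<close> after \<open>j\<close> entries gives an ordering
  of a \<open>j\<close>-subset and one of its complement, and every such pair arises exactly once.
  The induction removes the first entry of the left factor.\<close>

lemma sum_sym_conv_convolution:
  assumes "finite S" "\<And>i. i \<in> S \<Longrightarrow> linear (d i)" "j \<le> card S"
  shows "(\<Sum>T | T \<subseteq> S \<and> card T = j. (sym_conv d T \<star> sym_conv d (S - T)) x) = sym_conv d S x"
  using assms
proof (induction j arbitrary: S x)
  case 0
  then have "{T. T \<subseteq> S \<and> card T = 0} = {{}}" by (auto dest: finite_subset)
  then show ?case using 0 by simp
next
  case (Suc j)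
  define P where "P A k = {T. T \<subseteq> A \<and> card T = k}" for A :: "'a set" and k :: nat
  have fin: "finite T" if "T \<subseteq> S" for T using that Suc.prems(1) by (rule finite_subset)
  have finP: "finite (P A k)" if "A \<subseteq> S" for A k
    using fin[OF that] by (auto simp: P_def)
  have lin: "linear (sym_conv d T)" if "T \<subseteq> S" for T
    using that Suc.prems(2) by (intro linear_sym_conv) auto
  have "(\<Sum>T\<in>P S (Suc j). (sym_conv d T \<star> sym_conv d (S - T)) x) =
    (\<Sum>T\<in>P S (Suc j). \<Sum>i\<in>T. (d i \<star> (sym_conv d (T - {i}) \<star> sym_conv d (S - T))) x)"
  proof (rule sum.cong[OF refl])
    fix T assume "T \<in> P S (Suc j)"
    then have T: "T \<subseteq> S" "T \<noteq> {}" "finite T" using fin by (auto simp: P_def)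
    have "sym_conv d T = (\<lambda>x. \<Sum>i\<in>T. (d i \<star> sym_conv d (T - {i})) x)"
      using T Suc.prems(2) by (intro ext sym_conv_remove) auto
    then have "(sym_conv d T \<star> sym_conv d (S - T)) x =
        ((\<lambda>x. \<Sum>i\<in>T. (d i \<star> sym_conv d (T - {i})) x) \<star> sym_conv d (S - T)) x"
      by simp
    also have "\<dots> = (\<Sum>i\<in>T. ((d i \<star> sym_conv d (T - {i})) \<star> sym_conv d (S - T)) x)"
      using T Suc.prems(2) by (intro convolution_sum_left linear_convolution lin) auto
    also have "\<dots> = (\<Sum>i\<in>T. (d i \<star> (sym_conv d (T - {i}) \<star> sym_conv d (S - T))) x)"
      by (intro sum.cong refl fun_cong[OF convolution_assoc] lin) (use T Suc.prems(2) in auto)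
    finally show "(sym_conv d T \<star> sym_conv d (S - T)) x =
      (\<Sum>i\<in>T. (d i \<star> (sym_conv d (T - {i}) \<star> sym_conv d (S - T))) x)" .
  qed
  also have "\<dots> = (\<Sum>(T, i)\<in>(SIGMA T:P S (Suc j). T).
      (d i \<star> (sym_conv d (T - {i}) \<star> sym_conv d (S - T))) x)"
    using finP fin by (intro sum.Sigma) (auto simp: P_def)
  also have "\<dots> = (\<Sum>(i, T)\<in>(SIGMA i:S. P (S - {i}) j).
      (d i \<star> (sym_conv d T \<star> sym_conv d (S - {i} - T))) x)"
  proof (rule sum.reindex_bij_witness[where i = "\<lambda>(i, T). (insert i T, i)" and j = "\<lambda>(T, i). (i, T - {i})"])
    fix b assume "b \<in> (SIGMA i:S. P (S - {i}) j)"
    then obtain i T where b: "b = (i, T)" "i \<in> S" "T \<subseteq> S" "i \<notin> T" "card T = j"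
      by (auto simp: P_def)
    then show "(case b of (i, T) \<Rightarrow> (insert i T, i)) \<in> (SIGMA T:P S (Suc j). T)"
      using fin[of T] by (simp add: P_def)
  next
    fix a assume "a \<in> (SIGMA T:P S (Suc j). T)"
    then show "(case case a of (T, i) \<Rightarrow> (i, T - {i}) of (i, T) \<Rightarrow>
          (d i \<star> sym_conv d T \<star> sym_conv d (S - {i} - T)) x) =
        (case a of (T, i) \<Rightarrow> (d i \<star> sym_conv d (T - {i}) \<star> sym_conv d (S - T)) x)"
      by (auto simp: P_def intro!: arg_cong[of _ _ "\<lambda>A. (d _ \<star> _ \<star> sym_conv d A) x"])
  qed (use fin in \<open>auto simp: P_def insert_absorb\<close>)
  also have "\<dots> = (\<Sum>i\<in>S. \<Sum>T\<in>P (S - {i}) j. (d i \<star> (sym_conv d T \<star> sym_conv d (S - {i} - T))) x)"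
    using Suc.prems(1) finP by (intro sum.Sigma[symmetric]) auto
  also have "\<dots> = (\<Sum>i\<in>S. (d i \<star> (\<lambda>x. \<Sum>T\<in>P (S - {i}) j. (sym_conv d T \<star> sym_conv d (S - {i} - T)) x)) x)"
    by (intro sum.cong refl convolution_sum_right[symmetric] linear_convolution lin)
      (use Suc.prems(2) in \<open>auto simp: P_def\<close>)
  also have "\<dots> = (\<Sum>i\<in>S. (d i \<star> sym_conv d (S - {i})) x)"
  proof (rule sum.cong[OF refl])
    fix i assume i: "i \<in> S"
    have "(\<lambda>x. \<Sum>T\<in>P (S - {i}) j. (sym_conv d T \<star> sym_conv d (S - {i} - T)) x) = sym_conv d (S - {i})"
      unfolding P_def by (rule ext, rule Suc.IH) (use Suc.prems i in auto)
    then show "(d i \<star> (\<lambda>x. \<Sum>T\<in>P (S - {i}) j. (sym_conv d T \<star> sym_conv d (S - {i} - T)) x)) x =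
      (d i \<star> sym_conv d (S - {i})) x" by simp
  qed
  also have "\<dots> = sym_conv d S x"
    using Suc.prems by (intro sym_conv_remove[symmetric]) auto
  finally show ?case by (simp add: P_def)
qed

end

section \<open>Convolutions evaluated on products, and Hopf powers\<close>

locale bialgebra = coalgebra \<Delta> \<epsilon> for \<Delta> :: "'h::real_algebra_1 \<Rightarrow> 'h tensor" and \<epsilon> +
  assumes coproduct_mult: "\<Delta> (w * z) = tensor_mult (\<Delta> w) (\<Delta> z)"
    and counit_mult: "\<epsilon> (w * z) = \<epsilon> w * \<epsilon> z"
    and counit_1: "\<epsilon> 1 = 1"
begin

text \<open>The coproduct is an algebra morphism, so the splittings of \<open>f\<close> and
  \<open>g\<close> over a product combine slot by slot. The identity is bilinear in
  \<open>\<Delta> w\<close> and \<open>\<Delta> z\<close>; it is checked on elementary tensors and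
  then extended in one argument at a time.\<close>

lemma convolution_mult:
  fixes f g :: "'h \<Rightarrow> real"
  assumes f: "linear f" "\<And>u v. f (u * v) = (\<Sum>i\<in>I. f1 i u * f2 i v)"
    and g: "linear g" "\<And>u v. g (u * v) = (\<Sum>j\<in>J. g1 j u * g2 j v)"
    and lin_f: "\<And>i. i \<in> I \<Longrightarrow> linear (f1 i)" "\<And>i. i \<in> I \<Longrightarrow> linear (f2 i)"
    and lin_g: "\<And>j. j \<in> J \<Longrightarrow> linear (g1 j)" "\<And>j. j \<in> J \<Longrightarrow> linear (g2 j)"
  shows "(f \<star> g) (w * z) = (\<Sum>i\<in>I. \<Sum>j\<in>J. (f1 i \<star> g1 j) w * (f2 i \<star> g2 j) z)"
proof -
  let ?p = "tensor_pairing (\<lambda>u v. f u * g v)"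
  let ?p1 = "\<lambda>i j. tensor_pairing (\<lambda>u v. f1 i u * g1 j v)"
  let ?p2 = "\<lambda>i j. tensor_pairing (\<lambda>u v. f2 i u * g2 j v)"
  have b: "bilinear (\<lambda>u v. f u * g v)" by (intro bilinear_mult_functions f g)
  have b1: "bilinear (\<lambda>u v. f1 i u * g1 j v)" and b2: "bilinear (\<lambda>u v. f2 i u * g2 j v)"
    if "i \<in> I" "j \<in> J" for i j
    using that by (auto intro: bilinear_mult_functions lin_f lin_g)
  have lin_mult: "linear (\<lambda>x. c * x)" "linear (\<lambda>x. x * c)" for c :: real
    by (simp_all add: linear_iff distrib_left distrib_right)
  have tens_tens: "?p (tensor_mult (tens us) (tens vs)) =
      (\<Sum>i\<in>I. \<Sum>j\<in>J. ?p1 i j (tens us) * ?p2 i j (tens vs))" for us vs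
  proof (cases "length us = 2 \<and> length vs = 2")
    case True
    then obtain u1 u2 v1 v2 where uv: "us = [u1, u2]" "vs = [v1, v2]"
      by (auto simp: numeral_2_eq_2 length_Suc_conv)
    have "(\<Sum>i\<in>I. f1 i u1 * f2 i v1) * (\<Sum>j\<in>J. g1 j u2 * g2 j v2) =
        (\<Sum>i\<in>I. \<Sum>j\<in>J. (f1 i u1 * g1 j u2) * (f2 i v1 * g2 j v2))"
      by (simp add: sum_product mult_ac)
    also have "\<dots> = (\<Sum>i\<in>I. \<Sum>j\<in>J. ?p1 i j (tens us) * ?p2 i j (tens vs))"
      by (intro sum.cong refl) (simp add: uv b1 b2)
    finally show ?thesis by (simp add: uv tensor_mult_tens b f(2) g(2))
  next
    \<comment> \<open>Outside order two both sides vanish: \<open>tensor_mult\<close> yields 0 or a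
      tensor of the wrong order, and on the right one of the two pairings is 0.\<close>
    case False
    then have "?p1 i j (tens us) * ?p2 i j (tens vs) = 0" if "i \<in> I" "j \<in> J" for i j
      using that by (auto simp: tensor_pairing_tens b1 b2 split: list.splits)
    then have "(\<Sum>i\<in>I. \<Sum>j\<in>J. ?p1 i j (tens us) * ?p2 i j (tens vs)) = 0"
      by (intro sum.neutral ballI)
    moreover have "?p (tensor_mult (tens us) (tens vs)) = 0"
      using False linear_0[OF linear_tensor_pairing[OF b]]
      by (auto simp: tensor_mult_tens tensor_pairing_tens b simp del: length_map length_zip split: list.splits)
        (auto dest!: arg_cong[of _ _ length])
    ultimately show ?thesis by simp
  qed
  have tens_left: "?p (tensor_mult (tens us) t) = (\<Sum>i\<in>I. \<Sum>j\<in>J. ?p1 i j (tens us) * ?p2 i j t)" for us t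
  proof -
    have "linear (?p \<circ> tensor_mult (tens us))"
      by (intro linear_compose linear_tensor_mult linear_tensor_pairing b)
    moreover have "linear (\<lambda>t. \<Sum>i\<in>I. \<Sum>j\<in>J. ?p1 i j (tens us) * ?p2 i j t)"
      by (intro linear_compose_sum ballI linear_compose[OF linear_tensor_pairing lin_mult(1), unfolded o_def] b2)
    ultimately have "?p \<circ> tensor_mult (tens us) = (\<lambda>t. \<Sum>i\<in>I. \<Sum>j\<in>J. ?p1 i j (tens us) * ?p2 i j t)"
      by (rule tensor_linear_unique) (simp add: tens_tens)
    then show ?thesis by (metis comp_apply)
  qed
  have "?p (tensor_mult s t) = (\<Sum>i\<in>I. \<Sum>j\<in>J. ?p1 i j s * ?p2 i j t)" for s t
  proof -
    have "linear (?p \<circ> (\<lambda>s. tensor_mult s t))"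
      by (intro linear_compose linear_tensor_mult linear_tensor_pairing b)
    moreover have "linear (\<lambda>s. \<Sum>i\<in>I. \<Sum>j\<in>J. ?p1 i j s * ?p2 i j t)"
      by (intro linear_compose_sum ballI linear_compose[OF linear_tensor_pairing lin_mult(2), unfolded o_def] b1)
    ultimately have "?p \<circ> (\<lambda>s. tensor_mult s t) = (\<lambda>s. \<Sum>i\<in>I. \<Sum>j\<in>J. ?p1 i j s * ?p2 i j t)"
      by (rule tensor_linear_unique) (simp add: tens_left)
    then show ?thesis by (metis comp_apply)
  qed
  then show ?thesis by (simp add: convolution_def coproduct_mult)
qed

text \<open>A derivation along the counit, that is, a primitive element for the operation dual to
  multiplication.\<close>

definition infinitesimal_character :: "('h \<Rightarrow> real) \<Rightarrow> bool" where
  "infinitesimal_character d \<longleftrightarrow> linear d \<and> (\<forall>u v. d (u * v) = d u * \<epsilon> v + \<epsilon> u * d v)"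

lemma infinitesimal_character_linear: "infinitesimal_character d \<Longrightarrow> linear d"
  by (simp add: infinitesimal_character_def)

lemma convolution_infinitesimal_mult:
  fixes g :: "'h \<Rightarrow> real"
  assumes d: "infinitesimal_character d"
    and g: "linear g" "\<And>u v. g (u * v) = (\<Sum>j\<in>J. g1 j u * g2 j v)"
    and lin_g: "\<And>j. j \<in> J \<Longrightarrow> linear (g1 j)" "\<And>j. j \<in> J \<Longrightarrow> linear (g2 j)"
  shows "(d \<star> g) (w * z) = (\<Sum>j\<in>J. (d \<star> g1 j) w * g2 j z + g1 j w * (d \<star> g2 j) z)"
proof -
  \<comment> \<open>The two summands of the derivation rule are indexed by \<open>bool\<close>, to
    fit the finite sum in \<open>convolution_mult\<close>.\<close>
  define f1 f2 where "f1 b = (if b then d else \<epsilon>)" and "f2 b = (if b then \<epsilon> else d)" for b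
  have "(d \<star> g) (w * z) = (\<Sum>i\<in>(UNIV :: bool set). \<Sum>j\<in>J. (f1 i \<star> g1 j) w * (f2 i \<star> g2 j) z)"
    using d by (intro convolution_mult g lin_g)
      (auto simp: infinitesimal_character_def f1_def f2_def UNIV_bool)
  also have "\<dots> = (\<Sum>j\<in>J. (d \<star> g1 j) w * g2 j z + g1 j w * (d \<star> g2 j) z)"
    by (simp add: UNIV_bool f1_def f2_def sum.distrib[symmetric] lin_g algebra_simps cong: sum.cong)
  finally show ?thesis .
qed

text \<open>Each \<open>d i\<close> acts either on \<open>w\<close> or on \<open>z\<close>, and
  \<open>T\<close> records those acting on \<open>w\<close>. A given pair of orderings of
  \<open>T\<close> and \<open>S - T\<close> is induced by exactly
  \<open>card S choose card T\<close> orderings of \<open>S\<close>, their interleavings. The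
  induction splits off the first functional of an ordering.\<close>

lemma sym_conv_mult:
  assumes "finite S" "\<And>i. i \<in> S \<Longrightarrow> infinitesimal_character (d i)"
  shows "sym_conv d S (w * z) =
    (\<Sum>T\<in>Pow S. real (card S choose card T) * sym_conv d T w * sym_conv d (S - T) z)"
  using assms
proof (induction "card S" arbitrary: S w z)
  case 0
  then show ?case by (simp add: counit_mult)
next
  case (Suc s)
  let ?G = "sym_conv d"
  have fin: "finite T" if "T \<subseteq> S" for T using that Suc.prems(1) by (rule finite_subset)
  have lind: "linear (d i)" if "i \<in> S" for i
    using that Suc.prems(2) infinitesimal_character_linear by blast
  then have lin: "linear (?G T)" if "T \<subseteq> S" for T using that by (intro linear_sym_conv) auto
  have S: "S \<noteq> {}" using Suc.hyps(2) by auto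
  have step: "(d i \<star> ?G (S - {i})) (w * z) =
      (\<Sum>T\<in>Pow (S - {i}). real (s choose card T) * (d i \<star> ?G T) w * ?G (S - {i} - T) z) +
      (\<Sum>T\<in>Pow (S - {i}). real (s choose card T) * ?G T w * (d i \<star> ?G (S - {i} - T)) z)"
    if i: "i \<in> S" for i
  proof -
    have card: "card (S - {i}) = s" using i Suc.hyps(2) Suc.prems(1) by simp
    have "(d i \<star> ?G (S - {i})) (w * z) = (\<Sum>T\<in>Pow (S - {i}).
        (d i \<star> (\<lambda>x. real (s choose card T) * ?G T x)) w * ?G (S - {i} - T) z +
        real (s choose card T) * ?G T w * (d i \<star> ?G (S - {i} - T)) z)"
    proof (rule convolution_infinitesimal_mult)
      show "infinitesimal_character (d i)" using Suc.prems i by simp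
      show "?G (S - {i}) (u * v) =
          (\<Sum>T\<in>Pow (S - {i}). real (s choose card T) * ?G T u * ?G (S - {i} - T) v)" for u v
        using Suc.hyps(1)[of "S - {i}" u v] card Suc.prems by simp
      show "linear (\<lambda>x. real (s choose card T) * ?G T x)" if "T \<in> Pow (S - {i})" for T
      proof -
        have "linear (?G T)" using that by (auto intro: lin)
        then show ?thesis by (simp add: linear_iff algebra_simps)
      qed
    qed (auto intro: lin)
    also have "\<dots> = (\<Sum>T\<in>Pow (S - {i}). real (s choose card T) * (d i \<star> ?G T) w * ?G (S - {i} - T) z +
        real (s choose card T) * ?G T w * (d i \<star> ?G (S - {i} - T)) z)"
    proof (intro sum.cong refl)
      fix T assume "T \<in> Pow (S - {i})"
      then have "linear (?G T)" by (auto intro: lin)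
      from convolution_scaleR[OF lind[OF i] this, of 1 "real (s choose card T)" w]
      have "(d i \<star> (\<lambda>x. real (s choose card T) * ?G T x)) w = real (s choose card T) * (d i \<star> ?G T) w"
        by simp
      then show "(d i \<star> (\<lambda>x. real (s choose card T) * ?G T x)) w * ?G (S - {i} - T) z +
          real (s choose card T) * ?G T w * (d i \<star> ?G (S - {i} - T)) z =
          real (s choose card T) * (d i \<star> ?G T) w * ?G (S - {i} - T) z +
          real (s choose card T) * ?G T w * (d i \<star> ?G (S - {i} - T)) z" by simp
    qed
    finally show ?thesis
      by (simp only: sum.distrib)
  qed
  have "?G S (w * z) = (\<Sum>i\<in>S. (d i \<star> ?G (S - {i})) (w * z))"
    using lind Suc.prems(1) S by (intro sym_conv_remove) auto
  also have "\<dots> = (\<Sum>i\<in>S. \<Sum>T\<in>Pow (S - {i}). real (s choose card T) * (d i \<star> ?G T) w * ?G (S - {i} - T) z) +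
      (\<Sum>i\<in>S. \<Sum>T\<in>Pow (S - {i}). real (s choose card T) * ?G T w * (d i \<star> ?G (S - {i} - T)) z)"
    by (simp add: step sum.distrib cong: sum.cong)
  also have "(\<Sum>i\<in>S. \<Sum>T\<in>Pow (S - {i}). real (s choose card T) * (d i \<star> ?G T) w * ?G (S - {i} - T) z) =
      (\<Sum>T\<in>Pow S. \<Sum>i\<in>T. real (s choose card (T - {i})) * (d i \<star> ?G (T - {i})) w * ?G (S - {i} - (T - {i})) z)"
    by (rule sum_Pow_insert) (rule Suc.prems)
  \<comment> \<open>The empty set is treated apart: its inner sum is empty, whereas
    \<open>card T - 1\<close> would truncate to 0 and leave a non-zero binomial.\<close>
  also have "\<dots> = (\<Sum>T\<in>Pow S. if T = {} then 0 else real (s choose (card T - 1)) * ?G T w * ?G (S - T) z)"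
  proof (rule sum.cong[OF refl])
    fix T assume "T \<in> Pow S"
    then have T: "T \<subseteq> S" "finite T" using fin by auto
    have "(\<Sum>i\<in>T. real (s choose card (T - {i})) * (d i \<star> ?G (T - {i})) w * ?G (S - {i} - (T - {i})) z) =
        (\<Sum>i\<in>T. real (s choose (card T - 1)) * ?G (S - T) z * (d i \<star> ?G (T - {i})) w)"
    proof (intro sum.cong refl)
      fix i assume "i \<in> T"
      then have "S - {i} - (T - {i}) = S - T" by auto
      then show "real (s choose card (T - {i})) * (d i \<star> ?G (T - {i})) w * ?G (S - {i} - (T - {i})) z =
          real (s choose (card T - 1)) * ?G (S - T) z * (d i \<star> ?G (T - {i})) w"
        using T \<open>i \<in> T\<close> by simp
    qed
    also have "\<dots> = (if T = {} then 0 else real (s choose (card T - 1)) * ?G T w * ?G (S - T) z)"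
    proof (cases "T = {}")
      case False
      then have "?G T w = (\<Sum>i\<in>T. (d i \<star> ?G (T - {i})) w)"
        using T lind by (intro sym_conv_remove) auto
      then show ?thesis using False by (simp add: sum_distrib_left mult_ac)
    qed simp
    finally show "(\<Sum>i\<in>T. real (s choose card (T - {i})) * (d i \<star> ?G (T - {i})) w * ?G (S - {i} - (T - {i})) z) =
        (if T = {} then 0 else real (s choose (card T - 1)) * ?G T w * ?G (S - T) z)" .
  qed
  also have "(\<Sum>i\<in>S. \<Sum>T\<in>Pow (S - {i}). real (s choose card T) * ?G T w * (d i \<star> ?G (S - {i} - T)) z) =
      (\<Sum>T\<in>Pow S. \<Sum>i\<in>S - T. real (s choose card T) * ?G T w * (d i \<star> ?G (S - {i} - T)) z)"
    by (rule sum_Pow_remove) (rule Suc.prems)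
  also have "\<dots> = (\<Sum>T\<in>Pow S. real (s choose card T) * ?G T w * ?G (S - T) z)"
  proof (rule sum.cong[OF refl])
    fix T assume "T \<in> Pow S"
    then have T: "T \<subseteq> S" "finite T" using fin by auto
    have comm: "S - {i} - T = S - T - {i}" for i by auto
    show "(\<Sum>i\<in>S - T. real (s choose card T) * ?G T w * (d i \<star> ?G (S - {i} - T)) z) =
      real (s choose card T) * ?G T w * ?G (S - T) z"
    \<comment> \<open>For \<open>T = S\<close> the inner sum is empty, in agreement with
      \<open>s choose Suc s = 0\<close> on the right.\<close>
    proof (cases "T = S")
      case True
      then show ?thesis by (simp add: Suc.hyps(2)[symmetric])
    next
      case False
      then have "?G (S - T) z = (\<Sum>i\<in>S - T. (d i \<star> ?G (S - T - {i})) z)"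
        using T Suc.prems(1) lind by (intro sym_conv_remove) auto
      then show ?thesis by (simp add: sum_distrib_left comm)
    qed
  qed
  \<comment> \<open>Pascal's rule with \<open>card S = Suc s\<close>: the first functional acts on
    \<open>w\<close> in one sum and on \<open>z\<close> in the other.\<close>
  also have "(\<Sum>T\<in>Pow S. if T = {} then 0 else real (s choose (card T - 1)) * ?G T w * ?G (S - T) z) +
      (\<Sum>T\<in>Pow S. real (s choose card T) * ?G T w * ?G (S - T) z) =
      (\<Sum>T\<in>Pow S. real (card S choose card T) * ?G T w * ?G (S - T) z)"
    unfolding sum.distrib[symmetric]
  proof (rule sum.cong[OF refl])
    fix T assume "T \<in> Pow S"
    then have T: "finite T" using fin by auto
    show "(if T = {} then 0 else real (s choose (card T - 1)) * ?G T w * ?G (S - T) z) +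
        real (s choose card T) * ?G T w * ?G (S - T) z =
        real (card S choose card T) * ?G T w * ?G (S - T) z"
      using T by (cases "card T") (auto simp: Suc.hyps(2)[symmetric] algebra_simps)
  qed
  finally show ?case .
qed

text \<open>On tensors of order \<open>k\<close> the iterated product is \<open>tensor_eval\<close>
  of \<open>k\<close> identity maps, so the general formula for iterated coproducts applies to the
  identity.\<close>

lemma hopf_power_eq_conv_list: "hopf_power \<Delta> k x = conv_list (replicate k (\<lambda>x. x)) x"
proof -
  have ml: "multilinear (prod_list :: 'h list \<Rightarrow> 'h)"
    by (simp add: multilinear_def distrib_left distrib_right)
  have lin: "linear f" if "f \<in> set (replicate k (\<lambda>x :: 'h. x))" for f
    using that by (simp add: linear_ident)
  have map2: "map2 (\<lambda>f. f) (replicate (length us) (\<lambda>x. x)) us = us" for us :: "'h list"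
    by (induction us) auto
  have eval: "tensor_eval (replicate k (\<lambda>x. x)) (tens us) =
      (if length us = length (replicate k (\<lambda>x. x :: 'h)) then
        prod_list (map2 (\<lambda>f. f) (replicate k (\<lambda>x. x)) us) else 0)" for us :: "'h list"
    using lin by (rule tensor_eval_tens)
  have "iter_product (iter_coproduct \<Delta> k x) = tensor_eval (replicate k (\<lambda>x. x)) (iter_coproduct \<Delta> k x)"
    unfolding iter_product_def
    by (rule tensor_power_eqI[OF linear_tensor_lift[OF ml] linear_tensor_eval[OF lin] _ iter_coproduct_in_tensor_power])
      (auto simp: eval tensor_lift_tens[OF ml] map2)
  also have "\<dots> = conv_list (replicate k (\<lambda>x. x)) x"
    using tensor_eval_iter_coproduct[of "replicate k (\<lambda>x. x)" x, OF lin] by simp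
  finally show ?thesis by (simp add: hopf_power_def)
qed

lemma linear_hopf_power: "linear (hopf_power \<Delta> k)"
proof -
  have "hopf_power \<Delta> k = conv_list (replicate k (\<lambda>x. x))"
    by (rule ext) (rule hopf_power_eq_conv_list)
  moreover have "linear (conv_list (replicate k (\<lambda>x :: 'h. x)))"
    by (rule linear_conv_list) (simp add: linear_ident)
  ultimately show ?thesis by simp
qed

lemma hopf_power_1 [simp]: "hopf_power \<Delta> (Suc 0) x = x"
  by (simp add: hopf_power_eq_conv_list conv_list_Nil convolution_counit_right linear_ident)

lemma hopf_power_Suc: "hopf_power \<Delta> (Suc k) = (\<lambda>x. x) \<star> hopf_power \<Delta> k"
  by (simp add: hopf_power_eq_conv_list[abs_def])

text \<open>By \<open>hopf_power_Suc\<close> one more identity is convolved in. Splitting over the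
  product gives binomials, the induction hypothesis gives \<open>k ^ (s - j)\<close> for a subset of
  size \<open>j\<close> of the \<open>s\<close> indices, and the convolutions over all such subsets
  recombine by \<open>sum_sym_conv_convolution\<close>. What remains is the binomial expansion of
  \<open>(k + 1) ^ s\<close>.\<close>

lemma sym_conv_hopf_power:
  assumes "k > 0" "finite S" "\<And>i. i \<in> S \<Longrightarrow> infinitesimal_character (d i)"
  shows "sym_conv d S (hopf_power \<Delta> k x) = real k ^ card S * sym_conv d S x"
  using assms
proof (induction k arbitrary: S x rule: nat_induct_non_zero)
  case 1
  then show ?case by simp
next
  case (Suc k)
  let ?G = "sym_conv d" and ?s = "card S"
  have lin: "linear (?G T)" if "T \<subseteq> S" for T
    using that Suc.prems(2) infinitesimal_character_linear by (intro linear_sym_conv) auto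
  have linH: "linear (\<lambda>v. ?G T (hopf_power \<Delta> k v))" if "T \<subseteq> S" for T
    using linear_compose[OF linear_hopf_power lin[OF that]] by (simp add: o_def)
  have b: "bilinear (\<lambda>u v. u * hopf_power \<Delta> k v)"
    by (intro bilinear_mult_functions linear_ident linear_hopf_power)
  have bT: "bilinear (\<lambda>u v. real (?s choose card T) * (?G T u * ?G (S - T) (hopf_power \<Delta> k v)))"
    if "T \<in> Pow S" for T
    using that by (intro bilinear_linear_mult lin linH) auto
  have "?G S (hopf_power \<Delta> (Suc k) x) =
      tensor_pairing (\<lambda>u v. ?G S (u * hopf_power \<Delta> k v)) (\<Delta> x)"
    by (simp add: hopf_power_Suc convolution_def linear_tensor_pairing_comp[OF lin b])
  also have "\<dots> = tensor_pairing (\<lambda>u v. \<Sum>T\<in>Pow S.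
      real (?s choose card T) * (?G T u * ?G (S - T) (hopf_power \<Delta> k v))) (\<Delta> x)"
    by (simp add: sym_conv_mult[OF Suc.prems] mult.assoc)
  also have "\<dots> = (\<Sum>T\<in>Pow S. tensor_pairing (\<lambda>u v.
      real (?s choose card T) * (?G T u * ?G (S - T) (hopf_power \<Delta> k v))) (\<Delta> x))"
    by (rule tensor_pairing_sum) (rule bT)
  also have "\<dots> = (\<Sum>T\<in>Pow S. real (?s choose card T) * real k ^ (?s - card T) * (?G T \<star> ?G (S - T)) x)"
  proof (rule sum.cong[OF refl])
    fix T assume "T \<in> Pow S"
    then have T: "T \<subseteq> S" "finite T" using Suc.prems(1) finite_subset by auto
    have "?G (S - T) (hopf_power \<Delta> k v) = real k ^ (?s - card T) * ?G (S - T) v" for v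
      using Suc.IH[of "S - T" v] Suc.prems T by (auto simp: card_Diff_subset)
    moreover have "bilinear (\<lambda>u v. ?G T u * ?G (S - T) v)"
      using T by (intro bilinear_mult_functions lin) auto
    ultimately show "tensor_pairing (\<lambda>u v. real (?s choose card T) *
        (?G T u * ?G (S - T) (hopf_power \<Delta> k v))) (\<Delta> x) =
        real (?s choose card T) * real k ^ (?s - card T) * (?G T \<star> ?G (S - T)) x"
      using tensor_pairing_scaleR[of "\<lambda>u v. ?G T u * ?G (S - T) v"
          "real (?s choose card T) * real k ^ (?s - card T)" "\<Delta> x"]
      by (simp add: convolution_def mult_ac)
  qed
  also have "\<dots> = (\<Sum>j\<le>?s. \<Sum>T | T \<in> Pow S \<and> card T = j.
      real (?s choose card T) * real k ^ (?s - card T) * (?G T \<star> ?G (S - T)) x)"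
    by (rule sum.group[symmetric]) (use Suc.prems(1) card_mono in auto)
  also have "\<dots> = (\<Sum>j\<le>?s. real (?s choose j) * real k ^ (?s - j) * ?G S x)"
  proof (rule sum.cong[OF refl])
    fix j assume "j \<in> {..?s}"
    then have "(\<Sum>T | T \<subseteq> S \<and> card T = j. (?G T \<star> ?G (S - T)) x) = ?G S x"
      using Suc.prems infinitesimal_character_linear by (intro sum_sym_conv_convolution) auto
    then show "(\<Sum>T | T \<in> Pow S \<and> card T = j.
        real (?s choose card T) * real k ^ (?s - card T) * (?G T \<star> ?G (S - T)) x) =
        real (?s choose j) * real k ^ (?s - j) * ?G S x"
      by (simp add: sum_distrib_left flip: \<open>(\<Sum>T | T \<subseteq> S \<and> card T = j. (?G T \<star> ?G (S - T)) x) = ?G S x\<close>)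
  qed
  also have "\<dots> = real (Suc k) ^ ?s * ?G S x"
    using binomial_ring[of 1 "real k" ?s] by (simp add: sum_distrib_right[symmetric] add.commute)
  finally show ?case .
qed

text \<open>Pigeonhole: with fewer functionals than factors, some factor meets only the counit,
  which kills it.\<close>

lemma sym_conv_prod_list_eq_0:
  assumes "finite S" "\<And>i. i \<in> S \<Longrightarrow> infinitesimal_character (d i)"
    and "\<And>e. e \<in> set es \<Longrightarrow> \<epsilon> e = 0" "card S < length es"
  shows "sym_conv d S (prod_list es) = 0"
  using assms
proof (induction es arbitrary: S)
  case Nil
  then show ?case by simp
next
  case (Cons e es)
  have "sym_conv d T e * sym_conv d (S - T) (prod_list es) = 0" if "T \<subseteq> S" for T
  proof (cases "T = {}")
    case True
    then show ?thesis using Cons.prems(3) by simp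
  next
    case False
    have "finite T" using that Cons.prems(1) by (rule finite_subset)
    then have "card (S - T) < card S"
      using that False Cons.prems(1) by (intro psubset_card_mono) auto
    then show ?thesis using Cons.prems Cons.IH[of "S - T"] by simp
  qed
  then have "(\<Sum>T\<in>Pow S. real (card S choose card T) * (sym_conv d T e * sym_conv d (S - T) (prod_list es))) = 0"
    by (intro sum.neutral) auto
  then show ?case by (simp add: sym_conv_mult[OF Cons.prems(1,2)] mult.assoc)
qed

text \<open>Every factor must receive exactly one functional. Such an assignment is an ordering of
  \<open>S\<close>, and the factorial counts the orders of convolution, each of which produces every
  assignment once.\<close>

lemma sym_conv_prod_list:
  assumes "finite S" "\<And>i. i \<in> S \<Longrightarrow> infinitesimal_character (d i)"
    and "\<And>e. e \<in> set es \<Longrightarrow> \<epsilon> e = 0" "card S = length es"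
  shows "sym_conv d S (prod_list es) =
    fact (card S) * (\<Sum>is\<in>permutations_of_set S. prod_list (map2 d is es))"
  using assms
proof (induction es arbitrary: S)
  case Nil
  then show ?case by (simp add: counit_1)
next
  case (Cons e es)
  let ?G = "sym_conv d" and ?s = "card S"
  have S: "S \<noteq> {}" using Cons.prems(4) by auto
  have zero: "?G T e * ?G (S - T) (prod_list es) = 0" if T: "T \<subseteq> S" "card T \<noteq> 1" for T
  proof (cases "T = {}")
    case True
    then show ?thesis using Cons.prems(3) by simp
  next
    case False
    have fin: "finite T" using T(1) Cons.prems(1) by (rule finite_subset)
    then have "card T \<ge> 2" using False T(2) by (cases "card T") auto
    moreover have "card T \<le> card S" using T Cons.prems(1) by (intro card_mono)
    ultimately have "card (S - T) < length es"
      using T fin Cons.prems(4) by (simp add: card_Diff_subset)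
    then have "?G (S - T) (prod_list es) = 0"
      using Cons.prems by (intro sym_conv_prod_list_eq_0) auto
    then show ?thesis by simp
  qed
  have "?G S (e * prod_list es) =
      (\<Sum>T\<in>Pow S. real (?s choose card T) * ?G T e * ?G (S - T) (prod_list es))"
    by (rule sym_conv_mult) (use Cons.prems in auto)
  \<comment> \<open>Only singletons survive: \<open>e\<close> needs at least one functional, and a
    second one would leave too few for \<open>es\<close>.\<close>
  also have "\<dots> = (\<Sum>T\<in>(\<lambda>i. {i}) ` S. real (?s choose card T) * ?G T e * ?G (S - T) (prod_list es))"
    by (rule sum.mono_neutral_right)
      (use Cons.prems(1) zero in \<open>auto simp: card_1_singleton_iff mult.assoc\<close>)
  also have "\<dots> = (\<Sum>i\<in>S. real ?s * d i e * ?G (S - {i}) (prod_list es))"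
    using Cons.prems(2) infinitesimal_character_linear
    by (subst sum.reindex) (auto simp: sym_conv_singleton intro!: sum.cong)
  also have "\<dots> = (\<Sum>i\<in>S. real ?s * d i e *
      (fact (?s - 1) * (\<Sum>is\<in>permutations_of_set (S - {i}). prod_list (map2 d is es))))"
  proof (intro sum.cong refl)
    fix i assume "i \<in> S"
    then have card: "card (S - {i}) = ?s - 1" using Cons.prems(1) by simp
    have "?G (S - {i}) (prod_list es) =
        fact (card (S - {i})) * (\<Sum>is\<in>permutations_of_set (S - {i}). prod_list (map2 d is es))"
      by (rule Cons.IH) (use Cons.prems card in auto)
    then show "real ?s * d i e * ?G (S - {i}) (prod_list es) = real ?s * d i e *
        (fact (?s - 1) * (\<Sum>is\<in>permutations_of_set (S - {i}). prod_list (map2 d is es)))"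
      by (simp add: card)
  qed
  also have "\<dots> = fact ?s * (\<Sum>i\<in>S. \<Sum>is\<in>permutations_of_set (S - {i}). d i e * prod_list (map2 d is es))"
    using Cons.prems(4) by (simp add: sum_distrib_left mult_ac)
  also have "(\<Sum>i\<in>S. \<Sum>is\<in>permutations_of_set (S - {i}). d i e * prod_list (map2 d is es)) =
      (\<Sum>is\<in>permutations_of_set S. prod_list (map2 d is (e # es)))"
    by (subst sum_permutations_of_set) (simp_all add: Cons.prems(1) S)
  finally show ?case by simp
qed

end

section \<open>Dual basis functionals\<close>

lemma bilinear_eq_on_spanning:
  assumes "span U = UNIV" "bilinear \<beta>" "bilinear \<beta>'" "\<And>u v. u \<in> U \<Longrightarrow> v \<in> U \<Longrightarrow> \<beta> u v = \<beta>' u v"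
  shows "\<beta> u v = \<beta>' u v"
proof -
  have span: "x \<in> span U" for x using assms(1) by simp
  have right: "linear (\<beta> u)" "linear (\<beta>' u)" and left: "linear (\<lambda>u. \<beta> u v)" "linear (\<lambda>u. \<beta>' u v)" for u v
    using assms(2,3) by (simp_all add: bilinear_def)
  have "\<beta> u v = \<beta>' u v" if "u \<in> U" for u v
    by (rule linear_eq_on_span[OF right assms(4)[OF that] span])
  then show ?thesis
    by (rule linear_eq_on_span[OF left _ span])
qed

lemma independentI_dual:
  fixes E :: "'a::real_vector set"
  assumes "\<And>b. b \<in> E \<Longrightarrow> \<exists>L :: 'a \<Rightarrow> real. linear L \<and> L b = 1 \<and> (\<forall>e\<in>E. e \<noteq> b \<longrightarrow> L e = 0)"
  shows "independent E"
proof
  assume "dependent E"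
  then obtain b where b: "b \<in> E" "b \<in> span (E - {b})" by (auto simp: dependent_def)
  with assms obtain L :: "'a \<Rightarrow> real" where L: "linear L" "L b = 1" "\<forall>e\<in>E. e \<noteq> b \<longrightarrow> L e = 0"
    by blast
  have "L b = 0" using linear_eq_0_on_span[OF L(1) _ b(2)] L(3) by blast
  with L(2) show False by simp
qed

lemma representation_eq_dual:
  fixes L :: "'a::real_vector \<Rightarrow> real"
  assumes "independent E" "t \<in> span E" "linear L" "L b = 1" "\<And>e. e \<in> E \<Longrightarrow> e \<noteq> b \<Longrightarrow> L e = 0" "b \<in> E"
  shows "representation E t b = L t"
proof -
  let ?S = "{e. representation E t e \<noteq> 0}"
  have "L t = L (\<Sum>e\<in>?S. representation E t e *\<^sub>R e)"
    by (simp add: sum_nonzero_representation_eq assms(1,2))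
  also have "\<dots> = (\<Sum>e\<in>?S. representation E t e * L e)"
    by (simp add: linear_sum[OF assms(3)] linear_scale[OF assms(3)])
  also have "\<dots> = (\<Sum>e\<in>?S. if e = b then representation E t e else 0)"
    using assms(4,5) representation_ne_zero by (intro sum.cong) auto
  also have "\<dots> = representation E t b"
    by (simp add: sum.delta' finite_representation)
  finally show ?thesis ..
qed

section \<open>Free-commutative state space bases\<close>

locale free_state_space =
  fixes H :: "nat \<Rightarrow> 'h::{real_algebra_1, comm_ring_1} set"
    and \<Delta> :: "'h \<Rightarrow> 'h tensor"
    and B :: "nat \<Rightarrow> 'h set"
    and C :: "'h set"
  assumes hopf: "graded_connected_Hopf_algebra H \<Delta>"
    and finite_dimensional: "\<exists>S. finite S \<and> span S = H k"
    and state_space: "state_space_basis H \<Delta> B"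
    and free: "free_commutative_basis H B C"
begin

section \<open>The monomial basis, its grading and its coefficient functionals\<close>

abbreviation basis :: "'h set" where
  "basis \<equiv> \<Union>n. B n"

definition dual :: "'h \<Rightarrow> 'h \<Rightarrow> real" where
  "dual b x = representation basis x b"

lemma basis_eq: "basis = prod_mset ` {S. set_mset S \<subseteq> C}"
  using free by (simp add: free_commutative_basis_def)

lemma inj_prod_mset: "inj_on prod_mset {S. set_mset S \<subseteq> C}"
  using free by (simp add: free_commutative_basis_def free_polynomial_generators_def)

lemma independent_basis: "independent basis" and span_basis: "span basis = UNIV"
  using free by (simp_all add: free_commutative_basis_def free_polynomial_generators_def basis_eq)

lemma in_span_basis [simp]: "x \<in> span basis"
  by (simp add: span_basis)

lemma linear_dual [simp]: "linear (dual b)"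
  unfolding dual_def
  by (simp add: linear_iff representation_add representation_scale independent_basis)

lemma dual_basis: "b \<in> basis \<Longrightarrow> dual c b = (if c = b then 1 else 0)"
  by (simp add: dual_def representation_basis independent_basis)

lemma graded_basis: "graded_basis H B"
  using state_space by (simp add: state_space_basis_def)

lemma B_0: "B 0 = {1}" and independent_B: "independent (B n)" and span_B: "span (B n) = H n"
  using graded_basis by (simp_all add: graded_basis_def)

lemma in_B_in_basis [intro]: "x \<in> B n \<Longrightarrow> x \<in> basis"
  by auto

lemma one_in_basis [simp]: "1 \<in> basis"
  using B_0 by blast

lemma dual_one: "dual c 1 = (if c = 1 then 1 else 0)"
  by (rule dual_basis) (rule one_in_basis)

lemma B_subset_H: "x \<in> B n \<Longrightarrow> x \<in> H n"
  using span_base span_B by blast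

lemma finite_B [simp]: "finite (B n)"
proof -
  obtain S where "finite S" "span S = H n" using finite_dimensional by blast
  then show ?thesis
    using independent_span_bound[OF _ independent_B, of S n] B_subset_H by auto
qed

text \<open>A non-zero \<open>x\<close> placed in degree \<open>i\<close> and the same
  \<open>x\<close> placed in degree \<open>j\<close> would be two homogeneous decompositions of
  it.\<close>

lemma H_disjoint:
  assumes "x \<in> H i" "x \<in> H j" "i \<noteq> j"
  shows "x = 0"
proof (rule ccontr)
  assume "x \<noteq> 0"
  have grad: "graded_vector_space H"
    using hopf by (simp add: graded_connected_Hopf_algebra_def)
  then have zero: "0 \<in> H k" for k
    by (simp add: graded_vector_space_def subspace_0)
  define f where "f k m = (if m = k then x else 0)" for k m :: nat
  have supp: "{m. f k m \<noteq> 0} = {k}" for k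
    using \<open>x \<noteq> 0\<close> by (auto simp: f_def)
  have f: "(\<forall>m. f k m \<in> H m) \<and> finite {m. f k m \<noteq> 0} \<and> x = (\<Sum>m | f k m \<noteq> 0. f k m)" if "x \<in> H k" for k
    unfolding supp using that zero by (simp add: f_def)
  have "\<exists>!f. (\<forall>n. f n \<in> H n) \<and> finite {n. f n \<noteq> 0} \<and> x = (\<Sum>n | f n \<noteq> 0. f n)"
    using grad by (simp add: graded_vector_space_def)
  then have "f i = f j" using f[OF assms(1)] f[OF assms(2)] by blast
  then have "f i i = f j i" by simp
  then show False using assms(3) \<open>x \<noteq> 0\<close> by (simp add: f_def)
qed

lemma basis_nonzero: "x \<in> basis \<Longrightarrow> x \<noteq> 0"
  using independent_basis dependent_zero by blast

lemma degree_unique: "x \<in> B i \<Longrightarrow> x \<in> H j \<Longrightarrow> i = j"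
  using H_disjoint B_subset_H basis_nonzero by blast

lemma basis_degree_eq: "x \<in> B n \<Longrightarrow> basis_degree B x = n"
  unfolding basis_degree_def by (rule the_equality) (auto dest: B_subset_H intro: degree_unique)

lemma in_B_basis_degree: "x \<in> basis \<Longrightarrow> x \<in> B (basis_degree B x)"
  using basis_degree_eq by auto

lemma dual_H_eq_0:
  assumes "b \<in> B m" "x \<in> H n" "m \<noteq> n"
  shows "dual b x = 0"
proof (rule linear_eq_0_on_span[OF linear_dual])
  show "x \<in> span (B n)" using assms by (simp add: span_B)
  fix z assume "z \<in> B n"
  then show "dual b z = 0"
    using assms degree_unique[of b m n] B_subset_H by (subst dual_basis) auto
qed

lemma generator_in_basis: "c \<in> C \<Longrightarrow> c \<in> basis"
  unfolding basis_eq by (rule image_eqI[of _ _ "{#c#}"]) auto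

lemma generator_degree:
  assumes "c \<in> C"
  shows "c \<in> B (basis_degree B c)" "basis_degree B c > 0"
proof -
  show c: "c \<in> B (basis_degree B c)"
    by (intro in_B_basis_degree generator_in_basis assms)
  obtain d where "d > 0" "c \<in> H d"
    using free assms by (auto simp: free_commutative_basis_def)
  with degree_unique[OF c] show "basis_degree B c > 0" by blast
qed

lemma basis_mult: "w \<in> basis \<Longrightarrow> z \<in> basis \<Longrightarrow> w * z \<in> basis"
  unfolding basis_eq
proof (elim imageE)
  fix p q assume "w = prod_mset p" "z = prod_mset q" "p \<in> {S. set_mset S \<subseteq> C}" "q \<in> {S. set_mset S \<subseteq> C}"
  then show "w * z \<in> prod_mset ` {S. set_mset S \<subseteq> C}"
    by (intro image_eqI[of _ _ "p + q"]) auto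
qed

lemma B_mult:
  assumes "w \<in> B i" "z \<in> B j"
  shows "w * z \<in> B (i + j)"
proof -
  have "w * z \<in> H (i + j)"
    using hopf assms B_subset_H by (auto simp: graded_connected_Hopf_algebra_def)
  moreover have "w * z \<in> basis" using assms by (intro basis_mult) auto
  ultimately show ?thesis using degree_unique by blast
qed

lemma B_prod_list: "set cs \<subseteq> C \<Longrightarrow> prod_list cs \<in> B (\<Sum>c\<leftarrow>cs. basis_degree B c)"
  by (induction cs) (auto simp: B_0 intro: B_mult generator_degree)

lemma basis_factorisation:
  assumes "x \<in> basis"
  obtains es where "set es \<subseteq> C" "x = prod_list es"
proof -
  obtain S where S: "x = prod_mset S" "set_mset S \<subseteq> C" using assms unfolding basis_eq by auto
  obtain es where "mset es = S" using ex_mset by blast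
  then show ?thesis using that[of es] S by (auto simp: prod_mset_prod_list)
qed

lemma prod_mset_eq_iff:
  "set_mset p \<subseteq> C \<Longrightarrow> set_mset q \<subseteq> C \<Longrightarrow> prod_mset p = prod_mset q \<longleftrightarrow> p = q"
  using inj_prod_mset by (auto dest: inj_onD)

lemma dual_prod_mset:
  "set_mset p \<subseteq> C \<Longrightarrow> set_mset q \<subseteq> C \<Longrightarrow> dual (prod_mset p) (prod_mset q) = (if p = q then 1 else 0)"
  by (subst dual_basis) (auto simp: basis_eq prod_mset_eq_iff)

lemma dual_one_prod_mset: "set_mset q \<subseteq> C \<Longrightarrow> dual 1 (prod_mset q) = (if q = {#} then 1 else 0)"
  using dual_prod_mset[of "{#}" q] by auto

lemma dual_generator_prod_mset:
  "c \<in> C \<Longrightarrow> set_mset q \<subseteq> C \<Longrightarrow> dual c (prod_mset q) = (if q = {#c#} then 1 else 0)"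
  using dual_prod_mset[of "{#c#}" q] by auto

lemma bilinear_dual_mult: "bilinear (\<lambda>u v. dual b (u * v))"
  by (rule bilinear_compose[OF linear_dual bilinear_times])

lemma dual_one_mult: "dual 1 (w * z) = dual 1 w * dual 1 z"
proof (rule bilinear_eq_on_spanning[OF span_basis bilinear_dual_mult])
  show "bilinear (\<lambda>u v. dual 1 u * dual 1 v)" by (intro bilinear_mult_functions linear_dual)
  fix u v assume "u \<in> basis" "v \<in> basis"
  then obtain p q where "u = prod_mset p" "v = prod_mset q" "set_mset p \<subseteq> C" "set_mset q \<subseteq> C"
    by (auto simp: basis_eq)
  then show "dual 1 (u * v) = dual 1 u * dual 1 v"
    using dual_one_prod_mset[of "p + q"] dual_one_prod_mset[of p] dual_one_prod_mset[of q] by auto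
qed

text \<open>By unique factorisation a product of two monomials is the single generator
  \<open>c\<close> only if one of them is \<open>c\<close> and the other is 1. This is how freeness
  makes generators dual to infinitesimal characters.\<close>

lemma dual_generator_mult:
  assumes "c \<in> C"
  shows "dual c (w * z) = dual c w * dual 1 z + dual 1 w * dual c z"
proof (rule bilinear_eq_on_spanning[OF span_basis bilinear_dual_mult])
  show "bilinear (\<lambda>u v. dual c u * dual 1 v + dual 1 u * dual c v)"
    by (intro iffD2[OF bilinear_def] conjI allI linear_compose_add)
      (use bilinear_mult_functions[of "dual c" "dual 1"] bilinear_mult_functions[of "dual 1" "dual c"]
       in \<open>auto simp: bilinear_def\<close>)
  fix u v assume "u \<in> basis" "v \<in> basis"
  then obtain p q where pq: "u = prod_mset p" "v = prod_mset q" "set_mset p \<subseteq> C" "set_mset q \<subseteq> C"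
    by (auto simp: basis_eq)
  have "p + q = {#c#} \<longleftrightarrow> (p = {#c#} \<and> q = {#}) \<or> (p = {#} \<and> q = {#c#})"
    by (cases p) auto
  then show "dual c (u * v) = dual c u * dual 1 v + dual 1 u * dual c v"
    using pq assms dual_generator_prod_mset[of c "p + q"]
      dual_one_prod_mset[of p] dual_one_prod_mset[of q]
      dual_generator_prod_mset[of c p] dual_generator_prod_mset[of c q]
    by auto
qed

lemma coproduct_graded:
  "x \<in> H n \<Longrightarrow> \<Delta> x \<in> span {tens [u, v] | u v j. j \<le> n \<and> u \<in> H j \<and> v \<in> H (n - j)}"
  using hopf by (simp add: graded_connected_Hopf_algebra_def)

lemma coproduct_reduced:
  "n \<ge> 1 \<Longrightarrow> x \<in> H n \<Longrightarrow> \<Delta> x - tens [1, x] - tens [x, 1] \<in>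
    span {tens [u, v] | u v j. 1 \<le> j \<and> j < n \<and> u \<in> H j \<and> v \<in> H (n - j)}"
  using hopf by (simp add: graded_connected_Hopf_algebra_def)

lemma linear_Delta: "linear \<Delta>"
  using hopf by (simp add: graded_connected_Hopf_algebra_def)

text \<open>The counit is the projection onto degree zero. The reduced coproduct has both tensor
  factors in positive degree, where \<open>dual 1\<close> vanishes, and the two terms with a factor
  1 return \<open>x\<close>.\<close>

sublocale bialgebra \<Delta> "dual 1"
proof (intro bialgebra.intro coalgebra.intro bialgebra_axioms.intro)
  show "linear \<Delta>" by (rule linear_Delta)
  show "\<Delta> x \<in> tensor_power 2" for x
  proof (rule linear_image_span_subset[OF linear_Delta in_span_basis subspace_tensor_power])
    fix x assume "x \<in> basis"
    then obtain n where "x \<in> H n" using B_subset_H by blast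
    have "span {tens [u, v] | u v j. j \<le> n \<and> u \<in> H j \<and> v \<in> H (n - j)} \<subseteq> tensor_power 2"
      by (intro span_minimal subspace_tensor_power) auto
    with coproduct_graded[OF \<open>x \<in> H n\<close>] show "\<Delta> x \<in> tensor_power 2" by blast
  qed
  show "tensor_pairing (\<lambda>u v. \<Delta> u \<otimes>\<^sub>t tens [v]) (\<Delta> x) = tensor_pairing (\<lambda>u v. tens [u] \<otimes>\<^sub>t \<Delta> v) (\<Delta> x)" for x
    using hopf by (simp add: graded_connected_Hopf_algebra_def tensor_pairing_def)
  show "linear (dual 1)" by simp
  \<comment> \<open>Stated for a general pairing so that the left and the right counit law are both
    instances.\<close>
  have unit: "tensor_pairing \<beta> (\<Delta> x) = x"
    if b: "bilinear \<beta>" and vanish: "\<And>m n u v. m \<ge> 1 \<Longrightarrow> n \<ge> 1 \<Longrightarrow> u \<in> H m \<Longrightarrow> v \<in> H n \<Longrightarrow> \<beta> u v = 0"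
      and one: "\<beta> 1 1 = 1" and prim: "\<And>n x. n \<ge> 1 \<Longrightarrow> x \<in> H n \<Longrightarrow> \<beta> 1 x + \<beta> x 1 = x"
    for \<beta> :: "'h \<Rightarrow> 'h \<Rightarrow> 'h" and x
  proof -
    have lin: "linear (tensor_pairing \<beta>)" by (rule linear_tensor_pairing[OF b])
    have "(tensor_pairing \<beta> \<circ> \<Delta>) x = x"
    proof (rule linear_eq_on_span[OF linear_compose[OF linear_Delta lin] linear_ident _ in_span_basis])
      fix x assume "x \<in> basis"
      then obtain n where n: "x \<in> B n" by blast
      show "(tensor_pairing \<beta> \<circ> \<Delta>) x = x"
      proof (cases "n = 0")
        case True
        then have "x = 1" using n B_0 by simp
        moreover have "\<Delta> 1 = tens [1, 1]" using hopf by (simp add: graded_connected_Hopf_algebra_def)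
        ultimately show ?thesis by (simp add: b one)
      next
        case False
        then have n1: "n \<ge> 1" "x \<in> H n" using n B_subset_H by auto
        have "tensor_pairing \<beta> (\<Delta> x - tens [1, x] - tens [x, 1]) = 0"
        proof (rule linear_eq_0_on_span[OF lin _ coproduct_reduced[OF n1]])
          fix t assume "t \<in> {tens [u, v] | u v j. 1 \<le> j \<and> j < n \<and> u \<in> H j \<and> v \<in> H (n - j)}"
          then obtain u v j where "t = tens [u, v]" "1 \<le> j" "j < n" "u \<in> H j" "v \<in> H (n - j)"
            by blast
          then show "tensor_pairing \<beta> t = 0" using vanish[of j "n - j" u v] b by simp
        qed
        then show ?thesis
          using prim[OF n1] by (simp add: linear_diff[OF lin] linear_add[OF lin] b algebra_simps)
      qed
    qed
    then show ?thesis by simp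
  qed
  have dual1: "dual 1 u = 0" if "u \<in> H m" "m \<ge> 1" for u m
    using dual_H_eq_0[of 1 0 u m] that B_0 by auto
  have one: "dual 1 1 = 1" by (simp add: dual_one)
  show "tensor_pairing (\<lambda>u v. dual 1 u *\<^sub>R v) (\<Delta> x) = x" for x
    by (rule unit) (auto simp: bilinear_def linear_iff linear_add[OF linear_dual] linear_scale[OF linear_dual]
        algebra_simps dual1 one)
  show "tensor_pairing (\<lambda>u v. dual 1 v *\<^sub>R u) (\<Delta> x) = x" for x
    by (rule unit) (auto simp: bilinear_def linear_iff linear_add[OF linear_dual] linear_scale[OF linear_dual]
        algebra_simps dual1 one)
  show "\<Delta> (w * z) = tensor_mult (\<Delta> w) (\<Delta> z)" for w z
    using hopf by (simp add: graded_connected_Hopf_algebra_def)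
  show "dual 1 (w * z) = dual 1 w * dual 1 z" for w z by (rule dual_one_mult)
  show "dual 1 1 = 1" by (rule one)
qed

section \<open>Coproduct coefficients as convolutions of coefficient functionals\<close>

lemma infinitesimal_character_dual: "c \<in> C \<Longrightarrow> infinitesimal_character (dual c)"
  by (simp add: infinitesimal_character_def dual_generator_mult)

lemma prod_list_map2_dual:
  "set us \<subseteq> basis \<Longrightarrow> length us = length zs \<Longrightarrow>
    prod_list (map2 (\<lambda>f u. f u) (map dual zs) us) = (if us = zs then 1 else 0)"
  by (induction us zs rule: list_induct2') (auto simp: dual_basis)

lemma tensor_eval_dual:
  "set us \<subseteq> basis \<Longrightarrow> length us = length zs \<Longrightarrow> tensor_eval (map dual zs) (tens us) = (if us = zs then 1 else 0)"
proof -
  assume us: "set us \<subseteq> basis" "length us = length zs"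
  have "tensor_eval (map dual zs) (tens us) = (if length us = length (map dual zs) then
      prod_list (map2 (\<lambda>f u. f u) (map dual zs) us) else 0)"
    by (rule tensor_eval_tens) auto
  then show ?thesis using us by (simp add: prod_list_map2_dual del: map_map)
qed

lemma linear_tensor_eval_dual: "linear (tensor_eval (map dual zs))"
  by (rule linear_tensor_eval) auto

text \<open>The functional \<open>tensor_eval (map dual zs)\<close> is 1 at \<open>tens zs\<close>
  and 0 at the other tensors of basis elements of that order. The same functionals compute the
  coefficients in \<open>representation_tens_basis\<close>.\<close>

lemma independent_tens_basis: "independent (tens ` {us. length us = k \<and> set us \<subseteq> basis})"
proof (rule independentI_dual)
  fix b assume "b \<in> tens ` {us. length us = k \<and> set us \<subseteq> basis}"
  then obtain zs where zs: "b = tens zs" "length zs = k" "set zs \<subseteq> basis" by auto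
  have "tensor_eval (map dual zs) e = 0"
    if "e \<in> tens ` {us. length us = k \<and> set us \<subseteq> basis}" "e \<noteq> b" for e
    using that zs by (auto simp: tensor_eval_dual)
  then show "\<exists>L :: 'h tensor \<Rightarrow> real. linear L \<and> L b = 1 \<and>
      (\<forall>e\<in>tens ` {us. length us = k \<and> set us \<subseteq> basis}. e \<noteq> b \<longrightarrow> L e = 0)"
    using zs linear_tensor_eval_dual[of zs] by (intro exI[of _ "tensor_eval (map dual zs)"]) (simp add: tensor_eval_dual)
qed

lemma representation_tens_basis:
  assumes "t \<in> tensor_power (length zs)" "set zs \<subseteq> basis"
  shows "representation (tens ` {us. length us = length zs \<and> set us \<subseteq> basis}) t (tens zs) =
    tensor_eval (map dual zs) t"
  by (rule representation_eq_dual[OF independent_tens_basis _ linear_tensor_eval_dual])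
    (use assms in \<open>auto simp: tensor_eval_dual tensor_power_eq_span[OF span_basis]\<close>)

lemma coproduct_coeff_eq:
  assumes "set zs \<subseteq> basis"
  shows "coproduct_coeff \<Delta> B x zs = conv_list (map dual zs) x"
proof -
  have "tensor_eval (map dual zs) (iter_coproduct \<Delta> (length (map dual zs)) x) = conv_list (map dual zs) x"
    by (rule tensor_eval_iter_coproduct) auto
  then show ?thesis
    by (simp add: coproduct_coeff_def representation_tens_basis iter_coproduct_in_tensor_power assms)
qed

lemma dual_nonzero_in_B: "b \<in> basis \<Longrightarrow> x \<in> H n \<Longrightarrow> dual b x \<noteq> 0 \<Longrightarrow> b \<in> B n"
  using in_B_basis_degree dual_H_eq_0 by metis

section \<open>Positivity on the cone spanned by the basis\<close>

lemma iter_coproduct_2: "iter_coproduct \<Delta> (Suc (Suc 0)) x = \<Delta> x"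
  by (simp add: tensor_lift_tens[OF multilinear_coproduct_last])

text \<open>The assumed non-negativity concerns two-fold coefficients. These are the coordinates of
  the coproduct, so the pairing is a non-negative combination of values of \<open>\<beta>\<close> on
  basis pairs; convolution then spreads positivity to coefficients of any length.\<close>

lemma pairing_coproduct_nonneg:
  fixes \<beta> :: "'h \<Rightarrow> 'h \<Rightarrow> real"
  assumes b: "bilinear \<beta>" and nonneg: "\<And>u v. u \<in> basis \<Longrightarrow> v \<in> basis \<Longrightarrow> \<beta> u v \<ge> 0"
    and x: "x \<in> basis"
  shows "tensor_pairing \<beta> (\<Delta> x) \<ge> 0"
proof -
  let ?E = "tens ` {us. length us = Suc (Suc 0) \<and> set us \<subseteq> basis}"
  let ?r = "representation ?E (\<Delta> x)"
  have "\<Delta> x \<in> span ?E"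
    using coproduct_in_tensor_power[of x] tensor_power_eq_span[OF span_basis, of 2]
    by (simp add: numeral_2_eq_2)
  then have "\<Delta> x = (\<Sum>e | ?r e \<noteq> 0. ?r e *\<^sub>R e)"
    by (simp add: sum_nonzero_representation_eq independent_tens_basis)
  then have "tensor_pairing \<beta> (\<Delta> x) = tensor_pairing \<beta> (\<Sum>e | ?r e \<noteq> 0. ?r e *\<^sub>R e)"
    by simp
  also have "\<dots> = (\<Sum>e | ?r e \<noteq> 0. ?r e * tensor_pairing \<beta> e)"
    using linear_tensor_pairing[OF b] by (simp add: linear_sum linear_scale)
  also have "\<dots> \<ge> 0"
  proof (rule sum_nonneg)
    fix e assume "e \<in> {e. ?r e \<noteq> 0}"
    then have "e \<in> ?E" using representation_ne_zero by blast
    then obtain w z where e: "e = tens [w, z]" "w \<in> basis" "z \<in> basis"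
      by (auto simp: length_Suc_conv)
    have "coproduct_coeff \<Delta> B x [w, z] \<ge> 0"
      using state_space x e(2,3) unfolding state_space_basis_def by blast
    then have "?r e \<ge> 0"
      by (simp add: coproduct_coeff_def iter_coproduct_2 e del: iter_coproduct.simps)
    then show "?r e * tensor_pairing \<beta> e \<ge> 0"
      using nonneg e b by simp
  qed
  finally show ?thesis .
qed

lemma convolution_mono:
  fixes f f' g g' :: "'h \<Rightarrow> real"
  assumes lin: "linear f" "linear f'" "linear g" "linear g'"
    and le: "\<And>u. u \<in> basis \<Longrightarrow> f' u \<le> f u" "\<And>u. u \<in> basis \<Longrightarrow> g' u \<le> g u"
    and nonneg: "\<And>u. u \<in> basis \<Longrightarrow> 0 \<le> f' u" "\<And>u. u \<in> basis \<Longrightarrow> 0 \<le> g' u"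
    and x: "x \<in> basis"
  shows "(f' \<star> g') x \<le> (f \<star> g) x"
proof -
  let ?b = "\<lambda>u v. f u * g v" and ?b' = "\<lambda>u v. f' u * g' v"
  have b: "bilinear ?b" "bilinear ?b'" by (intro bilinear_mult_functions lin)+
  then have b_diff: "bilinear (\<lambda>u v. ?b u v - ?b' u v)"
    by (auto simp: bilinear_def intro: linear_compose_sub)
  have "tensor_pairing (\<lambda>u v. ?b u v - ?b' u v) t = tensor_pairing ?b t - tensor_pairing ?b' t" for t
  proof -
    have "tensor_pairing (\<lambda>u v. ?b u v - ?b' u v) = (\<lambda>t. tensor_pairing ?b t - tensor_pairing ?b' t)"
      by (intro tensor_linear_unique linear_compose_sub linear_tensor_pairing b b_diff)
        (auto simp: tensor_pairing_tens b b_diff split: list.split)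
    then show ?thesis by metis
  qed
  moreover have "tensor_pairing (\<lambda>u v. ?b u v - ?b' u v) (\<Delta> x) \<ge> 0"
  proof (rule pairing_coproduct_nonneg[OF b_diff _ x])
    fix u v assume uv: "u \<in> basis" "v \<in> basis"
    then have "f u \<ge> 0" using le(1) nonneg(1) order_trans by blast
    then show "0 \<le> f u * g v - f' u * g' v"
      using mult_mono[OF le(1)[OF uv(1)] le(2)[OF uv(2)]] nonneg(2)[OF uv(2)] by simp
  qed
  ultimately show ?thesis by (simp add: convolution_def)
qed

lemma convolution_nonneg:
  fixes f g :: "'h \<Rightarrow> real"
  assumes "linear f" "linear g" "\<And>u. u \<in> basis \<Longrightarrow> 0 \<le> f u" "\<And>u. u \<in> basis \<Longrightarrow> 0 \<le> g u" "x \<in> basis"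
  shows "0 \<le> (f \<star> g) x"
  unfolding convolution_def
  by (rule pairing_coproduct_nonneg) (use assms in \<open>auto intro: bilinear_mult_functions\<close>)

lemma dual_nonneg [simp]: "x \<in> basis \<Longrightarrow> 0 \<le> dual b x"
  by (simp add: dual_basis)

lemma conv_list_nonneg:
  fixes fs :: "('h \<Rightarrow> real) list"
  assumes "\<And>f. f \<in> set fs \<Longrightarrow> linear f" "\<And>f u. f \<in> set fs \<Longrightarrow> u \<in> basis \<Longrightarrow> 0 \<le> f u" "x \<in> basis"
  shows "0 \<le> conv_list fs x"
  using assms
proof (induction fs arbitrary: x)
  case Nil
  then show ?case by simp
next
  case (Cons f fs)
  then show ?case
    unfolding conv_list_Cons by (intro convolution_nonneg linear_conv_list) auto
qed

lemma conv_list_mono: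
  fixes F G :: "'a \<Rightarrow> 'h \<Rightarrow> real"
  assumes "\<And>d. d \<in> set ds \<Longrightarrow> linear (F d)" "\<And>d. d \<in> set ds \<Longrightarrow> linear (G d)"
    and "\<And>d u. d \<in> set ds \<Longrightarrow> u \<in> basis \<Longrightarrow> 0 \<le> F d u"
    and "\<And>d u. d \<in> set ds \<Longrightarrow> u \<in> basis \<Longrightarrow> F d u \<le> G d u" "x \<in> basis"
  shows "conv_list (map F ds) x \<le> conv_list (map G ds) x"
  using assms
proof (induction ds arbitrary: x)
  case Nil
  then show ?case by simp
next
  case (Cons d ds)
  have "(F d \<star> conv_list (map F ds)) x \<le> (G d \<star> conv_list (map G ds)) x"
  proof (rule convolution_mono)
    show "conv_list (map F ds) u \<le> conv_list (map G ds) u" if "u \<in> basis" for u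
      by (rule Cons.IH) (use Cons.prems that in auto)
    show "0 \<le> conv_list (map F ds) u" if "u \<in> basis" for u
    proof (rule conv_list_nonneg[OF _ _ that])
      fix f v assume "f \<in> set (map F ds)" "v \<in> basis"
      then show "0 \<le> f v" using Cons.prems(3) by force
    qed (use Cons.prems(1) in auto)
    show "linear (conv_list (map F ds))" "linear (conv_list (map G ds))"
      by (rule linear_conv_list; use Cons.prems in auto)+
  qed (use Cons.prems in auto)
  then show ?case by simp
qed

lemma nonneg_on_cone:
  fixes L :: "'h \<Rightarrow> real"
  assumes "linear L" "\<And>u. u \<in> basis \<Longrightarrow> 0 \<le> L u" "\<And>b. b \<in> basis \<Longrightarrow> 0 \<le> dual b v"
  shows "0 \<le> L v"
proof -
  let ?S = "{b. dual b v \<noteq> 0}"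
  have S: "?S \<subseteq> basis" unfolding dual_def by (auto dest: representation_ne_zero)
  have "v = (\<Sum>b\<in>?S. dual b v *\<^sub>R b)"
    unfolding dual_def by (simp add: sum_nonzero_representation_eq independent_basis)
  then have "L v = L (\<Sum>b\<in>?S. dual b v *\<^sub>R b)" by simp
  also have "\<dots> = (\<Sum>b\<in>?S. dual b v * L b)"
    by (simp add: linear_sum[OF assms(1)] linear_scale[OF assms(1)])
  also have "\<dots> \<ge> 0"
    using S assms by (intro sum_nonneg mult_nonneg_nonneg) auto
  finally show ?thesis .
qed

text \<open>One more Hopf power applies the coproduct, which has non-negative coefficients, and then
  multiplies by a basis element. The latter preserves the cone because products of basis elements
  are again basis elements.\<close>

lemma dual_hopf_power_nonneg:
  assumes "k > 0" "x \<in> basis"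
  shows "0 \<le> dual b (hopf_power \<Delta> k x)"
  using assms
proof (induction k arbitrary: x b rule: nat_induct_non_zero)
  case 1
  then show ?case by simp
next
  case (Suc k)
  have bil: "bilinear (\<lambda>u v. u * hopf_power \<Delta> k v)"
    by (intro bilinear_mult_functions linear_ident linear_hopf_power)
  have "dual b (hopf_power \<Delta> (Suc k) x) = tensor_pairing (\<lambda>u v. dual b (u * hopf_power \<Delta> k v)) (\<Delta> x)"
    by (simp add: hopf_power_Suc convolution_def linear_tensor_pairing_comp[OF linear_dual bil])
  also have "\<dots> \<ge> 0"
  proof (rule pairing_coproduct_nonneg[OF bilinear_compose[OF linear_dual bil] _ Suc.prems])
    fix u v assume uv: "u \<in> basis" "v \<in> basis"
    have "linear (\<lambda>w. dual b (u * w))"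
      using bilinear_dual_mult by (simp add: bilinear_def)
    then show "0 \<le> dual b (u * hopf_power \<Delta> k v)"
      by (rule nonneg_on_cone) (use uv Suc.IH basis_mult in auto)
  qed
  finally show ?case .
qed

subsection \<open>The rescaling function\<close>

definition dual_B1 :: "'h \<Rightarrow> real" where
  "dual_B1 = (\<lambda>x. \<Sum>c\<in>B 1. dual c x)"

text \<open>The rescaling function extended to a linear functional on the whole algebra, so that it
  can be convolved. The degree becomes an index of its own, and \<open>rescale n\<close> vanishes on
  homogeneous elements of other degrees.\<close>

definition rescale :: "nat \<Rightarrow> 'h \<Rightarrow> real" where
  "rescale n = conv_list (replicate n dual_B1)"

lemma linear_dual_B1 [simp]: "linear dual_B1"
  unfolding dual_B1_def by (intro linear_compose_sum) simp

lemma linear_rescale [simp]: "linear (rescale n)"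
  unfolding rescale_def by (rule linear_conv_list) simp

lemma dual_B1_nonneg: "x \<in> basis \<Longrightarrow> 0 \<le> dual_B1 x"
  unfolding dual_B1_def by (intro sum_nonneg) simp

lemma rescale_nonneg: "x \<in> basis \<Longrightarrow> 0 \<le> rescale n x"
  unfolding rescale_def by (rule conv_list_nonneg) (auto simp: dual_B1_nonneg)

lemma rescale_0 [simp]: "rescale 0 = dual 1"
  by (simp add: rescale_def)

lemma rescale_Suc: "rescale (Suc n) = dual_B1 \<star> rescale n"
  by (simp add: rescale_def)

lemma rescale_add: "rescale (m + n) = rescale m \<star> rescale n"
  unfolding rescale_def replicate_add by (rule conv_list_append) auto

lemma sum_conv_list_lists:
  "(\<Sum>cs | length cs = n \<and> set cs \<subseteq> B 1. conv_list (map dual cs) x) = rescale n x"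
proof (induction n arbitrary: x)
  case 0
  have "{cs. length cs = 0 \<and> set cs \<subseteq> B 1} = {[]}" by auto
  then show ?case by simp
next
  case (Suc n)
  have lists: "{cs. length cs = n \<and> set cs \<subseteq> B 1} = {cs. set cs \<subseteq> B 1 \<and> length cs = n}" for n
    by auto
  have fin: "finite {cs. length cs = n \<and> set cs \<subseteq> B 1}"
    unfolding lists by (rule finite_lists_length_eq) simp
  have "(\<Sum>cs | length cs = Suc n \<and> set cs \<subseteq> B 1. conv_list (map dual cs) x) =
      (\<Sum>(cs, c)\<in>{cs. length cs = n \<and> set cs \<subseteq> B 1} \<times> B 1. (dual c \<star> conv_list (map dual cs)) x)"
    unfolding lists lists_length_Suc_eq
    by (subst sum.reindex) (auto simp: inj_on_def intro!: sum.cong)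
  also have "\<dots> = (\<Sum>c\<in>B 1. \<Sum>cs | length cs = n \<and> set cs \<subseteq> B 1. (dual c \<star> conv_list (map dual cs)) x)"
    by (subst sum.cartesian_product[symmetric]) (rule sum.swap)
  also have "\<dots> = (\<Sum>c\<in>B 1. (dual c \<star> (\<lambda>x. \<Sum>cs | length cs = n \<and> set cs \<subseteq> B 1. conv_list (map dual cs) x)) x)"
    by (intro sum.cong refl convolution_sum_right[symmetric] linear_conv_list) auto
  also have "\<dots> = (\<Sum>c\<in>B 1. (dual c \<star> rescale n) x)"
    by (simp only: Suc.IH)
  also have "\<dots> = (dual_B1 \<star> rescale n) x"
    unfolding dual_B1_def by (intro convolution_sum_left[symmetric]) auto
  finally show ?case by (simp add: rescale_Suc)
qed

lemma rescaling_eq: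
  assumes "x \<in> B n"
  shows "rescaling \<Delta> B x = rescale n x"
proof -
  have "rescaling \<Delta> B x = (\<Sum>cs | length cs = n \<and> set cs \<subseteq> B 1. conv_list (map dual cs) x)"
    unfolding rescaling_def basis_degree_eq[OF assms]
    by (intro sum.cong refl coproduct_coeff_eq) blast
  then show ?thesis by (simp only: sum_conv_list_lists)
qed

lemma dual_B1_H_eq_0: "x \<in> H n \<Longrightarrow> n \<noteq> 1 \<Longrightarrow> dual_B1 x = 0"
  unfolding dual_B1_def using dual_H_eq_0[of _ 1 x n] by (intro sum.neutral) auto

lemma rescale_H_eq_0: "x \<in> H n \<Longrightarrow> m \<noteq> n \<Longrightarrow> rescale m x = 0"
proof (induction m arbitrary: n x)
  case 0
  then show ?case using dual_H_eq_0[of 1 0 x n] B_0 by simp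
next
  case (Suc m)
  have b: "bilinear (\<lambda>u v. dual_B1 u * rescale m v)"
    by (intro bilinear_mult_functions) auto
  have "tensor_pairing (\<lambda>u v. dual_B1 u * rescale m v) (\<Delta> x) = 0"
  proof (rule linear_eq_0_on_span[OF linear_tensor_pairing[OF b] _ coproduct_graded[OF Suc.prems(1)]])
    fix t assume "t \<in> {tens [u, v] | u v j. j \<le> n \<and> u \<in> H j \<and> v \<in> H (n - j)}"
    then obtain u v j where t: "t = tens [u, v]" "j \<le> n" "u \<in> H j" "v \<in> H (n - j)" by blast
    have "dual_B1 u * rescale m v = 0"
    proof (cases "j = 1")
      case True
      then have "m \<noteq> n - j" using Suc.prems(2) t(2) by auto
      then show ?thesis using Suc.IH[OF t(4)] by simp
    next
      case False
      then show ?thesis using dual_B1_H_eq_0[OF t(3)] by simp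
    qed
    then show "tensor_pairing (\<lambda>u v. dual_B1 u * rescale m v) t = 0" using t b by simp
  qed
  then show ?case by (simp add: rescale_Suc convolution_def)
qed

text \<open>Generators have positive degree and degrees add, so degree one leaves room for a single
  factor. Consequently \<open>dual_B1\<close> is infinitesimal.\<close>

lemma B1_subset_generators: "B 1 \<subseteq> C"
proof
  fix x assume x: "x \<in> B 1"
  then have "x \<in> basis" by blast
  then obtain es where es: "set es \<subseteq> C" "x = prod_list es"
    by (rule basis_factorisation)
  then have "(\<Sum>e\<leftarrow>es. basis_degree B e) = 1"
    using degree_unique[OF x] B_subset_H[OF B_prod_list[OF es(1)]] by simp
  moreover have "length es \<le> (\<Sum>e\<leftarrow>es. basis_degree B e)"
    using es(1) by (induction es) (auto dest: generator_degree(2))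
  moreover have "es \<noteq> []" using \<open>(\<Sum>e\<leftarrow>es. basis_degree B e) = 1\<close> by auto
  ultimately have "length es = 1" by (cases es) auto
  then obtain e where "es = [e]" by (auto simp: length_Suc_conv)
  then show "x \<in> C" using es by simp
qed

lemma infinitesimal_character_dual_B1: "infinitesimal_character dual_B1"
  using B1_subset_generators
  by (auto simp: infinitesimal_character_def dual_B1_def[abs_def] dual_generator_mult sum.distrib
      sum_distrib_left sum_distrib_right subset_iff intro!: linear_compose_sum)

text \<open>For the constant family \<open>dual_B1\<close> on \<open>n\<close> indices,
  \<open>sym_conv\<close> is \<open>n!\<close> times \<open>rescale n\<close>. In
  \<open>sym_conv_mult\<close> the degrees force \<open>card T = i\<close>; there the binomial turns
  \<open>i! j!\<close> into \<open>(i + j)!\<close>, which cancels, and the binomial in the result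
  is the number of such \<open>T\<close>.\<close>

lemma rescale_mult:
  assumes "w \<in> B i" "z \<in> B j"
  shows "rescale (i + j) (w * z) = real ((i + j) choose i) * rescale i w * rescale j z"
proof -
  have G: "sym_conv (\<lambda>_. dual_B1) S x = fact (card S) * rescale (card S) x" if "finite S" for S :: "nat set" and x
  proof -
    have "sym_conv (\<lambda>_. dual_B1) S x = (\<Sum>is\<in>permutations_of_set S. rescale (card S) x)"
      unfolding sym_conv_def rescale_def
      by (intro sum.cong refl) (simp add: map_replicate_const length_finite_permutations_of_set that)
    then show ?thesis using that by simp
  qed
  let ?s = "i + j" and ?S = "{..<i + j}"
  have "fact ?s * rescale ?s (w * z) = sym_conv (\<lambda>_. dual_B1) ?S (w * z)"
    using G[of ?S] by simp
  also have "\<dots> = (\<Sum>T\<in>Pow ?S. real (card ?S choose card T) *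
      sym_conv (\<lambda>_. dual_B1) T w * sym_conv (\<lambda>_. dual_B1) (?S - T) z)"
    by (rule sym_conv_mult) (auto simp: infinitesimal_character_dual_B1)
  also have "\<dots> = (\<Sum>T\<in>Pow ?S. if card T = i then fact ?s * (rescale i w * rescale j z) else 0)"
  proof (rule sum.cong[OF refl])
    fix T assume "T \<in> Pow ?S"
    then have T: "T \<subseteq> ?S" "finite T" by (auto intro: finite_subset)
    have card: "card T \<le> ?s" using card_mono[OF _ T(1)] by simp
    show "real (card ?S choose card T) * sym_conv (\<lambda>_. dual_B1) T w * sym_conv (\<lambda>_. dual_B1) (?S - T) z =
        (if card T = i then fact ?s * (rescale i w * rescale j z) else 0)"
    proof (cases "card T = i")
      case True
      have "real (?s choose i) * fact i * fact j = fact ?s"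
        using binomial_fact[of i ?s, where 'a = real] by simp
      then show ?thesis
        using T True by (simp add: G card_Diff_subset mult_ac flip: \<open>real (?s choose i) * fact i * fact j = fact ?s\<close>)
    next
      case False
      then have "rescale (card T) w = 0" using rescale_H_eq_0 B_subset_H assms(1) by blast
      then show ?thesis using T False by (simp add: G)
    qed
  qed
  also have "\<dots> = (\<Sum>T | T \<subseteq> ?S \<and> card T = i. fact ?s * (rescale i w * rescale j z))"
    by (simp add: sum.inter_filter[symmetric])
  also have "\<dots> = real (?s choose i) * (fact ?s * (rescale i w * rescale j z))"
    using n_subsets[of ?S i] by simp
  finally have "fact ?s * rescale ?s (w * z) = fact ?s * (real (?s choose i) * (rescale i w * rescale j z))"
    by simp
  then show ?thesis by (simp add: mult.assoc)
qed

lemma rescale_prod_list: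
  assumes "set cs \<subseteq> C"
  shows "rescale (\<Sum>c\<leftarrow>cs. basis_degree B c) (prod_list cs) =
    fact (\<Sum>c\<leftarrow>cs. basis_degree B c) / (\<Prod>c\<leftarrow>cs. fact (basis_degree B c)) *
      (\<Prod>c\<leftarrow>cs. rescale (basis_degree B c) c)"
  using assms
proof (induction cs)
  case Nil
  then show ?case by (simp add: dual_one)
next
  case (Cons c cs)
  let ?d = "basis_degree B c" and ?D = "\<Sum>c\<leftarrow>cs. basis_degree B c"
  have "rescale (?d + ?D) (c * prod_list cs) = real ((?d + ?D) choose ?d) * rescale ?d c * rescale ?D (prod_list cs)"
    using Cons.prems by (intro rescale_mult B_prod_list generator_degree) auto
  also have "real ((?d + ?D) choose ?d) = fact (?d + ?D) / (fact ?d * fact ?D)"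
    using binomial_fact[of ?d "?d + ?D", where 'a = real] by simp
  finally show ?case using Cons by simp
qed

text \<open>Strong induction on the degree. Above degree one \<open>x\<close> is not primitive, so
  some \<open>w \<otimes> z\<close> with both factors of positive degree occurs in its coproduct,
  necessarily with a positive coefficient, and \<open>\<eta>(x)\<close> is at least that coefficient
  times \<open>\<eta>(w) \<eta>(z)\<close>.\<close>

lemma rescale_pos:
  assumes "x \<in> B n"
  shows "0 < rescale n x"
  using assms
proof (induction n arbitrary: x rule: less_induct)
  case (less n)
  consider "n = 0" | "n = 1" | "n > 1" by linarith
  then show ?case
  proof cases
    case 1
    then show ?thesis using less.prems B_0 by (simp add: dual_one)
  next
    case 2
    then have "x \<in> B 1" using less.prems by simp
    then have "dual_B1 x = 1"
      unfolding dual_B1_def using in_B_in_basis by (simp add: dual_basis)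
    moreover have "rescale 1 = dual_B1" by (simp add: rescale_Suc)
    ultimately show ?thesis using 2 by simp
  next
    case 3
    let ?r = "\<Delta> x - tens [1, x] - tens [x, 1]"
    let ?E = "tens ` {us. length us = 2 \<and> set us \<subseteq> basis}"
    have x: "x \<in> basis" "x \<in> H n" using less.prems B_subset_H by auto
    have "\<Delta> x \<noteq> tens [1, x] + tens [x, 1]"
      using state_space less.prems 3 by (simp add: state_space_basis_def)
    then have "?r \<noteq> 0" by (simp add: algebra_simps)
    have r2: "?r \<in> tensor_power 2"
      by (intro subspace_diff[OF subspace_tensor_power] coproduct_in_tensor_power) simp_all
    have "\<exists>e. representation ?E ?r e \<noteq> 0"
    proof (rule ccontr)
      assume "\<nexists>e. representation ?E ?r e \<noteq> 0"
      then have "(\<Sum>e | representation ?E ?r e \<noteq> 0. representation ?E ?r e *\<^sub>R e) = 0" by simp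
      moreover have "(\<Sum>e | representation ?E ?r e \<noteq> 0. representation ?E ?r e *\<^sub>R e) = ?r"
        using r2 by (intro sum_nonzero_representation_eq independent_tens_basis)
          (simp add: tensor_power_eq_span[OF span_basis])
      ultimately show False using \<open>?r \<noteq> 0\<close> by simp
    qed
    then obtain e where e: "representation ?E ?r e \<noteq> 0" by blast
    then have "e \<in> ?E" using representation_ne_zero by blast
    then obtain w z where wz: "e = tens [w, z]" "w \<in> basis" "z \<in> basis"
      by (auto simp: length_Suc_conv numeral_2_eq_2)
    let ?L = "tensor_pairing (\<lambda>u v. dual w u * dual z v)"
    have b: "bilinear (\<lambda>u v. dual w u * dual z v)" by (intro bilinear_mult_functions) auto
    have linL: "linear ?L" by (rule linear_tensor_pairing[OF b])
    have "representation ?E ?r e = ?L ?r"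
      by (rule representation_eq_dual[OF independent_tens_basis _ linL])
        (use r2 wz b in \<open>auto simp: tensor_power_eq_span[OF span_basis] length_Suc_conv numeral_2_eq_2 dual_basis\<close>)
    with e have Lr: "?L ?r \<noteq> 0" by simp
    \<comment> \<open>The reduced coproduct is spanned by tensors of complementary positive degrees.
      One of them must have a non-zero coefficient at \<open>w\<close>, \<open>z\<close>, which
      locates the degrees of \<open>w\<close> and \<open>z\<close>.\<close>
    have "\<exists>j u v. 1 \<le> j \<and> j < n \<and> u \<in> H j \<and> v \<in> H (n - j) \<and> dual w u * dual z v \<noteq> 0"
    proof (rule ccontr)
      assume neg: "\<nexists>j u v. 1 \<le> j \<and> j < n \<and> u \<in> H j \<and> v \<in> H (n - j) \<and> dual w u * dual z v \<noteq> 0"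
      have "?L ?r = 0"
      proof (rule linear_eq_0_on_span[OF linL _ coproduct_reduced[OF _ x(2)]])
        fix t assume "t \<in> {tens [u, v] | u v j. 1 \<le> j \<and> j < n \<and> u \<in> H j \<and> v \<in> H (n - j)}"
        then obtain u v j where "t = tens [u, v]" "1 \<le> j" "j < n" "u \<in> H j" "v \<in> H (n - j)" by blast
        then show "?L t = 0" using neg b by simp
      qed (use 3 in simp)
      with Lr show False by simp
    qed
    then obtain j u v where j: "1 \<le> j" "j < n" and uv: "u \<in> H j" "v \<in> H (n - j)" "dual w u \<noteq> 0" "dual z v \<noteq> 0"
      by auto
    have w: "w \<in> B j" and z: "z \<in> B (n - j)"
      using dual_nonzero_in_B wz uv by blast+
    \<comment> \<open>Restoring the terms \<open>tens [1, x]\<close> and \<open>tens [x, 1]\<close>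
      leaves the coefficient unchanged, since the degree of \<open>w\<close> lies strictly between 0
      and \<open>n\<close>.\<close>
    have "dual w 1 = 0" using dual_H_eq_0[OF w, of 1 0] B_0 B_subset_H[of 1 0] j by simp
    moreover have "dual w x * dual z 1 = 0"
      using dual_H_eq_0[OF w x(2)] j by simp
    ultimately have "?L ?r = ?L (\<Delta> x)" by (simp add: linear_diff[OF linL] b)
    then have "(dual w \<star> dual z) x \<noteq> 0" using Lr by (simp add: convolution_def)
    moreover have "0 \<le> (dual w \<star> dual z) x" using x by (intro convolution_nonneg) auto
    ultimately have pos: "0 < (dual w \<star> dual z) x" by simp
    have wj: "0 < rescale j w" and zj: "0 < rescale (n - j) z"
      using less.IH[OF _ w] less.IH[OF _ z] j by auto
    \<comment> \<open>This multiple of \<open>dual b\<close> agrees with \<open>rescale k\<close> at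
      \<open>b\<close> and is 0 at every other basis element, so \<open>convolution_mono\<close>
      becomes applicable.\<close>
    have dual_le: "rescale k b * dual b u \<le> rescale k u" if "b \<in> basis" "u \<in> basis" for k b u
      using that by (auto simp: dual_basis rescale_nonneg)
    have scale: "linear (\<lambda>u. rescale k b * dual b u)" for k b
      using linear_compose_scale_right[OF linear_dual, of "rescale k b" b] by simp
    have "0 < rescale j w * rescale (n - j) z * (dual w \<star> dual z) x"
      using pos wj zj by simp
    also have "\<dots> = ((\<lambda>u. rescale j w * dual w u) \<star> (\<lambda>u. rescale (n - j) z * dual z u)) x"
      using convolution_scaleR[of "dual w" "dual z" "rescale j w" "rescale (n - j) z" x] by simp
    also have "\<dots> \<le> (rescale j \<star> rescale (n - j)) x"
      by (rule convolution_mono) (use wz x scale wj zj dual_le in auto)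
    also have "\<dots> = rescale n x" using rescale_add[of j "n - j"] j by simp
    finally show ?thesis .
  qed
qed

end

section \<open>The eigenfunction attached to a state\<close>

text \<open>Links the sum over permutation functions in \<open>symmetrised_coeff\<close> with the
  sum over orderings in \<open>sym_conv\<close>. Surjectivity follows by counting, as both sides
  have \<open>l!\<close> elements.\<close>

lemma bij_betw_permutes_permutations_of_set:
  "bij_betw (\<lambda>\<sigma>. map \<sigma> [0..<l]) {\<sigma>. \<sigma> permutes {..<l}} (permutations_of_set {..<l})"
proof -
  let ?h = "\<lambda>\<sigma> :: nat \<Rightarrow> nat. map \<sigma> [0..<l]"
  have inj: "inj_on ?h {\<sigma>. \<sigma> permutes {..<l}}"
  proof (rule inj_onI)
    fix \<sigma> \<tau> :: "nat \<Rightarrow> nat"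
    assume *: "\<sigma> \<in> {\<sigma>. \<sigma> permutes {..<l}}" "\<tau> \<in> {\<sigma>. \<sigma> permutes {..<l}}" "map \<sigma> [0..<l] = map \<tau> [0..<l]"
    show "\<sigma> = \<tau>"
    proof
      fix i
      show "\<sigma> i = \<tau> i" using * by (cases "i < l") (auto simp: permutes_not_in)
    qed
  qed
  have "?h ` {\<sigma>. \<sigma> permutes {..<l}} \<subseteq> permutations_of_set {..<l}"
  proof (intro image_subsetI permutations_of_setI)
    fix \<sigma> assume "\<sigma> \<in> {\<sigma>. \<sigma> permutes {..<l}}"
    then have \<sigma>: "\<sigma> permutes {..<l}" by simp
    show "set (map \<sigma> [0..<l]) = {..<l}"
      using permutes_image[OF \<sigma>] by (simp add: atLeast0LessThan)
    show "distinct (map \<sigma> [0..<l])"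
      using permutes_inj_on[OF \<sigma>] by (simp add: distinct_map)
  qed
  moreover have "card (?h ` {\<sigma>. \<sigma> permutes {..<l}}) = card (permutations_of_set {..<l})"
    by (simp add: card_image[OF inj] card_permutations)
  ultimately have "?h ` {\<sigma>. \<sigma> permutes {..<l}} = permutations_of_set {..<l}"
    by (intro card_subset_eq) auto
  with inj show ?thesis by (simp add: bij_betw_def)
qed

lemma permute_list_eq_map: "permute_list \<sigma> cs = map ((!) cs) (map \<sigma> [0..<length cs])"
  by (simp add: permute_list_def)

lemma stabiliser_size_pos: "0 < stabiliser_size cs"
proof -
  have "finite {\<sigma>. \<sigma> permutes {..<length cs} \<and> permute_list \<sigma> cs = cs}"
    by (rule finite_subset[OF _ finite_permutations[of "{..<length cs}"]]) auto
  moreover have "id \<in> {\<sigma>. \<sigma> permutes {..<length cs} \<and> permute_list \<sigma> cs = cs}"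
    by (simp add: permutes_id)
  ultimately show ?thesis
    unfolding stabiliser_size_def card_gt_0_iff by blast
qed

lemma sum_list_permute_list:
  fixes f :: "'a \<Rightarrow> 'b::comm_monoid_add"
  assumes "\<sigma> permutes {..<length cs}"
  shows "(\<Sum>c\<leftarrow>permute_list \<sigma> cs. f c) = (\<Sum>c\<leftarrow>cs. f c)"
proof -
  have "mset (map f (permute_list \<sigma> cs)) = mset (map f cs)" using assms by simp
  then show ?thesis by (metis sum_mset_sum_list)
qed

lemma prod_list_permute_list:
  fixes f :: "'a \<Rightarrow> 'b::comm_monoid_mult"
  assumes "\<sigma> permutes {..<length cs}"
  shows "(\<Prod>c\<leftarrow>permute_list \<sigma> cs. f c) = (\<Prod>c\<leftarrow>cs. f c)"
proof -
  have "mset (map f (permute_list \<sigma> cs)) = mset (map f cs)" using assms by simp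
  then show ?thesis by (metis prod_mset_prod_list)
qed

context free_state_space
begin

lemma set_permute_generators:
  "set cs \<subseteq> C \<Longrightarrow> \<sigma> permutes {..<length cs} \<Longrightarrow> set (permute_list \<sigma> cs) \<subseteq> basis"
  using generator_in_basis by (simp add: set_permute_list) blast

lemma symmetrised_coeff_eq:
  assumes "set cs \<subseteq> C"
  shows "symmetrised_coeff \<Delta> B cs = sym_conv (\<lambda>i. dual (cs ! i)) {..<length cs}"
proof
  fix x
  have "symmetrised_coeff \<Delta> B cs x =
      (\<Sum>\<sigma> | \<sigma> permutes {..<length cs}. conv_list (map (\<lambda>i. dual (cs ! i)) (map \<sigma> [0..<length cs])) x)"
    unfolding symmetrised_coeff_def
  proof (rule sum.cong[OF refl])
    fix \<sigma> assume "\<sigma> \<in> {\<sigma>. \<sigma> permutes {..<length cs}}"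
    then have "set (permute_list \<sigma> cs) \<subseteq> basis"
      using assms by (intro set_permute_generators) auto
    then have "coproduct_coeff \<Delta> B x (permute_list \<sigma> cs) = conv_list (map dual (permute_list \<sigma> cs)) x"
      by (rule coproduct_coeff_eq)
    also have "map dual (permute_list \<sigma> cs) = map (\<lambda>i. dual (cs ! i)) (map \<sigma> [0..<length cs])"
      by (simp add: permute_list_def)
    finally show "coproduct_coeff \<Delta> B x (permute_list \<sigma> cs) =
      conv_list (map (\<lambda>i. dual (cs ! i)) (map \<sigma> [0..<length cs])) x" .
  qed
  also have "\<dots> = sym_conv (\<lambda>i. dual (cs ! i)) {..<length cs} x"
    unfolding sym_conv_def by (rule sum.reindex_bij_betw[OF bij_betw_permutes_permutations_of_set])
  finally show "symmetrised_coeff \<Delta> B cs x = sym_conv (\<lambda>i. dual (cs ! i)) {..<length cs} x" .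
qed

lemma infinitesimal_character_dual_nth:
  "set cs \<subseteq> C \<Longrightarrow> i \<in> {..<length cs} \<Longrightarrow> infinitesimal_character (dual (cs ! i))"
  by (rule infinitesimal_character_dual) (auto dest: nth_mem)

lemma linear_symmetrised_coeff: "set cs \<subseteq> C \<Longrightarrow> linear (symmetrised_coeff \<Delta> B cs)"
  by (simp add: symmetrised_coeff_eq)

lemma coproduct_coeff_nonneg:
  assumes "x \<in> basis" "set zs \<subseteq> basis"
  shows "0 \<le> coproduct_coeff \<Delta> B x zs"
  unfolding coproduct_coeff_eq[OF assms(2)]
proof (rule conv_list_nonneg[OF _ _ assms(1)])
  fix f u assume "f \<in> set (map dual zs)" "u \<in> basis"
  then obtain c where "f = dual c" by auto
  with dual_nonneg[OF \<open>u \<in> basis\<close>] show "0 \<le> f u" by simp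
qed auto

lemma symmetrised_coeff_nonneg:
  assumes "set cs \<subseteq> C" "x \<in> basis"
  shows "0 \<le> symmetrised_coeff \<Delta> B cs x"
  unfolding symmetrised_coeff_def
  by (intro sum_nonneg coproduct_coeff_nonneg set_permute_generators) (use assms in auto)

lemma symmetrised_coeff_hopf_power:
  "set cs \<subseteq> C \<Longrightarrow> k > 0 \<Longrightarrow>
    symmetrised_coeff \<Delta> B cs (hopf_power \<Delta> k x) = real k ^ length cs * symmetrised_coeff \<Delta> B cs x"
  using sym_conv_hopf_power[of k "{..<length cs}" "\<lambda>i. dual (cs ! i)" x]
  by (simp add: symmetrised_coeff_eq infinitesimal_character_dual_nth)

section \<open>Values of the eigenvector on products of generators\<close>

lemma dual_one_generator:
  assumes "e \<in> C"
  shows "dual 1 e = 0"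
  using dual_generator_prod_mset[OF assms, of "{#}"] dual_one_prod_mset[of "{#e#}"] assms by simp

lemma prod_list_map2_dual_nth:
  "length is = length es \<Longrightarrow> set es \<subseteq> basis \<Longrightarrow>
    prod_list (map2 (\<lambda>i e. dual (cs ! i) e) is es) = (if map ((!) cs) is = es then 1 else 0)"
  by (induction "is" es rule: list_induct2) (auto simp: dual_basis)

text \<open>Coefficient functionals take only the values 0 and 1 on generators, so an ordering in
  \<open>sym_conv_prod_list\<close> contributes exactly when it carries \<open>cs\<close> to
  \<open>es\<close>. For \<open>es = cs\<close> the count is the stabiliser.\<close>

lemma symmetrised_coeff_prod_list:
  assumes "set cs \<subseteq> C" "set es \<subseteq> C" "length es = length cs"
  shows "symmetrised_coeff \<Delta> B cs (prod_list es) =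
    fact (length cs) * real (card {\<sigma>. \<sigma> permutes {..<length cs} \<and> permute_list \<sigma> cs = es})"
proof -
  let ?S = "{..<length cs}" and ?d = "\<lambda>i. dual (cs ! i)"
  have "symmetrised_coeff \<Delta> B cs (prod_list es) =
      fact (card ?S) * (\<Sum>is\<in>permutations_of_set ?S. prod_list (map2 ?d is es))"
    unfolding symmetrised_coeff_eq[OF assms(1)]
    by (rule sym_conv_prod_list)
      (use assms infinitesimal_character_dual_nth dual_one_generator in auto)
  also have "(\<Sum>is\<in>permutations_of_set ?S. prod_list (map2 ?d is es)) =
      (\<Sum>is\<in>permutations_of_set ?S. if map ((!) cs) is = es then 1 else 0)"
    using assms generator_in_basis
    by (intro sum.cong refl prod_list_map2_dual_nth) (auto simp: length_finite_permutations_of_set)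
  also have "\<dots> = (\<Sum>\<sigma> | \<sigma> permutes ?S. if permute_list \<sigma> cs = es then 1 else 0)"
    unfolding permute_list_eq_map
    by (rule sum.reindex_bij_betw[OF bij_betw_permutes_permutations_of_set, symmetric])
  also have "\<dots> = real (card {\<sigma>. \<sigma> permutes ?S \<and> permute_list \<sigma> cs = es})"
    by (simp add: sum.inter_filter[symmetric] finite_permutations)
  finally show ?thesis by simp
qed

lemma symmetrised_coeff_self:
  "set cs \<subseteq> C \<Longrightarrow> symmetrised_coeff \<Delta> B cs (prod_list cs) = fact (length cs) * real (stabiliser_size cs)"
  by (simp add: symmetrised_coeff_prod_list stabiliser_size_def)

text \<open>More factors than \<open>cs\<close> are excluded by the pigeonhole vanishing. With
  equally many, a non-zero value yields a permutation from \<open>cs\<close> to \<open>es\<close>,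
  and the two products coincide.\<close>

lemma symmetrised_coeff_nonzero_shorter:
  assumes "set cs \<subseteq> C" "z \<in> basis" "symmetrised_coeff \<Delta> B cs z \<noteq> 0" "z \<noteq> prod_list cs"
  obtains es where "set es \<subseteq> C" "z = prod_list es" "length es < length cs"
proof -
  obtain es where es: "set es \<subseteq> C" "z = prod_list es"
    using assms(2) by (rule basis_factorisation)
  have "\<not> length es > length cs"
  proof
    assume "length es > length cs"
    then have "symmetrised_coeff \<Delta> B cs (prod_list es) = 0"
      unfolding symmetrised_coeff_eq[OF assms(1)] using es assms(1)
      by (intro sym_conv_prod_list_eq_0) (auto intro: infinitesimal_character_dual_nth dual_one_generator)
    then show False using assms(3) es by simp
  qed
  moreover have "length es \<noteq> length cs"
  proof
    assume len: "length es = length cs"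
    then have "card {\<sigma>. \<sigma> permutes {..<length cs} \<and> permute_list \<sigma> cs = es} \<noteq> 0"
      using assms(1,3) es by (simp add: symmetrised_coeff_prod_list)
    then have "{\<sigma>. \<sigma> permutes {..<length cs} \<and> permute_list \<sigma> cs = es} \<noteq> {}"
      by (metis card.empty)
    then obtain \<sigma> where "\<sigma> permutes {..<length cs}" "permute_list \<sigma> cs = es" by blast
    then have "mset es = mset cs" by (metis mset_permute_list)
    then have "prod_list es = prod_list cs" by (metis prod_mset_prod_list)
    then show False using assms(4) es by simp
  qed
  ultimately show ?thesis using that es by force
qed

section \<open>Reachability and positivity\<close>

lemma reaches_refl: "y \<in> basis \<Longrightarrow> reaches \<Delta> B y y"
  unfolding reaches_def using dual_basis[of y y] by (intro exI[of _ 1]) (simp add: dual_def)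

text \<open>Subtracting from \<open>?F\<close> its part at \<open>?y\<close> leaves a functional
  that is non-negative on the cone, so at the Hopf power of \<open>x\<close> the value of
  \<open>?F\<close> is at least \<open>?F ?y\<close> times the positive coefficient of
  \<open>?y\<close>. The eigenvector equation for this \<open>b\<close> carries positivity back to
  \<open>x\<close>.\<close>

lemma symmetrised_coeff_pos_if_reaches:
  assumes cs: "set cs \<subseteq> C" and x: "x \<in> basis" and reach: "reaches \<Delta> B x (prod_list cs)"
  shows "0 < symmetrised_coeff \<Delta> B cs x"
proof -
  let ?F = "symmetrised_coeff \<Delta> B cs" and ?y = "prod_list cs"
  have y: "?y \<in> basis" using B_prod_list[OF cs] by blast
  obtain b where b: "b \<ge> 1" "dual ?y (hopf_power \<Delta> b x) \<noteq> 0"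
    using reach by (auto simp: reaches_def dual_def)
  have Fy: "?F ?y > 0" using stabiliser_size_pos[of cs] by (simp add: symmetrised_coeff_self cs)
  have "0 \<le> ?F (hopf_power \<Delta> b x) - ?F ?y * dual ?y (hopf_power \<Delta> b x)"
  proof (rule nonneg_on_cone)
    show "linear (\<lambda>v. ?F v - ?F ?y * dual ?y v)"
      using linear_symmetrised_coeff[OF cs] linear_compose_scale_right[OF linear_dual, of "?F ?y" ?y]
      by (intro linear_compose_sub) auto
    show "0 \<le> ?F u - ?F ?y * dual ?y u" if "u \<in> basis" for u
      using that symmetrised_coeff_nonneg[OF cs that] by (simp add: dual_basis[OF that])
    show "0 \<le> dual c (hopf_power \<Delta> b x)" for c
      using b x by (intro dual_hopf_power_nonneg) auto
  qed
  moreover have "0 < ?F ?y * dual ?y (hopf_power \<Delta> b x)"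
    using Fy b dual_hopf_power_nonneg[of b x ?y] x by (intro mult_pos_pos) auto
  ultimately have "0 < real b ^ length cs * ?F x"
    using symmetrised_coeff_hopf_power[OF cs, of b x] b by simp
  then show ?thesis using b by (simp add: zero_less_mult_iff)
qed

section \<open>Comparison of coproduct coefficients with the rescaling function\<close>

lemma conv_list_rescale: "conv_list (map (\<lambda>c. rescale (d c)) zs) = rescale (\<Sum>c\<leftarrow>zs. d c)"
  by (induction zs) (simp_all add: rescale_add)

lemma rescale_dual_le:
  assumes "b \<in> basis" "u \<in> basis"
  shows "rescale k b * dual b u \<le> rescale k u"
  using assms by (simp add: dual_basis[OF assms(2)] rescale_nonneg del: UN_iff)

text \<open>When \<open>d\<close> is the degree, the right side weighs all ways of breaking
  \<open>x\<close> into pieces of degree one, and the left side only those that pass through the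
  pieces \<open>zs\<close>. Formally, the bounds of \<open>rescale_dual_le\<close> are convolved
  over \<open>zs\<close>.\<close>

lemma coproduct_coeff_le_rescale:
  assumes zs: "set zs \<subseteq> basis" and x: "x \<in> basis"
  shows "(\<Prod>c\<leftarrow>zs. rescale (d c) c) * coproduct_coeff \<Delta> B x zs \<le> rescale (\<Sum>c\<leftarrow>zs. d c) x"
proof -
  have scale: "linear (\<lambda>u. rescale k b * dual b u)" for k b
    using linear_compose_scale_right[OF linear_dual, of "rescale k b" b] by simp
  have "conv_list (map (\<lambda>c u. rescale (d c) c * dual c u) zs) x =
      (\<Prod>c\<leftarrow>zs. rescale (d c) c) * conv_list (map dual zs) x" for x
  proof (induction zs arbitrary: x)
    case Nil
    then show ?case by simp
  next
    case (Cons c zs)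
    have "conv_list (map (\<lambda>c u. rescale (d c) c * dual c u) zs) =
        (\<lambda>x. (\<Prod>c\<leftarrow>zs. rescale (d c) c) * conv_list (map dual zs) x)"
      by (rule ext) (rule Cons.IH)
    moreover have "linear (conv_list (map dual zs))"
      by (rule linear_conv_list) auto
    ultimately show ?case
      using convolution_scaleR[of "dual c" "conv_list (map dual zs)" "rescale (d c) c" "\<Prod>c\<leftarrow>zs. rescale (d c) c" x]
      by simp
  qed
  moreover have "conv_list (map (\<lambda>c u. rescale (d c) c * dual c u) zs) x \<le>
      conv_list (map (\<lambda>c. rescale (d c)) zs) x"
  proof (rule conv_list_mono)
    fix c u assume cu: "c \<in> set zs" "u \<in> basis"
    then have c: "c \<in> basis" using zs by blast
    show "rescale (d c) c * dual c u \<le> rescale (d c) u" by (rule rescale_dual_le[OF c cu(2)])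
    show "0 \<le> rescale (d c) c * dual c u"
      by (intro mult_nonneg_nonneg rescale_nonneg dual_nonneg c cu)
  qed (use x scale in auto)
  ultimately show ?thesis by (simp add: coproduct_coeff_eq[OF zs] conv_list_rescale)
qed

lemma degree_prod_list:
  assumes "set cs \<subseteq> C" "prod_list cs \<in> B n"
  shows "(\<Sum>c\<leftarrow>cs. basis_degree B c) = n"
  using degree_unique[OF assms(2)] B_subset_H[OF B_prod_list[OF assms(1)]] by simp

text \<open>The product of the \<open>\<eta>(c)\<close> and the sum of the degrees do not depend on
  the order, so all \<open>l!\<close> permuted coefficients obey one bound. By
  \<open>rescale_prod_list\<close> the multinomial coefficient divided by \<open>\<eta>(y)\<close>
  is the reciprocal of that product.\<close>

lemma symmetrised_coeff_le:
  assumes cs: "set cs \<subseteq> C" "prod_list cs \<in> B n" and x: "x \<in> B n"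
  shows "symmetrised_coeff \<Delta> B cs x / (fact (length cs) * rescaling \<Delta> B x) \<le>
    1 / rescaling \<Delta> B (prod_list cs) * (fact n / (\<Prod>c\<leftarrow>cs. fact (basis_degree B c)))"
proof -
  let ?P = "\<Prod>c\<leftarrow>cs. rescale (basis_degree B c) c"
  have deg: "(\<Sum>c\<leftarrow>cs. basis_degree B c) = n" by (rule degree_prod_list[OF cs])
  have "0 < rescale (basis_degree B c) c" if "c \<in> C" for c
    using that by (intro rescale_pos generator_degree)
  then have P: "0 < ?P"
    using cs(1) by (induction cs) auto
  have xpos: "0 < rescale n x" by (rule rescale_pos[OF x])
  have fact_pos: "0 < (\<Prod>c\<leftarrow>cs. fact (basis_degree B c) :: real)"
    by (induction cs) auto
  have "?P * symmetrised_coeff \<Delta> B cs x =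
      (\<Sum>\<sigma> | \<sigma> permutes {..<length cs}. ?P * coproduct_coeff \<Delta> B x (permute_list \<sigma> cs))"
    by (simp add: symmetrised_coeff_def sum_distrib_left)
  also have "\<dots> \<le> (\<Sum>\<sigma> | \<sigma> permutes {..<length cs}. rescale n x)"
  proof (rule sum_mono)
    fix \<sigma> assume "\<sigma> \<in> {\<sigma>. \<sigma> permutes {..<length cs}}"
    then have \<sigma>: "\<sigma> permutes {..<length cs}" by simp
    show "?P * coproduct_coeff \<Delta> B x (permute_list \<sigma> cs) \<le> rescale n x"
      using coproduct_coeff_le_rescale[OF set_permute_generators[OF cs(1) \<sigma>], of x "basis_degree B"] x
      by (auto simp: sum_list_permute_list[OF \<sigma>] prod_list_permute_list[OF \<sigma>] deg)
  qed
  also have "\<dots> = fact (length cs) * rescale n x"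
    by (simp add: card_permutations)
  finally have le: "?P * symmetrised_coeff \<Delta> B cs x \<le> fact (length cs) * rescale n x" .
  have "rescaling \<Delta> B (prod_list cs) = fact n / (\<Prod>c\<leftarrow>cs. fact (basis_degree B c)) * ?P"
    using rescale_prod_list[OF cs(1)] rescaling_eq[OF cs(2)] by (simp add: deg)
  then have "1 / rescaling \<Delta> B (prod_list cs) * (fact n / (\<Prod>c\<leftarrow>cs. fact (basis_degree B c))) = 1 / ?P"
    using fact_pos P by (simp add: field_simps)
  moreover have "symmetrised_coeff \<Delta> B cs x / (fact (length cs) * rescaling \<Delta> B x) \<le> 1 / ?P"
    using le P xpos by (simp add: rescaling_eq[OF x] field_simps)
  ultimately show ?thesis by simp
qed

section \<open>The normalised eigenfunction of the chain\<close>

lemma rescaling_pos: "x \<in> B n \<Longrightarrow> 0 < rescaling \<Delta> B x"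
  by (simp add: rescaling_eq rescale_pos)

lemma absorption_fn_nonneg:
  assumes "set cs \<subseteq> C" "x \<in> B n"
  shows "0 \<le> absorption_fn \<Delta> B cs x"
  using symmetrised_coeff_nonneg[OF assms(1) in_B_in_basis[OF assms(2)]] rescaling_pos[OF assms(2)]
  by (simp add: absorption_fn_def)

lemma absorption_fn_pos_if_reaches:
  assumes "set cs \<subseteq> C" "x \<in> B n" "reaches \<Delta> B x (prod_list cs)"
  shows "0 < absorption_fn \<Delta> B cs x"
  using symmetrised_coeff_pos_if_reaches[OF assms(1) in_B_in_basis[OF assms(2)] assms(3)]
    rescaling_pos[OF assms(2)] stabiliser_size_pos[of cs]
  by (simp add: absorption_fn_def)

text \<open>The normalisation by \<open>l! Z\<close> cancels the value of the eigenvector at its own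
  state. The reciprocal of what remains is the factor \<open>\<eta>(y)\<close> in the
  asymptotics.\<close>

lemma absorption_fn_self:
  assumes "set cs \<subseteq> C"
  shows "absorption_fn \<Delta> B cs (prod_list cs) = 1 / rescaling \<Delta> B (prod_list cs)"
  using stabiliser_size_pos[of cs] by (simp add: absorption_fn_def symmetrised_coeff_self[OF assms])

text \<open>The eigenvector is applied to the defining equation of \<open>K\<close>. The quotient of
  rescaling values there is a Doob transform, undone by the division by \<open>\<eta>\<close> inside
  \<open>absorption_fn\<close>; the prefactor \<open>1 / a ^ n\<close> shifts the exponent by
  \<open>n\<close>.\<close>

lemma absorption_fn_eigen:
  assumes cs: "set cs \<subseteq> C" and a: "a > 0" and K: "Hopf_power_transition_matrix \<Delta> B a n K" and x: "x \<in> B n"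
  shows "(\<Sum>z\<in>B n. K x z * absorption_fn \<Delta> B cs z) =
    real a powi (int (length cs) - int n) * absorption_fn \<Delta> B cs x"
proof -
  let ?F = "symmetrised_coeff \<Delta> B cs" and ?\<eta> = "rescaling \<Delta> B"
  let ?c = "fact (length cs) * real (stabiliser_size cs)"
  note lin = linear_symmetrised_coeff[OF cs]
  have "?\<eta> x > 0" by (rule rescaling_pos[OF x])
  have "(1 / real a ^ n) *\<^sub>R hopf_power \<Delta> a x = (\<Sum>z\<in>B n. (?\<eta> x / ?\<eta> z * K x z) *\<^sub>R z)"
    using K x by (simp add: Hopf_power_transition_matrix_def)
  from arg_cong[OF this, of ?F]
  have "real a ^ length cs / real a ^ n * ?F x = (\<Sum>z\<in>B n. ?\<eta> x / ?\<eta> z * K x z * ?F z)"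
    by (simp add: linear_sum[OF lin] linear_scale[OF lin] symmetrised_coeff_hopf_power[OF cs a])
  also have "real a ^ length cs / real a ^ n = real a powi (int (length cs) - int n)"
    using a by (simp add: power_int_diff)
  also have "(\<Sum>z\<in>B n. ?\<eta> x / ?\<eta> z * K x z * ?F z) = (\<Sum>z\<in>B n. (?\<eta> x * ?c) * (K x z * absorption_fn \<Delta> B cs z))"
    using stabiliser_size_pos[of cs] by (intro sum.cong refl) (simp add: absorption_fn_def)
  also have "\<dots> = (?\<eta> x * ?c) * (\<Sum>z\<in>B n. K x z * absorption_fn \<Delta> B cs z)"
    by (simp add: sum_distrib_left)
  finally show ?thesis
    using \<open>?\<eta> x > 0\<close> stabiliser_size_pos[of cs] by (simp add: absorption_fn_def field_simps)
qed

end

section \<open>Finite Markov chains\<close>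

locale finite_Markov_chain = prob_space M for M :: "'w measure" +
  fixes S :: "'s set" and K :: "'s \<Rightarrow> 's \<Rightarrow> real" and X :: "nat \<Rightarrow> 'w \<Rightarrow> 's"
  assumes Markov: "Markov_chain M S K X" and finite_S: "finite S"
begin

text \<open>Joint instead of conditional probabilities avoid null events. The choice
  \<open>A = {x0}\<close> serves a fixed start, up to one division at the end, and
  \<open>A = UNIV\<close> an arbitrary starting distribution.\<close>

definition joint :: "'s set \<Rightarrow> nat \<Rightarrow> 's \<Rightarrow> real" where
  "joint A m s = \<P>(\<omega> in M. X m \<omega> = s \<and> X 0 \<omega> \<in> A)"

lemma joint_nonneg: "0 \<le> joint A m s"
  by (simp add: joint_def)

lemma measurable_X: "X m \<in> measurable M (count_space S)"
  using Markov by (simp add: Markov_chain_def)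

lemma X_in_S: "\<omega> \<in> space M \<Longrightarrow> X m \<omega> \<in> S"
  using measurable_space[OF measurable_X] by simp

lemma event_X: "{\<omega> \<in> space M. P (X m \<omega>)} \<in> events"
proof -
  have "{\<omega> \<in> space M. P (X m \<omega>)} = X m -` {s \<in> S. P s} \<inter> space M"
    using X_in_S by auto
  then show ?thesis using measurable_sets[OF measurable_X, of "{s \<in> S. P s}"] by simp
qed

lemma event_path: "{\<omega> \<in> space M. \<forall>i\<le>m. X i \<omega> = s i} \<in> events"
proof -
  have "{\<omega> \<in> space M. \<forall>i\<le>m. X i \<omega> = s i} = (\<Inter>i\<in>{..m}. {\<omega> \<in> space M. X i \<omega> = s i})"
    by auto
  then show ?thesis using event_X by (simp add: sets.finite_INT)
qed

text \<open>The Markov property speaks of histories of positive probability. For a null history both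
  sides are 0.\<close>

lemma path_step:
  assumes "t \<in> S"
  shows "\<P>(\<omega> in M. X (Suc m) \<omega> = t \<and> (\<forall>i\<le>m. X i \<omega> = s i)) = K (s m) t * \<P>(\<omega> in M. \<forall>i\<le>m. X i \<omega> = s i)"
proof (cases "\<P>(\<omega> in M. \<forall>i\<le>m. X i \<omega> = s i) > 0")
  case True
  have "\<P>(\<omega> in M. X (Suc m) \<omega> = t \<bar> \<forall>i\<le>m. X i \<omega> = s i) = K (s m) t"
    using Markov assms True by (simp add: Markov_chain_def)
  then show ?thesis using True by (simp add: cond_prob_def divide_simps split: if_splits)
next
  case False
  then have zero: "\<P>(\<omega> in M. \<forall>i\<le>m. X i \<omega> = s i) = 0"
    by (simp add: zero_less_measure_iff)
  have "\<P>(\<omega> in M. X (Suc m) \<omega> = t \<and> (\<forall>i\<le>m. X i \<omega> = s i)) \<le> \<P>(\<omega> in M. \<forall>i\<le>m. X i \<omega> = s i)"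
    by (rule finite_measure_mono[OF _ event_path]) auto
  then show ?thesis using zero by (simp add: measure_le_0_iff)
qed

text \<open>The Markov property conditions on the whole history. As the state space is finite, the
  event splits into finitely many histories, and in each of them the transition probability depends
  on the last state \<open>s\<close> alone.\<close>

lemma step:
  assumes "t \<in> S" "s \<in> S"
  shows "\<P>(\<omega> in M. X (Suc m) \<omega> = t \<and> X m \<omega> = s \<and> X 0 \<omega> \<in> A) = K s t * joint A m s"
proof -
  \<comment> \<open>Extensional functions on \<open>{..m}\<close> make the set of histories finite
    and the history of each outcome unique.\<close>
  define F where "F = {f \<in> PiE {..m} (\<lambda>_. S). f m = s \<and> f 0 \<in> A}"
  have fin: "finite F"
    unfolding F_def by (rule finite_subset[OF _ finite_PiE[of "{..m}" "\<lambda>_. S"]]) (auto simp: finite_S)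
  let ?E = "\<lambda>f. {\<omega> \<in> space M. \<forall>i\<le>m. X i \<omega> = f i}"
  let ?T = "\<lambda>f. {\<omega> \<in> space M. X (Suc m) \<omega> = t \<and> (\<forall>i\<le>m. X i \<omega> = f i)}"
  have path: "restrict (\<lambda>i. X i \<omega>) {..m} \<in> F" if "\<omega> \<in> space M" "X m \<omega> = s" "X 0 \<omega> \<in> A" for \<omega>
    using that X_in_S by (auto simp: F_def)
  have "\<omega> \<in> (\<Union>f\<in>F. ?E f)" if "\<omega> \<in> space M" "X m \<omega> = s" "X 0 \<omega> \<in> A" for \<omega>
    using path[OF that] that by (intro UN_I[of "restrict (\<lambda>i. X i \<omega>) {..m}"]) auto
  then have E: "{\<omega> \<in> space M. X m \<omega> = s \<and> X 0 \<omega> \<in> A} = (\<Union>f\<in>F. ?E f)"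
    by (auto simp: F_def)
  have "\<omega> \<in> (\<Union>f\<in>F. ?T f)" if "\<omega> \<in> space M" "X (Suc m) \<omega> = t" "X m \<omega> = s" "X 0 \<omega> \<in> A" for \<omega>
    using path[of \<omega>] that by (intro UN_I[of "restrict (\<lambda>i. X i \<omega>) {..m}"]) auto
  then have T: "{\<omega> \<in> space M. X (Suc m) \<omega> = t \<and> X m \<omega> = s \<and> X 0 \<omega> \<in> A} = (\<Union>f\<in>F. ?T f)"
    by (auto simp: F_def)
  have T_inter: "?T f = ?E f \<inter> {\<omega> \<in> space M. X (Suc m) \<omega> = t}" for f by auto
  have T_event: "?T f \<in> events" for f
    unfolding T_inter by (intro sets.Int event_path event_X)
  have disj: "f = g" if "f \<in> F" "g \<in> F" "\<omega> \<in> space M" "\<forall>i\<le>m. X i \<omega> = f i" "\<forall>i\<le>m. X i \<omega> = g i" for f g \<omega>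
    using that by (intro PiE_ext[of f "{..m}" "\<lambda>_. S" g]) (auto simp: F_def)
  have "prob (\<Union>f\<in>F. ?T f) = (\<Sum>f\<in>F. prob (?T f))"
    using disj by (intro finite_measure_finite_Union fin) (auto simp: disjoint_family_on_def T_event)
  also have "\<dots> = (\<Sum>f\<in>F. K s t * prob (?E f))"
    using path_step[OF assms(1)] by (intro sum.cong refl) (auto simp: F_def)
  also have "\<dots> = K s t * prob (\<Union>f\<in>F. ?E f)"
    unfolding sum_distrib_left[symmetric] using disj
    by (subst finite_measure_finite_Union[OF fin]) (auto simp: disjoint_family_on_def event_path)
  finally show ?thesis unfolding joint_def E T .
qed

lemma prob_eq_sum_joint:
  "\<P>(\<omega> in M. R (X m \<omega>) \<and> X 0 \<omega> \<in> A) = (\<Sum>s\<in>{s \<in> S. R s}. joint A m s)"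
proof -
  have eq: "{\<omega> \<in> space M. R (X m \<omega>) \<and> X 0 \<omega> \<in> A} =
      (\<Union>s\<in>{s \<in> S. R s}. {\<omega> \<in> space M. X m \<omega> = s \<and> X 0 \<omega> \<in> A})"
    using X_in_S by auto
  have "{\<omega> \<in> space M. X m \<omega> = s \<and> X 0 \<omega> \<in> A} \<in> events" for s
    by (intro sets.sets_Collect_conj event_X)
  then show ?thesis
    unfolding eq joint_def using finite_S
    by (intro finite_measure_finite_Union) (auto simp: disjoint_family_on_def)
qed

lemma joint_Suc:
  assumes "t \<in> S"
  shows "joint A (Suc m) t = (\<Sum>s\<in>S. joint A m s * K s t)"
proof -
  have eq: "{\<omega> \<in> space M. X (Suc m) \<omega> = t \<and> X 0 \<omega> \<in> A} =
      (\<Union>s\<in>S. {\<omega> \<in> space M. X (Suc m) \<omega> = t \<and> X m \<omega> = s \<and> X 0 \<omega> \<in> A})"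
    using X_in_S by auto
  have "{\<omega> \<in> space M. X (Suc m) \<omega> = t \<and> X m \<omega> = s \<and> X 0 \<omega> \<in> A} \<in> events" for s
    by (intro sets.sets_Collect_conj event_X)
  then have "joint A (Suc m) t = (\<Sum>s\<in>S. \<P>(\<omega> in M. X (Suc m) \<omega> = t \<and> X m \<omega> = s \<and> X 0 \<omega> \<in> A))"
    unfolding eq joint_def using finite_S
    by (intro finite_measure_finite_Union) (auto simp: disjoint_family_on_def)
  also have "\<dots> = (\<Sum>s\<in>S. joint A m s * K s t)"
    by (intro sum.cong refl) (simp add: step[OF assms])
  finally show ?thesis .
qed

lemma sum_joint_eigen:
  assumes "\<And>s. s \<in> S \<Longrightarrow> (\<Sum>t\<in>S. K s t * g t) = r * g s"
  shows "(\<Sum>s\<in>S. joint A m s * g s) = r ^ m * (\<Sum>s\<in>S. joint A 0 s * g s)"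
proof (induction m)
  case 0
  show ?case by simp
next
  case (Suc m)
  have "(\<Sum>t\<in>S. joint A (Suc m) t * g t) = (\<Sum>t\<in>S. \<Sum>s\<in>S. joint A m s * K s t * g t)"
    by (simp add: joint_Suc sum_distrib_right)
  also have "\<dots> = (\<Sum>s\<in>S. \<Sum>t\<in>S. joint A m s * K s t * g t)"
    by (rule sum.swap)
  also have "\<dots> = (\<Sum>s\<in>S. joint A m s * (r * g s))"
    by (simp add: assms[symmetric] sum_distrib_left mult.assoc)
  also have "\<dots> = r * (\<Sum>s\<in>S. joint A m s * g s)"
    by (simp add: sum_distrib_left mult_ac)
  finally show ?case by (simp add: Suc.IH)
qed

lemma sum_joint_start:
  assumes "x0 \<in> S"
  shows "(\<Sum>s\<in>S. joint {x0} 0 s * g s) = \<P>(\<omega> in M. X 0 \<omega> = x0) * g x0"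
proof -
  have "joint {x0} 0 s = (if s = x0 then \<P>(\<omega> in M. X 0 \<omega> = x0) else 0)" for s
  proof -
    have "{\<omega> \<in> space M. X 0 \<omega> = s \<and> X 0 \<omega> \<in> {x0}} = (if s = x0 then {\<omega> \<in> space M. X 0 \<omega> = x0} else {})"
      by auto
    then show ?thesis by (simp add: joint_def)
  qed
  then have "(\<Sum>s\<in>S. joint {x0} 0 s * g s) = (\<Sum>s\<in>S. if s = x0 then \<P>(\<omega> in M. X 0 \<omega> = x0) * g x0 else 0)"
    by (intro sum.cong refl) auto
  then show ?thesis using assms finite_S by simp
qed

lemma sum_joint_le:
  assumes "\<And>s. s \<in> S \<Longrightarrow> g s \<le> c"
  shows "(\<Sum>s\<in>S. joint UNIV 0 s * g s) \<le> c"
proof -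
  have "(\<Sum>s\<in>S. joint UNIV 0 s * g s) \<le> (\<Sum>s\<in>S. joint UNIV 0 s * c)"
    using assms by (intro sum_mono mult_left_mono joint_nonneg)
  also have "\<dots> = \<P>(\<omega> in M. True \<and> X 0 \<omega> \<in> UNIV) * c"
    using prob_eq_sum_joint[of "\<lambda>_. True" 0 UNIV] by (simp add: sum_distrib_right)
  also have "\<dots> = c" by (simp add: prob_space)
  finally show ?thesis .
qed

lemma cond_prob_eq_sum_joint:
  "\<P>(\<omega> in M. R (X m \<omega>) \<bar> X 0 \<omega> = x0) =
    (\<Sum>s\<in>{s \<in> S. R s}. joint {x0} m s) / \<P>(\<omega> in M. X 0 \<omega> = x0)"
  using prob_eq_sum_joint[of R m "{x0}"] by (simp add: cond_prob_def)

end

section \<open>The absorption probabilities\<close>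

locale Hopf_power_chain = free_state_space H \<Delta> B C + finite_Markov_chain M "B n" K X
  for H :: "nat \<Rightarrow> 'h::{real_algebra_1, comm_ring_1} set"
    and \<Delta> :: "'h \<Rightarrow> 'h tensor" and B C and M :: "'w measure" and n K X +
  fixes a :: nat and cs :: "'h list"
  assumes a_ge_2: "a \<ge> 2" and transition: "Hopf_power_transition_matrix \<Delta> B a n K"
    and generators: "set cs \<subseteq> C" and target: "prod_list cs \<in> B n"
begin

abbreviation eigenvalue :: "'h list \<Rightarrow> real" where
  "eigenvalue es \<equiv> real a powi (int (length es) - int n)"

lemma eigenvalue_pos: "0 < eigenvalue es"
  using a_ge_2 by simp

lemma eigenvalue_power: "real a powi ((int (length es) - int n) * int m) = eigenvalue es ^ m"
  by (simp add: power_int_mult)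

lemma sum_joint_absorption:
  assumes "set es \<subseteq> C"
  shows "(\<Sum>z\<in>B n. joint A m z * absorption_fn \<Delta> B es z) =
    eigenvalue es ^ m * (\<Sum>z\<in>B n. joint A 0 z * absorption_fn \<Delta> B es z)"
  using a_ge_2 by (intro sum_joint_eigen absorption_fn_eigen[OF assms _ transition]) auto

lemma joint_absorption_nonneg:
  "set es \<subseteq> C \<Longrightarrow> z \<in> B n \<Longrightarrow> 0 \<le> joint A m z * absorption_fn \<Delta> B es z"
  by (intro mult_nonneg_nonneg joint_nonneg absorption_fn_nonneg)

abbreviation live :: "'h set" where
  "live \<equiv> {x \<in> B n. reaches \<Delta> B x (prod_list cs)}"

lemma target_live: "prod_list cs \<in> live"
  using target reaches_refl[OF in_B_in_basis[OF target]] by simp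

lemma Min_absorption_pos: "0 < (MIN x\<in>live. absorption_fn \<Delta> B cs x)"
proof -
  have "0 < absorption_fn \<Delta> B cs x" if "x \<in> live" for x
    using that by (intro absorption_fn_pos_if_reaches generators) auto
  then show ?thesis using target_live by (subst Min_gr_iff) auto
qed

lemma sum_live_le:
  "(\<Sum>z\<in>live. joint A m z) \<le>
    eigenvalue cs ^ m * (\<Sum>z\<in>B n. joint A 0 z * absorption_fn \<Delta> B cs z) / (MIN x\<in>live. absorption_fn \<Delta> B cs x)"
proof -
  let ?f = "absorption_fn \<Delta> B cs" and ?m = "MIN x\<in>live. absorption_fn \<Delta> B cs x"
  have "(\<Sum>z\<in>live. joint A m z) * ?m = (\<Sum>z\<in>live. joint A m z * ?m)"
    by (simp add: sum_distrib_right)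
  also have "\<dots> \<le> (\<Sum>z\<in>live. joint A m z * ?f z)"
    by (intro sum_mono mult_left_mono joint_nonneg Min_le) auto
  also have "\<dots> \<le> (\<Sum>z\<in>B n. joint A m z * ?f z)"
    by (intro sum_mono2) (auto intro: joint_absorption_nonneg[OF generators])
  also have "\<dots> = eigenvalue cs ^ m * (\<Sum>z\<in>B n. joint A 0 z * ?f z)"
    by (rule sum_joint_absorption[OF generators])
  finally show ?thesis using Min_absorption_pos by (simp add: pos_le_divide_eq)
qed

lemma joint_ratio_tendsto_0:
  assumes z: "z \<in> B n" "absorption_fn \<Delta> B cs z \<noteq> 0" "z \<noteq> prod_list cs"
  shows "(\<lambda>m. joint A m z / eigenvalue cs ^ m) \<longlonglongrightarrow> 0"
proof -
  have "symmetrised_coeff \<Delta> B cs z \<noteq> 0"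
    using z(2) by (auto simp: absorption_fn_def)
  then obtain es where es: "set es \<subseteq> C" "z = prod_list es" "length es < length cs"
    using symmetrised_coeff_nonzero_shorter[OF generators in_B_in_basis[OF z(1)] _ z(3)] by blast
  let ?f = "absorption_fn \<Delta> B es"
  define c where "c = (\<Sum>x\<in>B n. joint A 0 x * ?f x) / ?f z"
  define r where "r = eigenvalue es / eigenvalue cs"
  have fz: "0 < ?f z"
    using z(1) es absorption_fn_pos_if_reaches[OF es(1) z(1)] reaches_refl[OF in_B_in_basis[OF z(1)]] by simp
  \<comment> \<open>The degree \<open>n\<close> cancels in the quotient of the eigenvalues and
    leaves a negative exponent, because \<open>z\<close> has fewer factors.\<close>
  have "r = real a powi (int (length es) - int (length cs))"
    using a_ge_2 by (simp add: r_def power_int_diff)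
  also have "\<dots> = 1 / real a ^ (length cs - length es)"
    using es(3) a_ge_2 by (simp add: power_int_def nat_diff_distrib divide_simps)
  also have "\<dots> < 1"
    using es(3) a_ge_2 by (simp add: one_less_power)
  finally have r: "r < 1" .
  have r0: "0 \<le> r" using eigenvalue_pos by (simp add: r_def less_imp_le)
  have bound: "joint A m z / eigenvalue cs ^ m \<le> c * r ^ m" for m
  proof -
    have "joint A m z * ?f z \<le> (\<Sum>x\<in>B n. joint A m x * ?f x)"
      using z(1) by (intro member_le_sum) (auto intro: joint_absorption_nonneg[OF es(1)])
    also have "\<dots> = eigenvalue es ^ m * (\<Sum>x\<in>B n. joint A 0 x * ?f x)"
      by (rule sum_joint_absorption[OF es(1)])
    finally have "joint A m z \<le> eigenvalue es ^ m * c"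
      using fz by (simp add: c_def pos_le_divide_eq)
    then have "joint A m z / eigenvalue cs ^ m \<le> eigenvalue es ^ m * c / eigenvalue cs ^ m"
      using eigenvalue_pos by (intro divide_right_mono) (auto simp: less_imp_le)
    then show ?thesis by (simp add: r_def power_divide mult.commute)
  qed
  have nonneg: "0 \<le> joint A m z / eigenvalue cs ^ m" for m
    by (intro divide_nonneg_nonneg joint_nonneg zero_le_power less_imp_le eigenvalue_pos)
  have "(\<lambda>m. c * r ^ m) \<longlonglongrightarrow> c * 0"
    using r r0 by (intro tendsto_mult_left LIMSEQ_realpow_zero)
  then have "(\<lambda>m. c * r ^ m) \<longlonglongrightarrow> 0" by simp
  then show ?thesis
    by (rule tendsto_sandwich[OF _ _ tendsto_const, rotated 2])
      (use bound nonneg in auto)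
qed

text \<open>After division by the eigenvalue power, the \<open>absorption_fn\<close>-weighted sum
  over all states is constant in \<open>m\<close>. Every term except the one at \<open>y\<close>
  tends to 0, so that term tends to the constant, and its weight is \<open>1 / \<eta>(y)\<close>.
  The remaining live states have positive weight, hence their probabilities are also
  negligible.\<close>

lemma sum_live_asymptotics:
  "(\<lambda>m. (\<Sum>z\<in>live. joint A m z) / eigenvalue cs ^ m) \<longlonglongrightarrow>
    rescaling \<Delta> B (prod_list cs) * (\<Sum>z\<in>B n. joint A 0 z * absorption_fn \<Delta> B cs z)"
proof -
  let ?f = "absorption_fn \<Delta> B cs" and ?y = "prod_list cs" and ?\<eta> = "rescaling \<Delta> B (prod_list cs)"
  let ?v = "\<lambda>m z. joint A m z / eigenvalue cs ^ m"
  let ?c = "\<Sum>z\<in>B n. joint A 0 z * ?f z"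
  have \<eta>: "?\<eta> > 0" by (rule rescaling_pos[OF target])
  \<comment> \<open>A state with \<open>?f z = 0\<close> need not become rare at this rate, but its
    term is identically 0.\<close>
  have zero: "(\<lambda>m. ?v m z * ?f z) \<longlonglongrightarrow> 0" if "z \<in> B n - {?y}" for z
    using joint_ratio_tendsto_0[of z A] that tendsto_mult_right[of "\<lambda>m. ?v m z" 0 sequentially "?f z"]
    by (cases "?f z = 0") auto
  have "?c - (\<Sum>z\<in>B n - {?y}. ?v m z * ?f z) = ?v m ?y / ?\<eta>" for m
  proof -
    have "?c = (\<Sum>z\<in>B n. ?v m z * ?f z)"
      using sum_joint_absorption[OF generators, of A m] a_ge_2
      by (auto simp: sum_divide_distrib[symmetric])
    also have "\<dots> = ?v m ?y * ?f ?y + (\<Sum>z\<in>B n - {?y}. ?v m z * ?f z)"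
      using target by (intro sum.remove) auto
    finally show ?thesis by (simp add: absorption_fn_self[OF generators])
  qed
  moreover have "(\<lambda>m. ?c - (\<Sum>z\<in>B n - {?y}. ?v m z * ?f z)) \<longlonglongrightarrow> ?c - (\<Sum>z\<in>B n - {?y}. 0)"
    by (intro tendsto_diff tendsto_const tendsto_sum zero)
  ultimately have "(\<lambda>m. ?v m ?y / ?\<eta>) \<longlonglongrightarrow> ?c" by simp
  then have "(\<lambda>m. ?\<eta> * (?v m ?y / ?\<eta>)) \<longlonglongrightarrow> ?\<eta> * ?c" by (rule tendsto_mult_left)
  then have y: "(\<lambda>m. ?v m ?y) \<longlonglongrightarrow> ?\<eta> * ?c" using \<eta> by simp
  have "(\<lambda>m. ?v m z) \<longlonglongrightarrow> 0" if "z \<in> live - {?y}" for z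
    using that absorption_fn_pos_if_reaches[OF generators, of z n] by (intro joint_ratio_tendsto_0) auto
  then have "(\<lambda>m. ?v m ?y + (\<Sum>z\<in>live - {?y}. ?v m z)) \<longlonglongrightarrow> ?\<eta> * ?c + (\<Sum>z\<in>live - {?y}. 0)"
    by (intro tendsto_add y tendsto_sum)
  moreover have "(\<Sum>z\<in>live. joint A m z) / eigenvalue cs ^ m = ?v m ?y + (\<Sum>z\<in>live - {?y}. ?v m z)" for m
    unfolding sum_divide_distrib by (rule sum.remove) (use target_live in auto)
  ultimately show ?thesis by simp
qed

lemma absorption_fn_eq:
  "absorption_fn \<Delta> B cs x = 1 / (fact (length cs) * real (stabiliser_size cs)) *
    (1 / rescaling \<Delta> B x * symmetrised_coeff \<Delta> B cs x)"
  by (simp add: absorption_fn_def)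

text \<open>Multiplication by the constant \<open>?k\<close> is monotone and so commutes with the
  minimum. This yields the second form of the first bound, where the constant cancels.\<close>

lemma Min_absorption_fn:
  "(MIN x\<in>live. absorption_fn \<Delta> B cs x) = 1 / (fact (length cs) * real (stabiliser_size cs)) *
    (MIN x\<in>live. 1 / rescaling \<Delta> B x * symmetrised_coeff \<Delta> B cs x)"
proof -
  let ?k = "1 / (fact (length cs) * real (stabiliser_size cs))"
  have "mono (\<lambda>t :: real. ?k * t)" by (intro monoI mult_left_mono) auto
  then have "?k * (MIN x\<in>live. 1 / rescaling \<Delta> B x * symmetrised_coeff \<Delta> B cs x) =
      Min ((\<lambda>t. ?k * t) ` ((\<lambda>x. 1 / rescaling \<Delta> B x * symmetrised_coeff \<Delta> B cs x) ` live))"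
    using target_live by (intro mono_Min_commute) auto
  then show ?thesis by (simp only: image_image absorption_fn_eq)
qed

lemma absorption_bound:
  assumes "x0 \<in> B n" "\<P>(\<omega> in M. X 0 \<omega> = x0) > 0"
  shows "\<P>(\<omega> in M. reaches \<Delta> B (X m \<omega>) (prod_list cs) \<bar> X 0 \<omega> = x0) \<le>
    real a powi ((int (length cs) - int n) * int m) * absorption_fn \<Delta> B cs x0
      / (MIN x\<in>live. absorption_fn \<Delta> B cs x)"
proof -
  have "(\<Sum>z\<in>live. joint {x0} m z) / \<P>(\<omega> in M. X 0 \<omega> = x0) \<le>
      (eigenvalue cs ^ m * (\<P>(\<omega> in M. X 0 \<omega> = x0) * absorption_fn \<Delta> B cs x0) /
        (MIN x\<in>live. absorption_fn \<Delta> B cs x)) / \<P>(\<omega> in M. X 0 \<omega> = x0)"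
    using sum_live_le[of "{x0}" m] assms by (intro divide_right_mono) (auto simp: sum_joint_start)
  then show ?thesis
    using assms(2) cond_prob_eq_sum_joint[of "\<lambda>x. reaches \<Delta> B x (prod_list cs)" m x0]
    unfolding eigenvalue_power by (simp add: mult.commute)
qed

lemma absorption_asymptotics:
  assumes "x0 \<in> B n" "\<P>(\<omega> in M. X 0 \<omega> = x0) > 0"
  shows "\<exists>\<epsilon>::nat \<Rightarrow> real. \<epsilon> \<longlonglongrightarrow> 0 \<and>
    (\<forall>m. \<P>(\<omega> in M. reaches \<Delta> B (X m \<omega>) (prod_list cs) \<bar> X 0 \<omega> = x0) =
      rescaling \<Delta> B (prod_list cs) * real a powi ((int (length cs) - int n) * int m)
        * absorption_fn \<Delta> B cs x0 * (1 + \<epsilon> m))"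
proof -
  let ?f = "absorption_fn \<Delta> B cs x0" and ?\<eta> = "rescaling \<Delta> B (prod_list cs)"
  let ?p0 = "\<P>(\<omega> in M. X 0 \<omega> = x0)"
  define p where "p m = \<P>(\<omega> in M. reaches \<Delta> B (X m \<omega>) (prod_list cs) \<bar> X 0 \<omega> = x0)" for m
  have \<eta>: "?\<eta> > 0" by (rule rescaling_pos[OF target])
  have "\<exists>\<epsilon>::nat \<Rightarrow> real. \<epsilon> \<longlonglongrightarrow> 0 \<and> (\<forall>m. p m = ?\<eta> * eigenvalue cs ^ m * ?f * (1 + \<epsilon> m))"
  \<comment> \<open>If the eigenfunction vanishes at the start, no relative error can be formed, but
    then the first bound makes the probability 0 for every \<open>m\<close>.\<close>
  proof (cases "?f = 0")
    case True
    have "p m = 0" for m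
    proof -
      have "p m \<le> 0" using absorption_bound[OF assms, of m] True by (simp add: p_def)
      moreover have "0 \<le> p m" by (simp add: p_def cond_prob_def)
      ultimately show ?thesis by simp
    qed
    then show ?thesis using True by (intro exI[of _ "\<lambda>_. 0"]) simp
  next
    case False
    define \<epsilon> where "\<epsilon> m = p m / (?\<eta> * eigenvalue cs ^ m * ?f) - 1" for m
    have "(\<lambda>m. (\<Sum>z\<in>live. joint {x0} m z) / eigenvalue cs ^ m) \<longlonglongrightarrow> ?\<eta> * (?p0 * ?f)"
      using sum_live_asymptotics[of "{x0}"] by (simp add: sum_joint_start[OF assms(1)])
    then have "(\<lambda>m. (\<Sum>z\<in>live. joint {x0} m z) / eigenvalue cs ^ m / (?\<eta> * (?p0 * ?f))) \<longlonglongrightarrow>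
        ?\<eta> * (?p0 * ?f) / (?\<eta> * (?p0 * ?f))"
      using False \<eta> assms(2) by (intro tendsto_divide tendsto_const) auto
    moreover have "(\<Sum>z\<in>live. joint {x0} m z) / eigenvalue cs ^ m / (?\<eta> * (?p0 * ?f)) = 1 + \<epsilon> m" for m
      using cond_prob_eq_sum_joint[of "\<lambda>x. reaches \<Delta> B x (prod_list cs)" m x0]
      by (simp add: \<epsilon>_def p_def mult_ac)
    ultimately have "(\<lambda>m. 1 + \<epsilon> m) \<longlonglongrightarrow> 1" using False \<eta> assms(2) by simp
    then have "\<epsilon> \<longlonglongrightarrow> 0" using tendsto_diff[of "\<lambda>m. 1 + \<epsilon> m" 1 sequentially "\<lambda>_. 1" 1] by simp
    moreover have "p m = ?\<eta> * eigenvalue cs ^ m * ?f * (1 + \<epsilon> m)" for m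
      using False \<eta> a_ge_2 by (auto simp: \<epsilon>_def)
    ultimately show ?thesis by blast
  qed
  then show ?thesis by (simp only: p_def eigenvalue_power)
qed

text \<open>The initial mean of the eigenfunction is bounded through a uniform bound on its values,
  supplied by \<open>symmetrised_coeff_le\<close>.\<close>

lemma absorption_bound_any_start:
  "\<P>(\<omega> in M. reaches \<Delta> B (X m \<omega>) (prod_list cs)) \<le>
    real a powi ((int (length cs) - int n) * int m)
      / ((MIN x\<in>live. absorption_fn \<Delta> B cs x) * real (stabiliser_size cs))
    * (1 / rescaling \<Delta> B (prod_list cs) * (fact n / (\<Prod>c\<leftarrow>cs. fact (basis_degree B c))))"
proof -
  let ?b = "1 / rescaling \<Delta> B (prod_list cs) * (fact n / (\<Prod>c\<leftarrow>cs. fact (basis_degree B c)))"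
  let ?Z = "real (stabiliser_size cs)"
  have Z: "?Z > 0" using stabiliser_size_pos[of cs] by simp
  have "absorption_fn \<Delta> B cs x \<le> ?b / ?Z" if "x \<in> B n" for x
  proof -
    have "absorption_fn \<Delta> B cs x = symmetrised_coeff \<Delta> B cs x / (fact (length cs) * rescaling \<Delta> B x) / ?Z"
      by (simp add: absorption_fn_def)
    then show ?thesis
      using symmetrised_coeff_le[OF generators target that] Z by (simp only: divide_right_mono less_imp_le)
  qed
  then have "(\<Sum>z\<in>B n. joint UNIV 0 z * absorption_fn \<Delta> B cs z) \<le> ?b / ?Z"
    by (rule sum_joint_le)
  then have "eigenvalue cs ^ m * (\<Sum>z\<in>B n. joint UNIV 0 z * absorption_fn \<Delta> B cs z) / (MIN x\<in>live. absorption_fn \<Delta> B cs x)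
      \<le> eigenvalue cs ^ m * (?b / ?Z) / (MIN x\<in>live. absorption_fn \<Delta> B cs x)"
    using eigenvalue_pos[of cs] Min_absorption_pos
    by (intro divide_right_mono mult_left_mono) (auto simp: less_imp_le)
  moreover have "\<P>(\<omega> in M. reaches \<Delta> B (X m \<omega>) (prod_list cs)) = (\<Sum>z\<in>live. joint UNIV m z)"
    using prob_eq_sum_joint[of "\<lambda>x. reaches \<Delta> B x (prod_list cs)" m UNIV] by simp
  ultimately have "\<P>(\<omega> in M. reaches \<Delta> B (X m \<omega>) (prod_list cs)) \<le>
      eigenvalue cs ^ m * (?b / ?Z) / (MIN x\<in>live. absorption_fn \<Delta> B cs x)"
    using sum_live_le[of UNIV m] by linarith
  then show ?thesis unfolding eigenvalue_power by (simp add: mult_ac)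
qed

end

theorem proposition5p1p11:
  fixes H :: "nat \<Rightarrow> 'h::{real_algebra_1, comm_ring_1} set"
    and \<Delta> :: "'h \<Rightarrow> 'h tensor"
    and B :: "nat \<Rightarrow> 'h set"
    and C :: "'h set"
    and a n :: nat
    and K :: "'h \<Rightarrow> 'h \<Rightarrow> real"
    and M :: "'w measure"
    and X :: "nat \<Rightarrow> 'w \<Rightarrow> 'h"
    and y :: 'h
    and cs :: "'h list"
  assumes "graded_connected_Hopf_algebra H \<Delta>"
    and "\<forall>k. \<exists>S. finite S \<and> span S = H k"
    and "state_space_basis H \<Delta> B"
    and "free_commutative_basis H B C"
    and "a \<ge> 2"
    and "Hopf_power_transition_matrix \<Delta> B a n K"
    and "Markov_chain M (B n) K X"
    and "y \<in> B n"
    and "set cs \<subseteq> C" and "y = prod_list cs"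
  shows
    "(\<forall>x0\<in>B n. \<forall>m.
        (\<P>(\<omega> in M. X 0 \<omega> = x0) > 0 \<longrightarrow>
           \<P>(\<omega> in M. reaches \<Delta> B (X m \<omega>) y \<bar> X 0 \<omega> = x0) \<le>
             real a powi ((int (length cs) - int n) * int m) * absorption_fn \<Delta> B cs x0
               / (MIN x\<in>{x\<in>B n. reaches \<Delta> B x y}. absorption_fn \<Delta> B cs x)) \<and>
        real a powi ((int (length cs) - int n) * int m) * absorption_fn \<Delta> B cs x0
            / (MIN x\<in>{x\<in>B n. reaches \<Delta> B x y}. absorption_fn \<Delta> B cs x) =
          real a powi ((int (length cs) - int n) * int m)
              * (1 / rescaling \<Delta> B x0 * symmetrised_coeff \<Delta> B cs x0)
            / (MIN x\<in>{x\<in>B n. reaches \<Delta> B x y}.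
                 1 / rescaling \<Delta> B x * symmetrised_coeff \<Delta> B cs x)) \<and>
     (\<forall>x0\<in>B n. \<P>(\<omega> in M. X 0 \<omega> = x0) > 0 \<longrightarrow>
        (\<exists>\<epsilon>::nat \<Rightarrow> real. \<epsilon> \<longlonglongrightarrow> 0 \<and>
           (\<forall>m. \<P>(\<omega> in M. reaches \<Delta> B (X m \<omega>) y \<bar> X 0 \<omega> = x0) =
              rescaling \<Delta> B y * real a powi ((int (length cs) - int n) * int m)
                * absorption_fn \<Delta> B cs x0 * (1 + \<epsilon> m)))) \<and>
     (\<forall>m. \<P>(\<omega> in M. reaches \<Delta> B (X m \<omega>) y) \<le>
        real a powi ((int (length cs) - int n) * int m)
          / ((MIN x\<in>{x\<in>B n. reaches \<Delta> B x y}. absorption_fn \<Delta> B cs x)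
               * real (stabiliser_size cs))
        * (1 / rescaling \<Delta> B y * (fact n / (\<Prod>c\<leftarrow>cs. fact (basis_degree B c)))))"
proof -
  interpret free_state_space H \<Delta> B C
    using assms by (simp add: free_state_space_def)
  interpret prob_space M
    using \<open>Markov_chain M (B n) K X\<close> by (simp add: Markov_chain_def)
  interpret Hopf_power_chain H \<Delta> B C M n K X a cs
    by unfold_locales (use assms in simp_all)
  note y = \<open>y = prod_list cs\<close>
  show ?thesis
    unfolding y
  proof (intro conjI ballI allI impI)
    fix x0 m
    assume "x0 \<in> B n"
    show "real a powi ((int (length cs) - int n) * int m) * absorption_fn \<Delta> B cs x0
            / (MIN x\<in>live. absorption_fn \<Delta> B cs x) =
          real a powi ((int (length cs) - int n) * int m)
              * (1 / rescaling \<Delta> B x0 * symmetrised_coeff \<Delta> B cs x0)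
            / (MIN x\<in>live. 1 / rescaling \<Delta> B x * symmetrised_coeff \<Delta> B cs x)"
      using stabiliser_size_pos[of cs] unfolding Min_absorption_fn absorption_fn_eq[of x0] by simp
  qed (fact absorption_bound absorption_asymptotics absorption_bound_any_start)+
qed

end
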